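(* Let $\Omega\subset\mathbb{R}^d$ be uniformly convex, let $f,g\in C(\overline{\Omega})$ with $f\ge 0$ in $\Omega$, and let $u\in C(\overline\Omega)$ be the unique convex viscosity solution of $\det D^2u=f$ in $\Omega$, $u=g$ on $\partial\Omega$. For $\varepsilon=(h,\delta,\theta)$ let $u_\varepsilon$ be the discrete solution of the two-scale method, extended from $\overline{\Omega}_h$ to $\Omega$ by the closest-point extension (all defined in the context). Then $u_\varepsilon$ converges uniformly to $u$, i.e. $\|u-u_\varepsilon\|_{L^\infty(\Omega)}\to 0$, as $\varepsilon=(h,\delta,\theta)\to 0$ and $\frac{h}{\delta}\to 0$.
   Context: Setting. $d\ge 2$ and $\Omega\subset\mathbb{R}^d$ is a bounded domain. Uniformly convex means: $\Omega$ is convex and there is $R>0$ such that for every $z_0\in\partial\Omega$ and every inward unit normal $\nu$ of a supporting hyperplane of $\Omega$ at $z_0$, $\Omega$ is contained in the closed ball of radius $R$ centered at $z_0+R\nu$ (no smoothness of $\partial\Omega$ is assumed). Mesh. $\{\mathcal{T}_h\}$ is a shape-regular and quasi-uniform family of conforming simplicial triangulations with mesh size $h$ discretizing $\Omega$; $\Omega_h$ is the union of the elements of $\mathcal{T}_h$; $\mathcal{N}_h$ is the set of nodes (vertices), $\mathcal{N}_h^b=\mathcal{N}_h\cap\partial\Omega_h$ the boundary nodes, $\mathcal{N}_h^0=\mathcal{N}_h\setminus\mathcal{N}_h^b$ the interior nodes. It is assumed that $\mathcal{N}_h^b\subset\partial\Omega$, that $\Omega_h$ is convex with $\Omega_h\subset\Omega$,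 and that the Hausdorff distance $\mathrm{dist}_H(\Omega,\Omega_h)\to 0$ as $h\to 0$. $\mathbb{V}_h$ is the space of continuous functions on $\overline\Omega_h$ that are affine on each element of $\mathcal{T}_h$. Discrete operator. $\delta>0$ is the coarse scale. $\mathbb{S}$ is the unit sphere of $\mathbb{R}^d$ and $\mathbb{S}^\perp$ the set of orthonormal bases $\mathbf{v}=(v_1,\dots,v_d)$ of $\mathbb{R}^d$. For $\theta>0$, $\mathbb{S}_\theta\subset\mathbb{S}$ is a finite set such that every $v\in\mathbb{S}$ is within distance $\theta$ of some element of $\mathbb{S}_\theta$, and $\mathbb{S}^\perp_\theta\subset\mathbb{S}^\perp$ is a finite set of orthonormal bases with all components in $\mathbb{S}_\theta$ such that for every $\mathbf{v}\in\mathbb{S}^\perp$ there is $\mathbf{v}^\theta\in\mathbb{S}^\perp_\theta$ with $|v_j-v_j^\theta|\le\theta$ for all $1\le j\le d$. For $x_i\in\mathcal{N}_h^0$, $v\in\mathbb{S}$ and a continuous function $w$, $$\nabla^2_\delta w(x_i;v)=\frac{w(x_i+\rho\delta v)-2w(x_i)+w(x_i-\rho\delta v)}{\rho^2\delta^2},$$ where $\rho=\rho(x_i)\in(0,1]$ is the largest number with $x_i\pm\rho\delta v\in\overline\Omega_h$ for all $v\in\mathbb{S}$. Set $\nabla^{2,+}_\delta w=\max(\nabla^2_\delta w,0)$, $\nabla^{2,-}_\delta w=-\min(\nabla^2_\delta w,0)$ and $$T_\varepsilon[w](x_i)=\min_{\mathbf{v}\in\mathbb{S}^\perp_\theta}\Big(\prod_{j=1}^d\nabla^{2,+}_\delta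 w(x_i;v_j)-\sum_{j=1}^d\nabla^{2,-}_\delta w(x_i;v_j)\Big).$$ Discrete solution. $u_\varepsilon\in\mathbb{V}_h$ is the function with $u_\varepsilon(x_i)=g(x_i)$ for $x_i\in\mathcal{N}_h^b$ and $T_\varepsilon[u_\varepsilon](x_i)=f(x_i)$ for all $x_i\in\mathcal{N}_h^0$. It is extended to $\Omega$ by $u_\varepsilon(x):=u_\varepsilon(z)$ for $x\in\Omega\setminus\Omega_h$, where $z\in\partial\Omega_h$ is the (unique) closest point of $\overline\Omega_h$ to $x$. Viscosity solution. A convex function $u\in C(\overline\Omega)$ is a viscosity solution of the Dirichlet problem if $u=g$ on $\partial\Omega$ and, for every convex $\phi\in C^2(\Omega)$ and $x_0\in\Omega$: if $u-\phi$ has a local maximum at $x_0$ then $\det D^2\phi(x_0)\ge f(x_0)$, and if $u-\phi$ has a local minimum at $x_0$ then $\det D^2\phi(x_0)\le f(x_0)$. *)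

theory Defs
  imports "HOL-Analysis.Analysis"
begin

definition uniformly_convex :: "(real^'n) set \<Rightarrow> bool" where
  "uniformly_convex \<Omega> \<longleftrightarrow> convex \<Omega> \<and>
     (\<exists>R>0. \<forall>z\<in>frontier \<Omega>. \<forall>\<nu>. norm \<nu> = 1 \<and> (\<forall>x\<in>\<Omega>. 0 \<le> \<nu> \<bullet> (x - z))
        \<longrightarrow> \<Omega> \<subseteq> cball (z + R *\<^sub>R \<nu>) R)"

text \<open>All values are finite for nonempty bounded sets, the only case used.\<close>

definition hausdorff_distance :: "'a::metric_space set \<Rightarrow> 'a set \<Rightarrow> real" where
  "hausdorff_distance A B = max (SUP x\<in>A. infdist x B) (SUP y\<in>B. infdist y A)"

text \<open>Elements are closed simplices of full dimension; conformity (two elements meet in a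
  common face) is part of \<^const>\<open>triangulation\<close>.\<close>

definition simplicial_mesh :: "(real^'n) set set \<Rightarrow> bool" where
  "simplicial_mesh \<T> \<longleftrightarrow>
     \<T> \<noteq> {} \<and> triangulation \<T> \<and> (\<forall>K\<in>\<T>. int CARD('n) simplex K)"

definition mesh_size :: "(real^'n) set set \<Rightarrow> real" where
  "mesh_size \<T> = Max (diameter ` \<T>)"

definition inradius :: "(real^'n) set \<Rightarrow> real" where
  "inradius K = Sup {r. 0 \<le> r \<and> (\<exists>c. cball c r \<subseteq> K)}"

text \<open>A family of meshes is a function of the mesh size, restricted to a set of admissible
  mesh sizes.\<close>

definition shape_regular :: "real set \<Rightarrow> (real \<Rightarrow> (real^'n) set set) \<Rightarrow> bool" where
  "shape_regular H \<T> \<longleftrightarrow>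
     (\<exists>\<sigma>. \<forall>h\<in>H. \<forall>K\<in>\<T> h. diameter K \<le> \<sigma> * inradius K)"

definition quasi_uniform :: "real set \<Rightarrow> (real \<Rightarrow> (real^'n) set set) \<Rightarrow> bool" where
  "quasi_uniform H \<T> \<longleftrightarrow>
     (\<exists>c. \<forall>h\<in>H. \<forall>K\<in>\<T> h. mesh_size (\<T> h) \<le> c * diameter K)"

text \<open>The closed set written \<open>\<Omega>\<close> with a bar and index \<open>h\<close> in the literature.\<close>

definition mesh_domain :: "(real^'n) set set \<Rightarrow> (real^'n) set" where
  "mesh_domain \<T> = \<Union>\<T>"

definition nodes :: "(real^'n) set set \<Rightarrow> (real^'n) set" where
  "nodes \<T> = (\<Union>K\<in>\<T>. {x. x extreme_point_of K})"

definition boundary_nodes :: "(real^'n) set set \<Rightarrow> (real^'n) set" where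
  "boundary_nodes \<T> = nodes \<T> \<inter> frontier (mesh_domain \<T>)"

definition interior_nodes :: "(real^'n) set set \<Rightarrow> (real^'n) set" where
  "interior_nodes \<T> = nodes \<T> - boundary_nodes \<T>"

text \<open>Since \<^const>\<open>mesh_domain\<close> is closed and has its boundary nodes on the frontier of the
  open set \<open>\<Omega>\<close>, the inclusion of the discrete domain in \<open>\<Omega>\<close> is stated for the closures;
  by convexity this says that the interior of the mesh domain lies in \<open>\<Omega>\<close>.\<close>

definition discretizes :: "real set \<Rightarrow> (real \<Rightarrow> (real^'n) set set) \<Rightarrow> (real^'n) set \<Rightarrow> bool" where
  "discretizes H \<T> \<Omega> \<longleftrightarrow>
     (\<forall>h\<in>H. simplicial_mesh (\<T> h) \<and> mesh_size (\<T> h) = h \<and>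
        boundary_nodes (\<T> h) \<subseteq> frontier \<Omega> \<and>
        convex (mesh_domain (\<T> h)) \<and> mesh_domain (\<T> h) \<subseteq> closure \<Omega>) \<and>
     ((\<lambda>h. hausdorff_distance \<Omega> (mesh_domain (\<T> h))) \<longlongrightarrow> 0) (at 0 within H)"

text \<open>Values outside the mesh domain are unconstrained and never used.\<close>

definition fe_space :: "(real^'n) set set \<Rightarrow> (real^'n \<Rightarrow> real) set" where
  "fe_space \<T> = {w. continuous_on (mesh_domain \<T>) w \<and>
     (\<forall>K\<in>\<T>. \<exists>a b. \<forall>x\<in>K. w x = a \<bullet> x + b)}"

definition orthonormal_bases :: "('n \<Rightarrow> real^'n) set" where
  "orthonormal_bases = {v. \<forall>i j. v i \<bullet> v j = (if i = j then 1 else 0)}"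

definition direction_net :: "real \<Rightarrow> (real^'n) set \<Rightarrow> bool" where
  "direction_net \<theta> S \<longleftrightarrow> finite S \<and> S \<subseteq> sphere 0 1 \<and>
     (\<forall>v\<in>sphere 0 1. \<exists>w\<in>S. dist v w \<le> \<theta>)"

definition basis_net :: "real \<Rightarrow> (real^'n) set \<Rightarrow> ('n \<Rightarrow> real^'n) set \<Rightarrow> bool" where
  "basis_net \<theta> S P \<longleftrightarrow> finite P \<and> P \<subseteq> orthonormal_bases \<and> (\<forall>v\<in>P. \<forall>j. v j \<in> S) \<and>
     (\<forall>v\<in>orthonormal_bases. \<exists>w\<in>P. \<forall>j. norm (v j - w j) \<le> \<theta>)"

definition step_factor :: "(real^'n) set set \<Rightarrow> real \<Rightarrow> real^'n \<Rightarrow> real" where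
  "step_factor \<T> \<delta> x = (GREATEST \<rho>. 0 < \<rho> \<and> \<rho> \<le> 1 \<and>
     (\<forall>v\<in>sphere 0 1. x + (\<rho> * \<delta>) *\<^sub>R v \<in> mesh_domain \<T> \<and> x - (\<rho> * \<delta>) *\<^sub>R v \<in> mesh_domain \<T>))"

definition second_difference ::
  "(real^'n) set set \<Rightarrow> real \<Rightarrow> (real^'n \<Rightarrow> real) \<Rightarrow> real^'n \<Rightarrow> real^'n \<Rightarrow> real" where
  "second_difference \<T> \<delta> w x v =
     (let \<rho> = step_factor \<T> \<delta> x
      in (w (x + (\<rho> * \<delta>) *\<^sub>R v) - 2 * w x + w (x - (\<rho> * \<delta>) *\<^sub>R v)) / (\<rho>\<^sup>2 * \<delta>\<^sup>2))"

definition two_scale_operator ::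
  "(real^'n) set set \<Rightarrow> real \<Rightarrow> ('n \<Rightarrow> real^'n) set \<Rightarrow> (real^'n \<Rightarrow> real) \<Rightarrow> real^'n \<Rightarrow> real" where
  "two_scale_operator \<T> \<delta> P w x =
     Min ((\<lambda>v. (\<Prod>j\<in>UNIV. max (second_difference \<T> \<delta> w x (v j)) 0)
             - (\<Sum>j\<in>UNIV. - min (second_difference \<T> \<delta> w x (v j)) 0)) ` P)"

definition discrete_solution ::
  "(real^'n) set set \<Rightarrow> real \<Rightarrow> ('n \<Rightarrow> real^'n) set \<Rightarrow> (real^'n \<Rightarrow> real) \<Rightarrow> (real^'n \<Rightarrow> real)
     \<Rightarrow> (real^'n \<Rightarrow> real) \<Rightarrow> bool" where
  "discrete_solution \<T> \<delta> P f g w \<longleftrightarrow> w \<in> fe_space \<T> \<and>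
     (\<forall>x\<in>boundary_nodes \<T>. w x = g x) \<and>
     (\<forall>x\<in>interior_nodes \<T>. two_scale_operator \<T> \<delta> P w x = f x)"

definition extend_closest :: "(real^'n) set set \<Rightarrow> (real^'n \<Rightarrow> real) \<Rightarrow> real^'n \<Rightarrow> real" where
  "extend_closest \<T> w x =
     (if x \<in> mesh_domain \<T> then w x else w (closest_point (mesh_domain \<T>) x))"

text \<open>The limit \<open>(h, \<delta>, \<theta>) \<rightarrow> 0\<close> together with \<open>h / \<delta> \<rightarrow> 0\<close>, over positive \<open>\<delta>\<close>, \<open>\<theta>\<close> and
  admissible mesh sizes \<open>h \<in> H\<close>.\<close>

definition two_scale_limit :: "real set \<Rightarrow> (real \<times> real \<times> real) filter" where
  "two_scale_limit H =
     inf (filtercomap (\<lambda>(h, \<delta>, \<theta>). (h, \<delta>, \<theta>, h / \<delta>)) (nhds (0, 0, 0, 0)))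
         (principal {(h, \<delta>, \<theta>). h \<in> H \<and> 0 < \<delta> \<and> 0 < \<theta>})"

text \<open>\<open>G\<close> and \<open>D\<close> are the gradient and the Hessian matrix of \<open>\<phi>\<close>; on an open set both are
  determined by \<open>\<phi>\<close>.\<close>

definition C2_with_hessian ::
  "(real^'n) set \<Rightarrow> (real^'n \<Rightarrow> real) \<Rightarrow> (real^'n \<Rightarrow> real^'n) \<Rightarrow> (real^'n \<Rightarrow> real^'n^'n) \<Rightarrow> bool" where
  "C2_with_hessian \<Omega> \<phi> G D \<longleftrightarrow>
     (\<forall>x\<in>\<Omega>. (\<phi> has_derivative (\<lambda>y. G x \<bullet> y)) (at x) \<and>
             (G has_derivative (\<lambda>y. D x *v y)) (at x)) \<and>
     continuous_on \<Omega> D"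

definition viscosity_solution ::
  "(real^'n) set \<Rightarrow> (real^'n \<Rightarrow> real) \<Rightarrow> (real^'n \<Rightarrow> real) \<Rightarrow> (real^'n \<Rightarrow> real) \<Rightarrow> bool" where
  "viscosity_solution \<Omega> f g u \<longleftrightarrow>
     convex_on (closure \<Omega>) u \<and> continuous_on (closure \<Omega>) u \<and> (\<forall>x\<in>frontier \<Omega>. u x = g x) \<and>
     (\<forall>\<phi> G D. \<forall>x\<^sub>0\<in>\<Omega>. convex_on \<Omega> \<phi> \<and> C2_with_hessian \<Omega> \<phi> G D \<longrightarrow>
        ((\<forall>\<^sub>F x in nhds x\<^sub>0. u x - \<phi> x \<le> u x\<^sub>0 - \<phi> x\<^sub>0) \<longrightarrow> f x\<^sub>0 \<le> det (D x\<^sub>0)) \<and>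
        ((\<forall>\<^sub>F x in nhds x\<^sub>0. u x\<^sub>0 - \<phi> x\<^sub>0 \<le> u x - \<phi> x) \<longrightarrow> det (D x\<^sub>0) \<le> f x\<^sub>0))"

text \<open>Functions on the closure of \<open>\<Omega>\<close> are total functions here, so uniqueness means agreement
  on that closure.\<close>

definition unique_viscosity_solution ::
  "(real^'n) set \<Rightarrow> (real^'n \<Rightarrow> real) \<Rightarrow> (real^'n \<Rightarrow> real) \<Rightarrow> (real^'n \<Rightarrow> real) \<Rightarrow> bool" where
  "unique_viscosity_solution \<Omega> f g u \<longleftrightarrow> viscosity_solution \<Omega> f g u \<and>
     (\<forall>w. viscosity_solution \<Omega> f g w \<longrightarrow> (\<forall>x\<in>closure \<Omega>. w x = u x))"

end

theory Submission
  imports Defs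
begin

text \<open>No comparison principle for the Monge-Ampere equation is needed: Perron's method and the
  assumed uniqueness replace it.

  Discrete solutions lie between the quadratics \<open>c + p \<bullet> x + A |x|\<^sup>2 / 2\<close> with \<open>A\<^sup>d > max f\<close> below \<open>g\<close> on
  the boundary and the affine functions above \<open>g\<close>, which uniform convexity makes sharp at every boundary
  point. Their relaxed upper limit \<open>U\<close> is a convex subsolution and their relaxed lower limit \<open>L \<le> U\<close> is
  a supersolution: for a positive semidefinite Hessian the determinant is the minimum of
  \<open>\<Prod> v\<^sub>j \<bullet> M v\<^sub>j\<close> over orthonormal bases, and consistency is only required on quadratics. The largest
  subsolution below a supersolution with the right barriers is a viscosity solution, hence equals
  \<open>u\<close>. Below \<open>L\<close> this gives \<open>u \<le> L\<close>; below the infimum of the affine barriers, which is concave and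
  therefore a supersolution, it gives \<open>U \<le> u\<close>. So \<open>L = U = u\<close>, and compactness makes the convergence
  uniform.\<close>

section \<open>Symmetric matrices and orthonormal bases\<close>

text \<open>No modulus of continuity uniform in the parameters is at hand for the discrete
  solutions, so limits are taken in the relaxed sense and are at first only semicontinuous. This
  shapes the solution notions. They are tested with quadratics; C2 test functions appear once, when
  Perron's function is matched with \<open>viscosity_solution\<close>. Semidefiniteness of the test
  matrix is built into \<open>subsolution\<close>, because a determinant does not see an even number
  of negative directions; in the limit it is supplied by the negative sum in the discrete operator,
  and it makes subsolutions convex, hence continuous. \<open>supersolution\<close> is tested with
  positive definite matrices, since a degenerate convex quadratic has determinant 0, below f anyway.
  The two inequalities between the relaxed limits and u come from one construction with different
  obstacles V: any lower semicontinuous supersolution above L and below the affine barriers will do.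
  Uniform convexity enters through the slope of the barriers, and h / \<delta> \<rightarrow> 0
  through the interpolation error of quadratics divided by the squared step.\<close>

lemma symmetric_inner_commute:
  fixes M :: "real^'n^'n"
  assumes "transpose M = M"
  shows "x \<bullet> (M *v y) = y \<bullet> (M *v x)"
  by (metis assms dot_lmul_matrix inner_commute transpose_matrix_vector)

text \<open>First-order optimality in polynomial form. For the trial \<open>t\<close> below, the
  linear term equals \<open>- (t\<^sup>2 * (\<bar>b\<bar> + 1))\<close> and outweighs the quadratic
  one.\<close>

lemma linear_coeff_zero_of_nonneg:
  fixes a b :: real
  assumes "\<And>t. 0 \<le> t * a + t\<^sup>2 * b"
  shows "a = 0"
proof (rule ccontr)
  assume a: "a \<noteq> 0"
  define t where "t = - a / (\<bar>b\<bar> + 1)"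
  have p: "\<bar>b\<bar> + 1 > 0" by simp
  have "a = - (t * (\<bar>b\<bar> + 1))" using p by (simp add: t_def)
  then have "t * a + t\<^sup>2 * b = t\<^sup>2 * (b - (\<bar>b\<bar> + 1))" by algebra
  also have "\<dots> < 0" using a p by (intro mult_pos_neg) (auto simp: t_def)
  finally show False using assms[of t] by simp
qed

text \<open>The eigenvector maximizes the Rayleigh quotient on the unit sphere of \<open>S\<close>.
  Invariance of \<open>S\<close> keeps the residual \<open>c v - M v\<close> inside
  \<open>S\<close>, so it is an admissible direction of variation.\<close>

lemma symmetric_eigenvector_in_subspace:
  fixes M :: "real^'n^'n"
  assumes sym: "transpose M = M" and S: "subspace S" and inv: "\<And>x. x \<in> S \<Longrightarrow> M *v x \<in> S"
    and nz: "a \<in> S" "a \<noteq> 0"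
  obtains v c where "v \<in> S" "norm v = 1" "M *v v = c *\<^sub>R v"
proof -
  let ?K = "S \<inter> sphere 0 1"
  have "compact ?K" using closed_subspace[OF S] by (simp add: closed_Int_compact)
  moreover have "(1 / norm a) *\<^sub>R a \<in> ?K" using nz S by (simp add: subspace_scale)
  then have "?K \<noteq> {}" by blast
  moreover have "continuous_on ?K (\<lambda>x. x \<bullet> (M *v x))"
    by (intro continuous_on_inner continuous_on_id linear_continuous_on matrix_vector_mul_bounded_linear)
  ultimately have "\<exists>v\<in>?K. \<forall>x\<in>?K. x \<bullet> (M *v x) \<le> v \<bullet> (M *v v)"
    by (rule continuous_attains_sup)
  then obtain v where v: "v \<in> ?K" and max: "\<And>x. x \<in> ?K \<Longrightarrow> x \<bullet> (M *v x) \<le> v \<bullet> (M *v v)"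
    by blast
  define c where "c = v \<bullet> (M *v v)"
  have le: "x \<bullet> (M *v x) \<le> c * (x \<bullet> x)" if x: "x \<in> S" for x
  proof (cases "x = 0")
    case False
    then have "(1 / norm x) *\<^sub>R x \<in> ?K" using x S by (simp add: subspace_scale)
    from max[OF this] False have "x \<bullet> (M *v x) / (norm x)\<^sup>2 \<le> c"
      by (simp add: c_def matrix_vector_mult_scaleR power2_eq_square)
    then show ?thesis using False by (simp add: pos_divide_le_eq power2_norm_eq_inner)
  qed simp
  have "v \<bullet> v = 1" using v by (simp add: norm_eq_1)
  have vS: "v \<in> S" using v by simp
  \<comment> \<open>Varying \<open>v\<close> in the direction of the residual has first-order
    coefficient \<open>2 * (z \<bullet> z)\<close>, which maximality forces to vanish.\<close>
  define z where "z = c *\<^sub>R v - M *v v"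
  have zS: "z \<in> S" using vS S inv by (simp add: z_def subspace_diff subspace_scale)
  have "0 \<le> t * (2 * (z \<bullet> z)) + t\<^sup>2 * (c * (z \<bullet> z) - z \<bullet> (M *v z))" for t
  proof -
    have "v + t *\<^sub>R z \<in> S" using vS zS S by (simp add: subspace_add subspace_scale)
    from le[OF this]
    have "0 \<le> c * ((v + t *\<^sub>R z) \<bullet> (v + t *\<^sub>R z)) - (v + t *\<^sub>R z) \<bullet> (M *v (v + t *\<^sub>R z))"
      by (simp only: diff_ge_0_iff_ge)
    also have "\<dots> = t * (2 * (c * (z \<bullet> v) - z \<bullet> (M *v v))) + t\<^sup>2 * (c * (z \<bullet> z) - z \<bullet> (M *v z))"
    proof -
      have "M *v (v + t *\<^sub>R z) = M *v v + t *\<^sub>R (M *v z)"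
        by (simp add: matrix_vector_right_distrib matrix_vector_mult_scaleR)
      moreover have "v \<bullet> z = z \<bullet> v" "v \<bullet> (M *v z) = z \<bullet> (M *v v)" "v \<bullet> (M *v v) = c"
        using symmetric_inner_commute[OF sym, of v z] by (simp_all add: inner_commute[of v z] c_def)
      ultimately show ?thesis using \<open>v \<bullet> v = 1\<close>
        by (simp add: inner_add_left inner_add_right power2_eq_square) (simp add: algebra_simps)
    qed
    also have "c * (z \<bullet> v) - z \<bullet> (M *v v) = z \<bullet> z" by (simp add: z_def inner_diff_right)
    finally show ?thesis .
  qed
  from linear_coeff_zero_of_nonneg[OF this] have "z = 0" by simp
  then show ?thesis using that[OF vS, of c] v by (simp add: z_def)
qed

lemma orthonormal_rows_mult_transpose:
  assumes "v \<in> orthonormal_bases"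
  shows "(\<chi> i. v i) ** transpose (\<chi> i. v i) = (mat 1 :: real^'n^'n)"
  using assms by (simp add: orthonormal_bases_def vec_eq_iff matrix_matrix_mult_def transpose_def
      mat_def inner_vec_def)

theorem symmetric_spectral:
  fixes M :: "real^'n^'n"
  assumes sym: "transpose M = M"
  obtains w c where "w \<in> orthonormal_bases" "\<And>i. M *v w i = c i *\<^sub>R w i" "det M = (\<Prod>i\<in>UNIV. c i)"
proof -
  have ex: "\<exists>B. finite B \<and> card B = k \<and> (\<forall>b\<in>B. norm b = 1 \<and> (\<exists>c. M *v b = c *\<^sub>R b)) \<and> pairwise orthogonal B"
    if "k \<le> CARD('n)" for k
    using that
  proof (induction k)
    case 0 show ?case by (intro exI[of _ "{}"]) auto
  next
    case (Suc k)
    then obtain B where B: "finite B" "card B = k" "pairwise orthogonal B"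
      and eig: "\<forall>b\<in>B. norm b = 1 \<and> (\<exists>c. M *v b = c *\<^sub>R b)" by auto
    have "dim B < DIM(real^'n)" using dim_le_card'[OF B(1)] B(2) Suc.prems by simp
    then have "span B \<noteq> UNIV" by (metis dim_UNIV dim_span less_irrefl)
    then obtain a where a: "a \<noteq> 0" "\<forall>x\<in>span B. a \<bullet> x = 0" using span_not_UNIV_orthogonal by blast
    \<comment> \<open>The orthogonal complement of the eigenvectors found so far. Symmetry of
      \<open>M\<close> makes it invariant, so the next eigenvector can be sought in it.\<close>
    define S where "S = {x. \<forall>b\<in>B. b \<bullet> x = 0}"
    have sS: "subspace S" by (auto simp: S_def subspace_def inner_add_right)
    have inv: "M *v x \<in> S" if "x \<in> S" for x
      unfolding S_def
    proof (intro CollectI ballI)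
      fix b assume b: "b \<in> B"
      then obtain c where "M *v b = c *\<^sub>R b" using eig by blast
      then show "b \<bullet> (M *v x) = 0" using symmetric_inner_commute[OF sym, of b x] that b
        by (simp add: S_def inner_commute)
    qed
    have "a \<in> S" using a by (auto simp: S_def inner_commute span_base)
    from symmetric_eigenvector_in_subspace[OF sym sS inv this \<open>a \<noteq> 0\<close>]
    obtain v c where v: "v \<in> S" "norm v = 1" "M *v v = c *\<^sub>R v" by blast
    have "v \<notin> B" using v by (auto simp: S_def)
    then show ?case using B eig v
      by (intro exI[of _ "insert v B"])
        (auto simp: pairwise_insert S_def inner_commute orthogonal_def[of v] orthogonal_def[of _ v])
  qed
  obtain B :: "(real^'n) set" where B: "finite B" "card B = CARD('n)" "pairwise orthogonal B"
      and eig: "\<forall>b\<in>B. norm b = 1 \<and> (\<exists>c. M *v b = c *\<^sub>R b)" using ex[OF order_refl] by blast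
  then obtain w :: "'n \<Rightarrow> real^'n" where w: "bij_betw w UNIV B"
    using finite_same_card_bij[of "UNIV::'n set" B] by auto
  have wB: "w i \<in> B" for i using bij_betwE[OF w] by blast
  have "\<forall>i. \<exists>c. M *v w i = c *\<^sub>R w i" using eig wB by blast
  then have "\<exists>c. \<forall>i. M *v w i = c i *\<^sub>R w i" by (rule choice)
  then obtain c where c: "\<And>i. M *v w i = c i *\<^sub>R w i" by blast
  have inj: "w i = w j \<longleftrightarrow> i = j" for i j using w by (auto simp: bij_betw_def inj_def)
  have on: "w \<in> orthonormal_bases"
    unfolding orthonormal_bases_def
  proof (intro CollectI allI)
    fix i j show "w i \<bullet> w j = (if i = j then 1 else 0)"
      using wB[of i] wB[of j] B(3) inj[of i j] eig
      by (cases "i = j") (auto simp: norm_eq_1 pairwise_def orthogonal_def)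
  qed
  \<comment> \<open>Conjugation by the matrix with rows \<open>w i\<close> diagonalizes
    \<open>M\<close>. The determinants of this matrix and its transpose multiply to 1, which leaves
    the product of the eigenvalues.\<close>
  let ?Q = "(\<chi> i. w i) :: real^'n^'n"
  have QQ: "?Q ** transpose ?Q = mat 1" by (rule orthonormal_rows_mult_transpose[OF on])
  have entry: "(?Q ** M ** transpose ?Q) $ i $ j = w i \<bullet> (M *v w j)" for i j
  proof -
    have "(?Q ** (M ** transpose ?Q)) $ i $ j = (\<Sum>k\<in>UNIV. w i $ k * (\<Sum>l\<in>UNIV. M $ k $ l * w j $ l))"
      by (simp add: matrix_matrix_mult_def transpose_def)
    also have "\<dots> = w i \<bullet> (M *v w j)" by (simp add: inner_vec_def matrix_vector_mult_def)
    finally show ?thesis by (simp add: matrix_mul_assoc)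
  qed
  have "det (?Q ** M ** transpose ?Q) = (\<Prod>i\<in>UNIV. (?Q ** M ** transpose ?Q) $ i $ i)"
    by (rule det_diagonal) (use on in \<open>simp add: entry c orthonormal_bases_def\<close>)
  also have "\<dots> = (\<Prod>i\<in>UNIV. c i)" using on by (simp add: entry c orthonormal_bases_def)
  finally have "det ?Q * det M * det (transpose ?Q) = (\<Prod>i\<in>UNIV. c i)" by (simp add: det_mul)
  moreover have "det ?Q * det (transpose ?Q) = 1" using QQ by (metis det_I det_mul)
  ultimately have "det M = (\<Prod>i\<in>UNIV. c i)" by (simp add: mult_ac)
  then show ?thesis by (rule that[OF on c])
qed

lemma orthonormal_parseval:
  fixes w :: "'n::finite \<Rightarrow> real^'n"
  assumes "w \<in> orthonormal_bases"
  shows "x = (\<Sum>i\<in>UNIV. (x \<bullet> w i) *\<^sub>R w i)"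
proof -
  let ?Q = "(\<chi> i. w i) :: real^'n^'n"
  have "transpose ?Q ** ?Q = mat 1"
    using orthonormal_rows_mult_transpose[OF assms] matrix_left_right_inverse by blast
  then have "x = transpose ?Q *v (?Q *v x)" by (simp add: matrix_vector_mul_assoc del: transpose_matrix_vector)
  also have "\<dots> = (\<Sum>i\<in>UNIV. (x \<bullet> w i) *\<^sub>R w i)"
    by (simp add: vec_eq_iff matrix_vector_mult_def transpose_def inner_vec_def mult_ac
        del: transpose_matrix_vector)
  finally show ?thesis .
qed

text \<open>For \<open>M = mat 1\<close> and \<open>c = 1\<close> this is Parseval's identity, the
  form in which squared norms are expanded below.\<close>

lemma quadratic_form_eigenbasis:
  fixes w :: "'n::finite \<Rightarrow> real^'n"
  assumes w: "w \<in> orthonormal_bases" and e: "\<And>i. M *v w i = c i *\<^sub>R w i"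
  shows "x \<bullet> (M *v x) = (\<Sum>i\<in>UNIV. c i * (x \<bullet> w i)\<^sup>2)"
proof -
  have "M *v x = (\<Sum>i\<in>UNIV. (x \<bullet> w i) *\<^sub>R (M *v w i))"
    by (subst orthonormal_parseval[OF w, of x])
      (simp add: linear_sum[OF matrix_vector_mul_linear] matrix_vector_mult_scaleR)
  then show ?thesis by (simp add: e inner_sum_right power2_eq_square mult_ac)
qed

definition pos_semidef :: "real^'n^'n \<Rightarrow> bool" where
  "pos_semidef M \<longleftrightarrow> (\<forall>x. 0 \<le> x \<bullet> (M *v x))"

text \<open>A uniform lower bound instead of pointwise positivity, equivalent by compactness of the
  sphere: \<open>k\<close> measures how far \<open>M\<close> can be lowered by multiples of the
  identity.\<close>

definition pos_def :: "real^'n^'n \<Rightarrow> bool" where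
  "pos_def M \<longleftrightarrow> (\<exists>k>0. \<forall>x. k * (x \<bullet> x) \<le> x \<bullet> (M *v x))"

lemma pos_def_imp_semidef: "pos_def M \<Longrightarrow> pos_semidef M"
  unfolding pos_def_def pos_semidef_def by (meson inner_ge_zero mult_nonneg_nonneg order.strict_implies_order order_trans)

text \<open>The eigenvalues are nonnegative with nonzero product, hence positive, and the smallest
  one serves as the constant.\<close>

lemma pos_semidef_det_nonzero:
  assumes sym: "transpose M = M" and "pos_semidef M" "det M \<noteq> 0"
  shows "pos_def M"
proof -
  obtain w c where w: "w \<in> orthonormal_bases" "\<And>i. M *v w i = c i *\<^sub>R w i" "det M = (\<Prod>i\<in>UNIV. c i)"
    using symmetric_spectral[OF sym] by metis
  have ww: "w i \<bullet> w i = 1" for i using w(1) by (simp add: orthonormal_bases_def)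
  have c0: "c i > 0" for i
    using assms(2)[unfolded pos_semidef_def, rule_format, of "w i"] assms(3)
    by (simp add: w(2,3) ww) (metis order.not_eq_order_implies_strict)
  define k where "k = Min (range c)"
  have k: "k > 0" "\<And>i. k \<le> c i" using c0 by (auto simp: k_def)
  have "k * (x \<bullet> x) \<le> x \<bullet> (M *v x)" for x
  proof -
    have "x \<bullet> x = (\<Sum>i\<in>UNIV. (x \<bullet> w i)\<^sup>2)"
      using quadratic_form_eigenbasis[OF w(1), of "mat 1" "\<lambda>_. 1" x] by simp
    then show ?thesis
      by (simp add: quadratic_form_eigenbasis[OF w(1,2)] sum_distrib_left) (intro sum_mono mult_right_mono k; simp)
  qed
  then show ?thesis using k by (auto simp: pos_def_def)
qed

text \<open>With \<open>s\<^sub>i\<^sub>j = (v\<^sub>j \<bullet> w\<^sub>i)\<^sup>2\<close> doubly stochastic and \<open>m\<^sub>j = \<Sum>\<^sub>i c\<^sub>i s\<^sub>i\<^sub>j\<close>, summing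
  \<open>ln (c\<^sub>i / m\<^sub>j) \<le> c\<^sub>i / m\<^sub>j - 1\<close> against \<open>s\<^sub>i\<^sub>j\<close> gives \<open>\<Sum> ln c\<^sub>i \<le> \<Sum> ln m\<^sub>j\<close>.\<close>

theorem det_le_prod_orthonormal:
  fixes M :: "real^'n^'n"
  assumes sym: "transpose M = M" and pd: "pos_def M" and v: "v \<in> orthonormal_bases"
  shows "det M \<le> (\<Prod>j\<in>UNIV. v j \<bullet> (M *v v j))"
proof -
  obtain w c where w: "w \<in> orthonormal_bases" "\<And>i. M *v w i = c i *\<^sub>R w i" "det M = (\<Prod>i\<in>UNIV. c i)"
    using symmetric_spectral[OF sym] by metis
  obtain k where k: "k > 0" "\<And>x. k * (x \<bullet> x) \<le> x \<bullet> (M *v x)" using pd by (auto simp: pos_def_def)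
  have ww: "w i \<bullet> w i = 1" "v i \<bullet> v i = 1" for i using w(1) v by (auto simp: orthonormal_bases_def)
  have c0: "c i > 0" for i using k(2)[of "w i"] k(1) by (simp add: w(2) ww)
  define m where "m j = v j \<bullet> (M *v v j)" for j
  have m0: "m j > 0" for j using k(2)[of "v j"] k(1) by (simp add: m_def ww)
  define s where "s i j = (v j \<bullet> w i)\<^sup>2" for i j
  have s1: "(\<Sum>i\<in>UNIV. s i j) = 1" for j
    using quadratic_form_eigenbasis[OF w(1), of "mat 1" "\<lambda>_. 1" "v j"] by (simp add: s_def ww)
  have s2: "(\<Sum>j\<in>UNIV. s i j) = 1" for i
    using quadratic_form_eigenbasis[OF v, of "mat 1" "\<lambda>_. 1" "w i"] by (simp add: s_def ww inner_commute)
  have ms: "m j = (\<Sum>i\<in>UNIV. c i * s i j)" for j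
    by (simp add: m_def s_def quadratic_form_eigenbasis[OF w(1,2)])
  have "(\<Sum>j\<in>UNIV. \<Sum>i\<in>UNIV. s i j * (ln (c i) - ln (m j))) \<le> (\<Sum>j\<in>UNIV. \<Sum>i\<in>UNIV. s i j * (c i / m j - 1))"
  proof (intro sum_mono mult_left_mono)
    show "ln (c i) - ln (m j) \<le> c i / m j - 1" for i j
      using ln_le_minus_one[of "c i / m j"] c0[of i] m0[of j] by (simp add: ln_div)
  qed (simp add: s_def)
  also have "\<dots> = (\<Sum>j\<in>UNIV. m j / m j - 1)"
  proof (intro sum.cong refl)
    fix j
    have "(\<Sum>i\<in>UNIV. s i j * (c i / m j - 1)) = (\<Sum>i\<in>UNIV. c i * s i j) / m j - (\<Sum>i\<in>UNIV. s i j)"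
      by (simp add: right_diff_distrib sum_subtractf sum_divide_distrib mult_ac)
    then show "(\<Sum>i\<in>UNIV. s i j * (c i / m j - 1)) = m j / m j - 1" by (simp add: s1 flip: ms)
  qed
  also have "\<dots> = 0" using m0 by (simp add: less_imp_neq[symmetric])
  finally have "(\<Sum>j\<in>UNIV. \<Sum>i\<in>UNIV. s i j * ln (c i)) \<le> (\<Sum>j\<in>UNIV. \<Sum>i\<in>UNIV. s i j * ln (m j))"
    by (simp add: right_diff_distrib sum_subtractf)
  moreover have "(\<Sum>j\<in>UNIV. \<Sum>i\<in>UNIV. s i j * ln (c i)) = (\<Sum>i\<in>UNIV. ln (c i))"
    by (subst sum.swap) (simp add: s2 flip: sum_distrib_right)
  moreover have "(\<Sum>j\<in>UNIV. \<Sum>i\<in>UNIV. s i j * ln (m j)) = (\<Sum>j\<in>UNIV. ln (m j))"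
    by (simp add: s1 flip: sum_distrib_right)
  ultimately have "ln (\<Prod>i\<in>UNIV. c i) \<le> ln (\<Prod>j\<in>UNIV. m j)"
    using c0 m0 by (simp add: ln_prod less_imp_neq[symmetric])
  then show ?thesis using c0 m0 by (simp add: w(3) m_def[symmetric] prod_pos)
qed

text \<open>Evaluated in an eigenbasis of the larger matrix \<open>N\<close>: there
  \<open>det N\<close> equals the product of the diagonal entries, while for \<open>M\<close> the
  same product bounds the determinant from above.\<close>

lemma det_mono:
  fixes M N :: "real^'n^'n"
  assumes "transpose M = M" "transpose N = N" "pos_def M"
    and le: "\<And>x. x \<bullet> (M *v x) \<le> x \<bullet> (N *v x)"
  shows "det M \<le> det N"
proof -
  obtain w c where w: "w \<in> orthonormal_bases" "\<And>i. N *v w i = c i *\<^sub>R w i" "det N = (\<Prod>i\<in>UNIV. c i)"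
    using symmetric_spectral[OF assms(2)] by metis
  have ww: "w i \<bullet> w i = 1" for i using w(1) by (auto simp: orthonormal_bases_def)
  have "det M \<le> (\<Prod>j\<in>UNIV. w j \<bullet> (M *v w j))"
    by (rule det_le_prod_orthonormal[OF assms(1,3) w(1)])
  also have "\<dots> \<le> (\<Prod>j\<in>UNIV. w j \<bullet> (N *v w j))"
    using pos_def_imp_semidef[OF assms(3)] by (intro prod_mono) (auto simp: pos_semidef_def le)
  also have "\<dots> = det N" by (simp add: w(2,3) ww)
  finally show ?thesis .
qed

section \<open>Perturbation by multiples of the identity\<close>

lemma transpose_scalar_mat: "transpose (mat k :: real^'n^'n) = mat k"
  by (simp add: transpose_def mat_def vec_eq_iff)

lemma scalar_mat_mult_vec: "(mat k :: real^'n^'n) *v x = k *\<^sub>R x"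
proof -
  have "(\<Sum>j\<in>UNIV. (if i = j then k else 0) * x $ j) = (\<Sum>j\<in>UNIV. if i = j then k * x $ j else 0)" for i
    by (intro sum.cong) auto
  then show ?thesis by (simp add: vec_eq_iff matrix_vector_mult_def mat_def)
qed

lemma transpose_add: "transpose (M + N) = transpose M + transpose (N :: real^'n^'m)"
  by (simp add: transpose_def vec_eq_iff)

lemma det_scalar_mat: "det (mat k :: real^'n^'n) = k ^ CARD('n)"
  by (subst det_diagonal) (auto simp: mat_def)

text \<open>Test matrices are perturbed by multiples of the identity to gain strictness; this
  continuity removes the perturbation at the end.\<close>

lemma tendsto_det_add_mat:
  fixes M :: "real^'n^'n"
  assumes "(h \<longlongrightarrow> 0) F"
  shows "((\<lambda>t. det (M + mat (h t))) \<longlongrightarrow> det M) F"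
proof -
  have "((\<lambda>t. (M + mat (h t)) $ i $ j) \<longlongrightarrow> M $ i $ j) F" for i j
    using tendsto_add[OF tendsto_const[of "M $ i $ i"] assms] by (cases "i = j") (auto simp: mat_def)
  then show ?thesis unfolding det_def by (intro tendsto_sum tendsto_mult tendsto_prod tendsto_const)
qed

section \<open>Quadratic test functions and convexity\<close>

definition quad :: "real^'n \<Rightarrow> real^'n^'n \<Rightarrow> real^'n \<Rightarrow> real" where
  "quad p M y = p \<bullet> y + (y \<bullet> (M *v y)) / 2"

lemma quad_zero [simp]: "quad p M 0 = 0"
  by (simp add: quad_def)

lemma continuous_on_quad [continuous_intros]:
  assumes "continuous_on A h" shows "continuous_on A (\<lambda>x. quad p M (h x))"
proof -
  have "continuous_on UNIV (quad p M)"
    unfolding quad_def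
    by (intro continuous_on_add continuous_on_divide continuous_on_inner continuous_on_id continuous_on_const
        linear_continuous_on matrix_vector_mul_bounded_linear) simp
  then show ?thesis using continuous_on_compose2[OF _ assms] by blast
qed

text \<open>A quadratic centred at \<open>a\<close> may touch a function at another point
  \<open>y\<close>. Re-expanding it there changes the gradient and keeps the Hessian, which is what
  the tests evaluate.\<close>

lemma quad_recenter:
  fixes M :: "real^'n^'n"
  assumes "transpose M = M"
  shows "quad p M (x - a) = quad p M (y - a) + quad (p + M *v (y - a)) M (x - y)"
proof -
  define s t where "s = y - a" and "t = x - y"
  have e: "x - a = s + t" by (simp add: s_def t_def)
  show ?thesis
    using symmetric_inner_commute[OF assms, of s t] inner_commute[of "M *v s" t]
    unfolding e s_def[symmetric] t_def[symmetric]
    by (simp add: quad_def matrix_vector_right_distrib inner_add_left inner_add_right field_simps)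
qed

lemma quad_add_mat: "quad p (M + mat k) y = quad p M y + k / 2 * (y \<bullet> y)"
  by (simp add: quad_def matrix_vector_mult_add_rdistrib scalar_mat_mult_vec inner_add_right field_simps)

lemma transpose_add_mat:
  fixes M :: "real^'n^'n"
  shows "transpose M = M \<Longrightarrow> transpose (M + mat k) = M + mat k"
  by (simp add: transpose_add transpose_scalar_mat)

lemma quad_form_add_mat: "x \<bullet> ((M + mat k) *v x) = x \<bullet> (M *v x) + k * (x \<bullet> (x :: real^'n))"
  by (simp add: matrix_vector_mult_add_rdistrib scalar_mat_mult_vec inner_add_right)

text \<open>If no maximum existed, the relatively open sets where \<open>w < w y\<close> would cover
  \<open>K\<close>; in a finite subcover the index with the largest value would lie in none of the
  sets.\<close>

lemma compact_attains_sup_usc: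
  fixes w :: "'a::topological_space \<Rightarrow> real"
  assumes "compact K" "K \<noteq> {}" and usc: "\<And>x c. x \<in> K \<Longrightarrow> w x < c \<Longrightarrow> \<forall>\<^sub>F y in nhds x. y \<in> K \<longrightarrow> w y < c"
  obtains x where "x \<in> K" "\<And>y. y \<in> K \<Longrightarrow> w y \<le> w x"
proof -
  have "\<exists>x\<in>K. \<forall>y\<in>K. w y \<le> w x"
  proof (rule ccontr)
    assume "\<not> ?thesis"
    then have less: "\<exists>y\<in>K. w x < w y" if "x \<in> K" for x using that by (meson not_le)
    define U where "U c = \<Union>{S. open S \<and> (\<forall>x\<in>S \<inter> K. w x < c)}" for c
    have "\<And>y. y \<in> K \<Longrightarrow> open (U (w y))" by (auto simp: U_def)
    moreover have "K \<subseteq> (\<Union>y\<in>K. U (w y))"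
    proof
      fix x assume x: "x \<in> K"
      then obtain y where y: "y \<in> K" "w x < w y" using less by blast
      from usc[OF x y(2)] obtain S where "open S" "x \<in> S" "\<forall>z\<in>S. z \<in> K \<longrightarrow> w z < w y"
        by (auto simp: eventually_nhds)
      then have "x \<in> U (w y)" by (auto simp: U_def)
      then show "x \<in> (\<Union>y\<in>K. U (w y))" using y by blast
    qed
    ultimately obtain F where F: "F \<subseteq> K" "finite F" "K \<subseteq> (\<Union>y\<in>F. U (w y))"
      by (rule compactE_image[OF assms(1)])
    then have "F \<noteq> {}" using assms(2) by auto
    define y where "y = arg_min_on (\<lambda>x. - w x) F"
    have y: "y \<in> F" "\<And>z. z \<in> F \<Longrightarrow> w z \<le> w y"
      using arg_min_if_finite(1)[OF F(2) \<open>F \<noteq> {}\<close>, of "\<lambda>x. - w x"] arg_min_least[OF F(2) \<open>F \<noteq> {}\<close>, of _ "\<lambda>x. - w x"]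
      by (auto simp: y_def)
    obtain z where "z \<in> F" "y \<in> U (w z)" using F y(1) by blast
    then have "w y < w z" using y(1) F(1) by (auto simp: U_def)
    with y(2)[OF \<open>z \<in> F\<close>] show False by simp
  qed
  then show ?thesis using that by blast
qed

text \<open>Neighbourhoods are taken in the whole space; on the open sets to which this is applied
  it agrees with the relative notion.\<close>

definition usc_on :: "'a::topological_space set \<Rightarrow> ('a \<Rightarrow> real) \<Rightarrow> bool" where
  "usc_on A w \<longleftrightarrow> (\<forall>x\<in>A. \<forall>c>w x. \<forall>\<^sub>F y in nhds x. w y < c)"

definition lsc_on :: "'a::topological_space set \<Rightarrow> ('a \<Rightarrow> real) \<Rightarrow> bool" where
  "lsc_on A w \<longleftrightarrow> (\<forall>x\<in>A. \<forall>c<w x. \<forall>\<^sub>F y in nhds x. c < w y)"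

lemma continuous_on_open_imp_usc:
  fixes w :: "'a::t2_space \<Rightarrow> real"
  assumes "open A" "continuous_on A w"
  shows "usc_on A w"
  unfolding usc_on_def
proof (intro ballI allI impI order_tendstoD(2))
  show "(w \<longlongrightarrow> w x) (nhds x)" if "x \<in> A" for x
    using continuous_on_eq_continuous_at[OF assms(1), of w] assms(2) that
    by (simp add: isCont_def tendsto_at_iff_tendsto_nhds)
qed

lemma continuous_on_open_imp_lsc:
  fixes w :: "'a::t2_space \<Rightarrow> real"
  assumes "open A" "continuous_on A w"
  shows "lsc_on A w"
  unfolding lsc_on_def
proof (intro ballI allI impI order_tendstoD(1))
  show "(w \<longlongrightarrow> w x) (nhds x)" if "x \<in> A" for x
    using continuous_on_eq_continuous_at[OF assms(1), of w] assms(2) that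
    by (simp add: isCont_def tendsto_at_iff_tendsto_nhds)
qed

lemma usc_on_add_continuous:
  assumes "usc_on A w" "\<And>x. x \<in> A \<Longrightarrow> isCont h x"
  shows "usc_on A (\<lambda>x. w x + h x)"
  unfolding usc_on_def
proof (intro ballI allI impI)
  fix x c assume x: "x \<in> A" and c: "w x + h x < c"
  define k where "k = (c - w x - h x) / 2"
  have k: "k > 0" using c by (simp add: k_def)
  have "\<forall>\<^sub>F y in nhds x. w y < w x + k" using assms(1) x k by (simp add: usc_on_def)
  moreover have "\<forall>\<^sub>F y in nhds x. h y < h x + k"
    using assms(2)[OF x] k by (intro order_tendstoD(2)[of h "h x"]) (auto simp: isCont_def tendsto_at_iff_tendsto_nhds)
  ultimately show "\<forall>\<^sub>F y in nhds x. w y + h y < c"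
    by eventually_elim (simp add: k_def field_simps)
qed

lemma usc_attains_sup:
  assumes "compact K" "K \<noteq> {}" "usc_on A w" "K \<subseteq> A"
  obtains x where "x \<in> K" "\<And>y. y \<in> K \<Longrightarrow> w y \<le> w x"
proof (rule compact_attains_sup_usc[OF assms(1,2)])
  show "\<forall>\<^sub>F y in nhds x. y \<in> K \<longrightarrow> w y < c" if "x \<in> K" "w x < c" for x c
    using assms(3,4) that unfolding usc_on_def by (auto elim!: eventually_mono)
qed (use that in blast)

text \<open>Convexity in the viscosity sense; for a smooth function it amounts to a positive
  semidefinite Hessian.\<close>

definition psd_tests :: "(real^'n) set \<Rightarrow> (real^'n \<Rightarrow> real) \<Rightarrow> bool" where
  "psd_tests \<Omega> w \<longleftrightarrow> (\<forall>a\<in>\<Omega>. \<forall>p M. transpose M = M \<and>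
     (\<forall>\<^sub>F x in nhds a. w x \<le> w a + quad p M (x - a)) \<longrightarrow> pos_semidef M)"

text \<open>If \<open>w\<close> exceeds its chord over the segment from \<open>a\<close> to \<open>a + e\<close>, then \<open>w\<close> minus the chord
  touches from below a quadratic that is steep across the segment and slightly concave along it,
  somewhere inside a thin tube around the segment.\<close>

theorem psd_tests_imp_convex:
  fixes w :: "real^'n \<Rightarrow> real"
  assumes op: "open \<Omega>" and cv: "convex \<Omega>" and usc: "usc_on \<Omega> w" and tests: "psd_tests \<Omega> w"
  shows "convex_on \<Omega> w"
proof (rule ccontr)
  assume "\<not> convex_on \<Omega> w"
  then have "\<not> (\<forall>t x y. 0 < t \<longrightarrow> t < 1 \<longrightarrow> x \<in> \<Omega> \<longrightarrow> y \<in> \<Omega> \<longrightarrow>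
      w ((1 - t) *\<^sub>R x + t *\<^sub>R y) \<le> (1 - t) * w x + t * w y)"
    using cv by (blast intro: convex_onI)
  then obtain a b t where ab: "a \<in> \<Omega>" "b \<in> \<Omega>" and t: "0 < t" "t < 1"
    and gt: "(1 - t) * w a + t * w b < w ((1 - t) *\<^sub>R a + t *\<^sub>R b)"
    by (meson not_le)
  define e where "e = b - a"
  have beq: "b = a + e" by (simp add: e_def)
  have "a \<noteq> b" using gt by (auto simp: algebra_simps)
  then have e0: "e \<bullet> e > 0" "norm e > 0" by (auto simp: e_def)
  define s where "s x = ((x - a) \<bullet> e) / (e \<bullet> e)" for x
  define c where "c = a + t *\<^sub>R e"
  have c_eq: "c = (1 - t) *\<^sub>R a + t *\<^sub>R b" by (simp add: c_def e_def algebra_simps)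
  define L where "L x = w a + s x * (w b - w a)" for x
  define v where "v x = w x - L x" for x
  define m where "m = v c"
  have "s a = 0" "s b = 1" "s c = t" using e0 by (auto simp: s_def beq c_def)
  then have va: "v a = 0" "v b = 0" and m: "m > 0"
    using gt by (auto simp: v_def L_def m_def c_eq algebra_simps)
  have contL: "isCont (\<lambda>x. - L x) x" for x
    unfolding L_def s_def using e0 by (intro continuous_intros) auto
  have vusc: "usc_on \<Omega> v"
    using usc_on_add_continuous[OF usc, of "\<lambda>x. - L x"] contL by (simp add: v_def[abs_def])
  have "\<exists>r>0. (\<forall>y. dist y z \<le> r \<longrightarrow> v y < m / 2)" if "z \<in> \<Omega>" "v z = 0" for z
  proof -
    have "\<forall>\<^sub>F y in nhds z. v y < m / 2" using vusc[unfolded usc_on_def, rule_format, OF that(1), of "m / 2"] m that(2) by simp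
    then obtain d where "d > 0" "\<And>y. dist y z < d \<Longrightarrow> v y < m / 2"
      unfolding eventually_nhds_metric by blast
    then show ?thesis by (intro exI[of _ "d / 2"]) auto
  qed
  from this[OF ab(1) va(1)] this[OF ab(2) va(2)]
  obtain r1 r2 where r12: "r1 > 0" "r2 > 0" "\<And>y. dist y a \<le> r1 \<Longrightarrow> v y < m / 2"
    "\<And>y. dist y b \<le> r2 \<Longrightarrow> v y < m / 2" by blast
  have seg: "closed_segment a b \<subseteq> \<Omega>" using ab cv by (simp add: convex_contains_segment)
  obtain r3 where r3: "r3 > 0" "(\<Union>x\<in>closed_segment a b. cball x r3) \<subseteq> \<Omega>"
    using compact_subset_open_imp_cball_epsilon_subset[OF compact_segment op seg] by blast
  \<comment> \<open>The halves leave room for points of the tube whose projection leaves the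
    segment: they lie within \<open>2 * r\<close> of an endpoint, where
    \<open>v < m / 2\<close>.\<close>
  define r where "r = Min {r1 / 2, r2 / 2, r3, norm e}"
  have r: "r > 0" "2 * r \<le> r1" "2 * r \<le> r2" "r \<le> r3" "r \<le> norm e"
    using r12 r3 e0 by (auto simp: r_def)
  define Z where "Z = (\<lambda>(\<sigma>, y). a + \<sigma> *\<^sub>R e + y) ` ({0..1} \<times> cball 0 r)"
  have "compact Z" unfolding Z_def
    by (intro compact_continuous_image compact_Times compact_Icc compact_cball)
      (auto simp: split_def intro!: continuous_intros)
  have ZI: "a + \<sigma> *\<^sub>R e + y \<in> Z" if "0 \<le> \<sigma>" "\<sigma> \<le> 1" "norm y \<le> r" for \<sigma> y
    using that by (force simp: Z_def)
  have Zsub: "Z \<subseteq> \<Omega>"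
  proof
    fix x assume "x \<in> Z"
    then obtain \<sigma> y where x: "x = a + \<sigma> *\<^sub>R e + y" "0 \<le> \<sigma>" "\<sigma> \<le> 1" "norm y \<le> r" by (auto simp: Z_def)
    have "a + \<sigma> *\<^sub>R e \<in> closed_segment a b"
      using x by (auto simp: in_segment e_def algebra_simps intro!: exI[of _ \<sigma>])
    moreover have "x \<in> cball (a + \<sigma> *\<^sub>R e) r3" using x r by (simp add: dist_norm)
    ultimately show "x \<in> \<Omega>" using r3(2) by blast
  qed
  have cZ: "c \<in> Z" using ZI[of t 0] t r by (simp add: c_def)
  then have Zne: "Z \<noteq> {}" by blast
  obtain zB where zB: "\<And>y. y \<in> Z \<Longrightarrow> v y \<le> v zB"
    using usc_attains_sup[OF \<open>compact Z\<close> Zne vusc Zsub] by blast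
  \<comment> \<open>In the tube \<open>\<bar>s x - t\<bar> \<le> 3\<close>, so the concave part of
    \<open>q\<close> costs at most \<open>9 * \<eta> = m / 2\<close>. The constant \<open>K\<close>
    is such that at distance \<open>r\<close> from the axis the steep part compensates this cost and
    still reaches the maximum of \<open>v\<close>.\<close>
  define \<eta> where "\<eta> = m / 18"
  define K where "K = (\<bar>v zB\<bar> + 9 * \<eta>) / r\<^sup>2"
  have K0: "K \<ge> 0" "\<eta> > 0" using m by (auto simp: K_def \<eta>_def)
  \<comment> \<open>The Hessian of \<open>q\<close> is \<open>2 * K\<close> times the identity minus
    a multiple of the projection onto \<open>e\<close>; \<open>\<kappa>\<close> is fixed by
    \<open>e \<bullet> (M *v e) = - 2 * \<eta>\<close>, the negative direction that will contradict
    \<open>tests\<close>.\<close>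
  define \<kappa> where "\<kappa> = 2 * K / (e \<bullet> e) + 2 * \<eta> / (e \<bullet> e)\<^sup>2"
  define M :: "real^'n^'n" where "M = (\<chi> i j. (if i = j then 2 * K else 0) - \<kappa> * e $ i * e $ j)"
  have Msym: "transpose M = M" by (simp add: M_def transpose_def vec_eq_iff)
  have Mv: "M *v y = (2 * K) *\<^sub>R y - (\<kappa> * (e \<bullet> y)) *\<^sub>R e" for y
  proof -
    have "(\<Sum>j\<in>UNIV. ((if i = j then 2 * K else 0) - \<kappa> * e $ i * e $ j) * y $ j)
        = (\<Sum>j\<in>UNIV. (if i = j then 2 * K * y $ j else 0)) - (\<kappa> * e $ i) * (\<Sum>j\<in>UNIV. e $ j * y $ j)" for i
      unfolding sum_distrib_left sum_subtractf[symmetric] by (intro sum.cong) (auto simp: algebra_simps)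
    then show ?thesis by (simp add: M_def matrix_vector_mult_def vec_eq_iff inner_vec_def)
  qed
  define q where "q x = K * ((norm (x - a - s x *\<^sub>R e))\<^sup>2) - \<eta> * (s x - t)\<^sup>2" for x
  have q_quad: "q x = quad 0 M (x - c)" for x
  proof -
    define y where "y = x - a"
    have y: "x - c = y - t *\<^sub>R e" "s x = (e \<bullet> y) / (e \<bullet> e)" "x - a - s x *\<^sub>R e = y - s x *\<^sub>R e"
      by (auto simp: y_def c_def s_def inner_commute)
    have sy: "e \<bullet> y = s x * (e \<bullet> e)" using y(2) e0 by simp
    have 1: "(norm (y - s x *\<^sub>R e))\<^sup>2 = y \<bullet> y - (s x)\<^sup>2 * (e \<bullet> e)"
      unfolding power2_norm_eq_inner
      by (simp add: inner_diff_left inner_diff_right inner_commute[of y e] sy power2_eq_square)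
    have 2: "(y - t *\<^sub>R e) \<bullet> (y - t *\<^sub>R e) = y \<bullet> y - 2 * t * s x * (e \<bullet> e) + t\<^sup>2 * (e \<bullet> e)"
      by (simp add: inner_diff_left inner_diff_right inner_commute[of y e] sy power2_eq_square)
        (simp add: algebra_simps)
    have 3: "e \<bullet> (y - t *\<^sub>R e) = (s x - t) * (e \<bullet> e)"
      by (simp add: inner_diff_right sy left_diff_distrib)
    have 4: "\<kappa> * (e \<bullet> e)\<^sup>2 = 2 * K * (e \<bullet> e) + 2 * \<eta>"
      using e0 by (simp add: \<kappa>_def field_simps power2_eq_square)
    have "quad 0 M (x - c) = K * ((y - t *\<^sub>R e) \<bullet> (y - t *\<^sub>R e)) - \<kappa> * (e \<bullet> (y - t *\<^sub>R e))\<^sup>2 / 2"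
      by (simp add: quad_def Mv y(1) inner_diff_right[of "y - t *\<^sub>R e"] inner_commute[of _ e] power2_eq_square
          del: inner_diff_right inner_diff_left)
    also have "\<kappa> * (e \<bullet> (y - t *\<^sub>R e))\<^sup>2 = (s x - t)\<^sup>2 * (2 * K * (e \<bullet> e) + 2 * \<eta>)"
      unfolding 3 4[symmetric] by (simp add: power_mult_distrib)
    also have "K * ((y - t *\<^sub>R e) \<bullet> (y - t *\<^sub>R e)) - (s x - t)\<^sup>2 * (2 * K * (e \<bullet> e) + 2 * \<eta>) / 2 = q x"
      unfolding q_def y(3) 1 2 by (simp add: field_simps power2_eq_square)
    finally show ?thesis ..
  qed
  have qcont: "isCont (\<lambda>x. - q x) x" for x
    unfolding q_def s_def using e0 by (intro continuous_intros) auto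
  have "usc_on \<Omega> (\<lambda>x. v x + - q x)" by (rule usc_on_add_continuous[OF vusc qcont])
  then have "usc_on \<Omega> (\<lambda>x. v x - q x)" by simp
  then obtain x where x: "x \<in> Z" and xmax: "\<And>y. y \<in> Z \<Longrightarrow> v y - q y \<le> v x - q x"
    using usc_attains_sup[OF \<open>compact Z\<close> Zne _ Zsub] by blast
  have "q c = 0" by (simp add: q_quad)
  then have xm: "v x - q x \<ge> m" using xmax[OF cZ] by (simp add: m_def)
  obtain \<sigma> y where xy: "x = a + \<sigma> *\<^sub>R e + y" "0 \<le> \<sigma>" "\<sigma> \<le> 1" "norm y \<le> r" using x by (auto simp: Z_def)
  have sx: "s x = \<sigma> + (y \<bullet> e) / (e \<bullet> e)" using e0 by (simp add: s_def xy inner_add_left add_divide_distrib)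
  have ye: "\<bar>y \<bullet> e\<bar> \<le> r * norm e"
    using Cauchy_Schwarz_ineq2[of y e] xy(4) by (meson mult_right_mono norm_ge_zero order_trans)
  have ne: "e \<bullet> e = norm e * norm e" by (simp add: power2_norm_eq_inner[symmetric] power2_eq_square)
  have ye1: "\<bar>(y \<bullet> e) / (e \<bullet> e)\<bar> * norm e \<le> r" using ye e0 by (simp add: ne field_simps)
  have "\<bar>(y \<bullet> e) / (e \<bullet> e)\<bar> * norm e \<le> 1 * norm e" using ye1 r by simp
  then have ye2: "\<bar>(y \<bullet> e) / (e \<bullet> e)\<bar> \<le> 1" using e0(2) by (simp only: mult_le_cancel_right_pos)
  have "\<bar>s x - t\<bar> \<le> 3" using ye2 xy(2,3) t unfolding sx by linarith
  then have st: "(s x - t)\<^sup>2 \<le> 9" using abs_le_square_iff[of "s x - t" 3] by simp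
  have "0 \<le> K * (norm (x - a - s x *\<^sub>R e))\<^sup>2" using K0 by simp
  moreover have \<eta>st: "\<eta> * (s x - t)\<^sup>2 \<le> \<eta> * 9" using mult_left_mono[OF st, of \<eta>] K0 by simp
  ultimately have qlow: "q x \<ge> - (m / 2)" unfolding q_def by (simp add: \<eta>_def)
  \<comment> \<open>Beyond an endpoint \<open>v x < m / 2\<close>, whereas
    \<open>v x - q x \<ge> m\<close> and \<open>q x \<ge> - (m / 2)\<close> force
    \<open>v x \<ge> m / 2\<close>.\<close>
  have "0 \<le> s x \<and> s x \<le> 1"
  proof (rule ccontr)
    assume "\<not> ?thesis"
    then consider "s x < 0" | "s x > 1" by linarith
    then have "v x < m / 2"
    proof cases
      case 1
      have "\<sigma> * norm e \<le> \<bar>(y \<bullet> e) / (e \<bullet> e)\<bar> * norm e"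
        using 1 sx by (intro mult_right_mono norm_ge_zero) linarith
      then have "norm (\<sigma> *\<^sub>R e + y) \<le> 2 * r"
        using norm_triangle_ineq[of "\<sigma> *\<^sub>R e" y] ye1 xy by simp
      then show ?thesis using r12(3)[of x] r by (simp add: xy dist_norm)
    next
      case 2
      have "(1 - \<sigma>) * norm e \<le> \<bar>(y \<bullet> e) / (e \<bullet> e)\<bar> * norm e"
        using 2 sx by (intro mult_right_mono norm_ge_zero) linarith
      then have "norm ((\<sigma> - 1) *\<^sub>R e + y) \<le> 2 * r"
        using norm_triangle_ineq[of "(\<sigma> - 1) *\<^sub>R e" y] ye1 xy by simp
      moreover have "x - b = (\<sigma> - 1) *\<^sub>R e + y" by (simp add: xy beq algebra_simps)
      ultimately show ?thesis using r12(4)[of x] r by (simp add: dist_norm)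
    qed
    then show False using qlow xm by simp
  qed
  then have s01: "0 \<le> s x" "s x \<le> 1" by auto
  \<comment> \<open>The size of \<open>K\<close> keeps the maximizer off the lateral boundary. It is
    thus interior to the tube, and the touching is a genuine local one.\<close>
  have perp: "norm (x - a - s x *\<^sub>R e) < r"
  proof (rule ccontr)
    assume "\<not> ?thesis"
    then have "r\<^sup>2 \<le> (norm (x - a - s x *\<^sub>R e))\<^sup>2" using r by (simp add: power_mono)
    from mult_left_mono[OF this K0(1)] have "\<bar>v zB\<bar> + 9 * \<eta> \<le> K * (norm (x - a - s x *\<^sub>R e))\<^sup>2"
      using r by (simp add: K_def)
    then have "q x \<ge> \<bar>v zB\<bar>" using \<eta>st unfolding q_def by linarith
    then show False using xm m zB[OF x] by simp
  qed
  have "ball x (r - norm (x - a - s x *\<^sub>R e)) \<subseteq> Z"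
  proof
    fix z assume "z \<in> ball x (r - norm (x - a - s x *\<^sub>R e))"
    then have "norm (z - a - s x *\<^sub>R e) \<le> r"
      using norm_triangle_ineq[of "x - a - s x *\<^sub>R e" "z - x"]
      by (simp add: dist_norm norm_minus_commute[of z x] algebra_simps)
    from ZI[OF s01 this] show "z \<in> Z" by (simp add: algebra_simps)
  qed
  then have near: "\<forall>\<^sub>F z in nhds x. z \<in> Z"
    using perp by (auto simp: eventually_nhds intro!: exI[of _ "ball x (r - norm (x - a - s x *\<^sub>R e))"])
  define p where "p = ((w b - w a) / (e \<bullet> e)) *\<^sub>R e + M *v (x - c)"
  have Lq: "L z + q z - (L x + q x) = quad p M (z - x)" for z
  proof -
    have "q z = q x + quad (M *v (x - c)) M (z - x)"
      using quad_recenter[OF Msym, of 0 z c x] by (simp add: q_quad)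
    moreover have "L z = L x + ((w b - w a) / (e \<bullet> e)) * (e \<bullet> (z - x))"
      using e0 by (simp add: L_def s_def inner_diff_left inner_diff_right inner_commute field_simps)
    ultimately show ?thesis by (simp add: p_def quad_def inner_add_left)
  qed
  have "\<forall>\<^sub>F z in nhds x. w z \<le> w x + quad p M (z - x)"
    using near
  proof eventually_elim
    case (elim z)
    show ?case using xmax[OF elim] Lq[of z] by (simp add: v_def)
  qed
  moreover have "x \<in> \<Omega>" using x Zsub by blast
  ultimately have "pos_semidef M" using tests Msym by (auto simp: psd_tests_def)
  then have "0 \<le> e \<bullet> (M *v e)" by (simp add: pos_semidef_def)
  also have "\<dots> = - 2 * \<eta>"
    using e0 by (simp add: Mv inner_diff_right \<kappa>_def field_simps power2_eq_square)
  finally show False using K0 by simp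
qed

section \<open>Viscosity subsolutions and supersolutions\<close>

definition subsolution :: "(real^'n) set \<Rightarrow> (real^'n \<Rightarrow> real) \<Rightarrow> (real^'n \<Rightarrow> real) \<Rightarrow> bool" where
  "subsolution \<Omega> f w \<longleftrightarrow> (\<forall>a\<in>\<Omega>. \<forall>p M. transpose M = M \<and>
     (\<forall>\<^sub>F x in nhds a. w x \<le> w a + quad p M (x - a)) \<longrightarrow> pos_semidef M \<and> f a \<le> det M)"

definition supersolution :: "(real^'n) set \<Rightarrow> (real^'n \<Rightarrow> real) \<Rightarrow> (real^'n \<Rightarrow> real) \<Rightarrow> bool" where
  "supersolution \<Omega> f w \<longleftrightarrow> (\<forall>a\<in>\<Omega>. \<forall>p M. transpose M = M \<and> pos_def M \<and>
     (\<forall>\<^sub>F x in nhds a. w a + quad p M (x - a) \<le> w x) \<longrightarrow> det M \<le> f a)"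

lemma subsolution_imp_psd_tests: "subsolution \<Omega> f w \<Longrightarrow> psd_tests \<Omega> w"
  by (auto simp: subsolution_def psd_tests_def)

section \<open>Passage between C2 test functions and quadratics\<close>

lemma has_real_derivative_along_line:
  fixes \<phi> :: "real^'n \<Rightarrow> real"
  assumes "(\<phi> has_derivative (\<lambda>h. g \<bullet> h)) (at (z + t *\<^sub>R y))"
  shows "((\<lambda>t. \<phi> (z + t *\<^sub>R y)) has_real_derivative g \<bullet> y) (at t)"
proof -
  have "((\<lambda>t. z + t *\<^sub>R y) has_derivative (\<lambda>h. h *\<^sub>R y)) (at t)"
    by (auto intro!: derivative_eq_intros)
  from has_derivative_compose[OF this assms]
  show ?thesis by (simp add: has_field_derivative_def mult.commute[of _ "g \<bullet> y"])
qed

lemma C2_gradient_expansion: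
  assumes "open \<Omega>" "C2_with_hessian \<Omega> \<phi> G D" "a \<in> \<Omega>" "k > 0"
  obtains d where "d > 0" "ball a d \<subseteq> \<Omega>"
    "\<And>y. norm y < d \<Longrightarrow> norm (G (a + y) - G a - D a *v y) \<le> k * norm y"
proof -
  have "(G has_derivative (\<lambda>y. D a *v y)) (at a)" using assms by (auto simp: C2_with_hessian_def)
  then have "\<exists>d>0. \<forall>y. norm (y - a) < d \<longrightarrow> norm (G y - G a - D a *v (y - a)) \<le> k * norm (y - a)"
    using \<open>k > 0\<close> unfolding has_derivative_at_alt by blast
  then obtain d1 where d1: "d1 > 0" "\<And>y. norm (y - a) < d1 \<Longrightarrow> norm (G y - G a - D a *v (y - a)) \<le> k * norm (y - a)"
    by blast
  obtain d2 where d2: "d2 > 0" "ball a d2 \<subseteq> \<Omega>" using assms(1,3) openE by blast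
  show ?thesis
  proof (rule that[of "min d1 d2"])
    show "norm (G (a + y) - G a - D a *v y) \<le> k * norm y" if "norm y < min d1 d2" for y
      using d1(2)[of "a + y"] that by simp
    show "ball a (min d1 d2) \<subseteq> \<Omega>" using d2(2) by (meson ball_subset_cball min.cobounded2 order_trans subset_ball)
  qed (use d1 d2 in simp)
qed

text \<open>The mean value theorem along the segment reduces the second-order remainder to the
  linearization error of the gradient, which differentiability of \<open>G\<close> at
  \<open>a\<close> makes small relative to \<open>norm y\<close>.\<close>

lemma C2_taylor:
  fixes \<phi> :: "real^'n \<Rightarrow> real"
  assumes "open \<Omega>" "C2_with_hessian \<Omega> \<phi> G D" "a \<in> \<Omega>" "k > 0"
  shows "\<forall>\<^sub>F x in nhds a. \<bar>\<phi> x - \<phi> a - quad (G a) (D a) (x - a)\<bar> \<le> k * ((x - a) \<bullet> (x - a))"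
proof -
  obtain d where d: "d > 0" "ball a d \<subseteq> \<Omega>"
    "\<And>y. norm y < d \<Longrightarrow> norm (G (a + y) - G a - D a *v y) \<le> k * norm y"
    using C2_gradient_expansion[OF assms] by blast
  have "\<bar>\<phi> x - \<phi> a - quad (G a) (D a) (x - a)\<bar> \<le> k * ((x - a) \<bullet> (x - a))" if x: "dist x a < d" for x
  proof -
    define y where "y = x - a"
    have y: "norm y < d" "x = a + y" using x by (auto simp: y_def dist_norm)
    define r where "r t = \<phi> (a + t *\<^sub>R y) - t * (G a \<bullet> y) - t\<^sup>2 / 2 * (y \<bullet> (D a *v y))" for t
    have ty: "norm (t *\<^sub>R y) < d" if "0 \<le> t" "t \<le> 1" for t
      using that y mult_left_le_one_le[of "norm y" t] by simp
    have der: "(r has_real_derivative (G (a + t *\<^sub>R y) \<bullet> y - G a \<bullet> y - t * (y \<bullet> (D a *v y)))) (at t)"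
      if "0 \<le> t" "t \<le> 1" for t
    proof -
      have "a + t *\<^sub>R y \<in> \<Omega>" using d(2) ty[OF that] by (auto simp: dist_norm)
      then have "(\<phi> has_derivative (\<lambda>h. G (a + t *\<^sub>R y) \<bullet> h)) (at (a + t *\<^sub>R y))"
        using assms(2) by (auto simp: C2_with_hessian_def)
      from has_real_derivative_along_line[OF this]
      show ?thesis unfolding r_def by (auto intro!: derivative_eq_intros)
    qed
    obtain t where t: "0 < t" "t < 1" "r 1 - r 0 = G (a + t *\<^sub>R y) \<bullet> y - G a \<bullet> y - t * (y \<bullet> (D a *v y))"
      using MVT2[of 0 1 r, OF _ der] by auto
    have "\<dots> = (G (a + t *\<^sub>R y) - G a - D a *v (t *\<^sub>R y)) \<bullet> y"
      by (simp add: inner_diff_left matrix_vector_mult_scaleR inner_commute[of _ y] inner_diff_right)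
    then have "\<bar>r 1 - r 0\<bar> \<le> norm (G (a + t *\<^sub>R y) - G a - D a *v (t *\<^sub>R y)) * norm y"
      using t(3) by (simp add: Cauchy_Schwarz_ineq2)
    also have "\<dots> \<le> (k * norm (t *\<^sub>R y)) * norm y"
      using d(3)[OF ty[of t]] t by (intro mult_right_mono) simp_all
    also have "\<dots> \<le> (k * norm y) * norm y"
      using t \<open>k > 0\<close> by (intro mult_right_mono mult_left_mono) (auto simp: mult_left_le_one_le)
    also have "\<dots> = k * (y \<bullet> y)" by (simp add: power2_norm_eq_inner[symmetric] power2_eq_square)
    finally show ?thesis by (simp add: r_def quad_def y(2) algebra_simps)
  qed
  then show ?thesis using d(1) by (auto simp: eventually_nhds_metric)
qed

text \<open>Both orders of forming the mixed second difference of \<open>\<phi>\<close> in the directions \<open>x\<close> and \<open>y\<close>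
  are compared with the Hessian by the mean value theorem.\<close>

lemma C2_hessian_symmetric:
  fixes \<phi> :: "real^'n \<Rightarrow> real"
  assumes "open \<Omega>" "C2_with_hessian \<Omega> \<phi> G D" "a \<in> \<Omega>"
  shows "transpose (D a) = D a"
proof -
  define F where "F t x y = \<phi> (a + t *\<^sub>R x + t *\<^sub>R y) - \<phi> (a + t *\<^sub>R x) - \<phi> (a + t *\<^sub>R y) + \<phi> a" for t x y
  have half: "\<bar>F t x y - t\<^sup>2 * ((D a *v y) \<bullet> x)\<bar> \<le> t\<^sup>2 * (k * (2 * norm x + 2 * norm y) * norm x)"
    if d: "ball a d \<subseteq> \<Omega>" "\<And>y. norm y < d \<Longrightarrow> norm (G (a + y) - G a - D a *v y) \<le> k * norm y"
      and t: "0 < t" "t * (norm x + norm y) < d" and k: "k > 0" for t x y d k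
  proof -
    have small: "norm (s *\<^sub>R x) < d" "norm (s *\<^sub>R x + t *\<^sub>R y) < d"
      "norm (s *\<^sub>R x) + norm (s *\<^sub>R x + t *\<^sub>R y) \<le> t * (2 * norm x + 2 * norm y)"
      if "0 \<le> s" "s \<le> t" for s
    proof -
      have 1: "s * norm x \<le> t * norm x" using that by (intro mult_right_mono) auto
      have 2: "norm (s *\<^sub>R x + t *\<^sub>R y) \<le> s * norm x + t * norm y"
        using norm_triangle_ineq[of "s *\<^sub>R x" "t *\<^sub>R y"] that by simp
      have 3: "0 \<le> t * norm y" "norm (s *\<^sub>R x) = s * norm x" "t * (norm x + norm y) = t * norm x + t * norm y"
        using that by (auto simp: algebra_simps)
      then show "norm (s *\<^sub>R x) < d" "norm (s *\<^sub>R x + t *\<^sub>R y) < d"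
        "norm (s *\<^sub>R x) + norm (s *\<^sub>R x + t *\<^sub>R y) \<le> t * (2 * norm x + 2 * norm y)"
        using 1 2 t(2) by (simp_all only: distrib_left)
    qed
    have D\<phi>: "(\<phi> has_derivative (\<lambda>h. G (a + z) \<bullet> h)) (at (a + z))" if "norm z < d" for z
      using assms(2) d(1) that by (auto simp: C2_with_hessian_def dist_norm subset_eq)
    have der: "((\<lambda>s. \<phi> ((a + t *\<^sub>R y) + s *\<^sub>R x) - \<phi> (a + s *\<^sub>R x)) has_real_derivative
       (G (a + (s *\<^sub>R x + t *\<^sub>R y)) \<bullet> x - G (a + s *\<^sub>R x) \<bullet> x)) (at s)" if s: "0 \<le> s" "s \<le> t" for s
      using D\<phi>[OF small(1)[OF s]] D\<phi>[OF small(2)[OF s]]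
      by (intro DERIV_diff has_real_derivative_along_line) (simp_all add: ac_simps)
    obtain s where s: "0 < s" "s < t" and eq: "(\<phi> ((a + t *\<^sub>R y) + t *\<^sub>R x) - \<phi> (a + t *\<^sub>R x)) -
       (\<phi> ((a + t *\<^sub>R y) + 0 *\<^sub>R x) - \<phi> (a + 0 *\<^sub>R x)) = (t - 0) *
       (G (a + (s *\<^sub>R x + t *\<^sub>R y)) \<bullet> x - G (a + s *\<^sub>R x) \<bullet> x)"
      using MVT2[OF t(1), of "\<lambda>s. \<phi> ((a + t *\<^sub>R y) + s *\<^sub>R x) - \<phi> (a + s *\<^sub>R x)", OF der] by blast
    define e1 where "e1 = G (a + (s *\<^sub>R x + t *\<^sub>R y)) - G a - D a *v (s *\<^sub>R x + t *\<^sub>R y)"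
    define e2 where "e2 = G (a + s *\<^sub>R x) - G a - D a *v (s *\<^sub>R x)"
    have "F t x y = t * ((G (a + (s *\<^sub>R x + t *\<^sub>R y)) - G (a + s *\<^sub>R x)) \<bullet> x)"
      using eq by (simp add: F_def inner_diff_left ac_simps)
    also have "G (a + (s *\<^sub>R x + t *\<^sub>R y)) - G (a + s *\<^sub>R x) = t *\<^sub>R (D a *v y) + (e1 - e2)"
      by (simp add: e1_def e2_def matrix_vector_right_distrib matrix_vector_mult_scaleR)
    finally have "F t x y - t\<^sup>2 * ((D a *v y) \<bullet> x) = t * ((e1 - e2) \<bullet> x)"
      by (simp add: inner_add_left power2_eq_square algebra_simps)
    then have F: "\<bar>F t x y - t\<^sup>2 * ((D a *v y) \<bullet> x)\<bar> = t * \<bar>(e1 - e2) \<bullet> x\<bar>" using t by (simp add: abs_mult)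
    have "norm (e1 - e2) \<le> k * (t * (2 * norm x + 2 * norm y))"
    proof -
      have "norm (e1 - e2) \<le> norm e1 + norm e2" by (rule norm_triangle_ineq4)
      also have "\<dots> \<le> k * norm (s *\<^sub>R x + t *\<^sub>R y) + k * norm (s *\<^sub>R x)"
        unfolding e1_def e2_def using s by (intro add_mono d(2) small) auto
      also have "\<dots> = k * (norm (s *\<^sub>R x) + norm (s *\<^sub>R x + t *\<^sub>R y))" by (simp add: algebra_simps)
      also have "\<dots> \<le> k * (t * (2 * norm x + 2 * norm y))"
        using small(3)[of s] s k by (intro mult_left_mono) auto
      finally show ?thesis .
    qed
    then have "norm (e1 - e2) * norm x \<le> k * (t * (2 * norm x + 2 * norm y)) * norm x"
      by (rule mult_right_mono) simp
    then have "t * \<bar>(e1 - e2) \<bullet> x\<bar> \<le> t * (k * (t * (2 * norm x + 2 * norm y)) * norm x)"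
      using t(1) Cauchy_Schwarz_ineq2[of "e1 - e2" x] by (intro mult_left_mono) auto
    also have "\<dots> = t\<^sup>2 * (k * (2 * norm x + 2 * norm y) * norm x)"
      by (simp only: power2_eq_square mult_ac)
    finally show ?thesis using F by simp
  qed
  have sym: "(D a *v y) \<bullet> x = (D a *v x) \<bullet> y" for x y
  proof -
    define C where "C = (2 * norm x + 2 * norm y) * norm x + (2 * norm y + 2 * norm x) * norm y"
    have le: "\<bar>(D a *v y) \<bullet> x - (D a *v x) \<bullet> y\<bar> \<le> k * C" if k: "k > 0" for k
    proof -
      obtain d where d: "d > 0" "ball a d \<subseteq> \<Omega>"
        "\<And>y. norm y < d \<Longrightarrow> norm (G (a + y) - G a - D a *v y) \<le> k * norm y"
        using C2_gradient_expansion[OF assms k] by blast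
      define t where "t = d / (norm x + norm y + 1)"
      have np: "norm x + norm y + 1 > 0" by (simp add: add_nonneg_pos)
      then have t: "t > 0" "t * (norm x + norm y) < d" using d(1) by (auto simp: t_def field_simps)
      have "F t y x = F t x y" by (simp add: F_def ac_simps)
      moreover have "t * (norm y + norm x) < d" using t(2) by (simp add: add.commute)
      ultimately have "\<bar>t\<^sup>2 * ((D a *v y) \<bullet> x) - t\<^sup>2 * ((D a *v x) \<bullet> y)\<bar> \<le>
         t\<^sup>2 * (k * (2 * norm x + 2 * norm y) * norm x) + t\<^sup>2 * (k * (2 * norm y + 2 * norm x) * norm y)"
        using half[OF d(2,3) t k] half[OF d(2,3) t(1) _ k, of y x] by linarith
      moreover have "\<bar>t\<^sup>2 * ((D a *v y) \<bullet> x) - t\<^sup>2 * ((D a *v x) \<bullet> y)\<bar>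
          = t\<^sup>2 * \<bar>(D a *v y) \<bullet> x - (D a *v x) \<bullet> y\<bar>"
        by (simp add: abs_mult flip: right_diff_distrib)
      moreover have "t\<^sup>2 * (k * (2 * norm x + 2 * norm y) * norm x) + t\<^sup>2 * (k * (2 * norm y + 2 * norm x) * norm y)
          = t\<^sup>2 * (k * C)"
        unfolding C_def by algebra
      ultimately have "t\<^sup>2 * \<bar>(D a *v y) \<bullet> x - (D a *v x) \<bullet> y\<bar> \<le> t\<^sup>2 * (k * C)" by simp
      then show ?thesis using t(1) by simp
    qed
    have "C \<ge> 0" by (simp add: C_def)
    have "\<bar>(D a *v y) \<bullet> x - (D a *v x) \<bullet> y\<bar> \<le> 0 + e" if "e > 0" for e
    proof -
      have "(e / (C + 1)) * C \<le> e" using \<open>C \<ge> 0\<close> that by (simp add: field_simps)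
      moreover have "e / (C + 1) > 0" using \<open>C \<ge> 0\<close> that by simp
      ultimately show ?thesis using le[of "e / (C + 1)"] by linarith
    qed
    then have "\<bar>(D a *v y) \<bullet> x - (D a *v x) \<bullet> y\<bar> \<le> 0" by (rule field_le_epsilon)
    then show ?thesis by simp
  qed
  have "(x v* D a) \<bullet> y = (D a *v x) \<bullet> y" for x y
    using dot_lmul_matrix[of x "D a" y] sym[of x y] by (simp add: inner_commute)
  then have "x v* D a = D a *v x" for x using vector_eq_rdot by blast
  then show ?thesis by (simp add: matrix_eq)
qed

lemma eventually_nhds_line:
  fixes a y :: "'a::real_normed_vector"
  assumes "\<forall>\<^sub>F x in nhds a. P x"
  shows "\<forall>\<^sub>F t in at_right (0::real). P (a + t *\<^sub>R y)"
proof -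
  have "((\<lambda>t. a + t *\<^sub>R y) \<longlongrightarrow> a + 0 *\<^sub>R y) (at_right 0)" by (intro tendsto_intros)
  then show ?thesis using assms by (simp add: filterlim_iff)
qed

text \<open>Adding the values at \<open>t *\<^sub>R y\<close> and at its negative cancels both
  gradients and leaves the Hessians.\<close>

lemma quad_le_near:
  fixes M N :: "real^'n^'n"
  assumes "\<forall>\<^sub>F x in nhds a. quad p M (x - a) \<le> quad p' N (x - a)"
  shows "y \<bullet> (M *v y) \<le> y \<bullet> (N *v y)"
proof -
  have "\<forall>\<^sub>F t in at_right (0::real). 0 < t \<and> quad p M (t *\<^sub>R y) \<le> quad p' N (t *\<^sub>R y)
     \<and> quad p M (t *\<^sub>R (- y)) \<le> quad p' N (t *\<^sub>R (- y))"
    using eventually_nhds_line[OF assms, of y] eventually_nhds_line[OF assms, of "- y"] eventually_at_right_less[of 0]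
    by eventually_elim simp
  then obtain t where t: "0 < t" "quad p M (t *\<^sub>R y) \<le> quad p' N (t *\<^sub>R y)"
     "quad p M (t *\<^sub>R (- y)) \<le> quad p' N (t *\<^sub>R (- y))"
    using eventually_happens'[OF trivial_limit_at_right_real] by blast
  have "quad p M (t *\<^sub>R y) + quad p M (t *\<^sub>R (- y)) = t\<^sup>2 * (y \<bullet> (M *v y))" for p and M :: "real^'n^'n"
    by (simp add: quad_def matrix_vector_mult_scaleR power2_eq_square linear_neg[OF matrix_vector_mul_linear])
  then have "t\<^sup>2 * (y \<bullet> (M *v y)) \<le> t\<^sup>2 * (y \<bullet> (N *v y))"
    using t(2,3) by (metis add_mono)
  then show ?thesis using t(1) by simp
qed

lemma convex_on_midpoint_line:
  fixes w :: "'a::real_vector \<Rightarrow> real"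
  assumes "convex_on \<Omega> w" "a + y \<in> \<Omega>" "a - y \<in> \<Omega>"
  shows "2 * w a \<le> w (a + y) + w (a - y)"
proof -
  have "w ((1 - 1/2) *\<^sub>R (a + y) + (1/2) *\<^sub>R (a - y)) \<le> (1 - 1/2) * w (a + y) + (1/2) * w (a - y)"
    using assms by (intro convex_onD) auto
  moreover have "(1 - 1/2) *\<^sub>R (a + y) + (1/2) *\<^sub>R (a - y) = a"
    using scaleR_half_double[of a] by (simp add: scaleR_right_distrib scaleR_right_diff_distrib)
  ultimately show ?thesis by simp
qed

text \<open>The midpoint inequality at two opposite points around \<open>a\<close> makes the
  symmetric second difference of the quadratic nonnegative, and its linear part cancels.\<close>

lemma convex_touching_quad_psd:
  fixes w :: "real^'n \<Rightarrow> real"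
  assumes "open \<Omega>" "a \<in> \<Omega>" "convex_on \<Omega> w" "\<forall>\<^sub>F x in nhds a. w x \<le> w a + quad p M (x - a)"
  shows "pos_semidef M"
  unfolding pos_semidef_def
proof
  fix y
  have ev: "\<forall>\<^sub>F x in nhds a. x \<in> \<Omega> \<and> w x \<le> w a + quad p M (x - a)"
    using assms by (intro eventually_conj eventually_nhds_in_open)
  have "\<forall>\<^sub>F t in at_right (0::real). 0 < t \<and> (a + t *\<^sub>R y \<in> \<Omega> \<and> w (a + t *\<^sub>R y) \<le> w a + quad p M (t *\<^sub>R y))
     \<and> (a - t *\<^sub>R y \<in> \<Omega> \<and> w (a - t *\<^sub>R y) \<le> w a + quad p M (- (t *\<^sub>R y)))"
    using eventually_nhds_line[OF ev, of y] eventually_nhds_line[OF ev, of "- y"] eventually_at_right_less[of 0]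
    by eventually_elim simp
  then obtain t where t: "0 < t" "a + t *\<^sub>R y \<in> \<Omega>" "w (a + t *\<^sub>R y) \<le> w a + quad p M (t *\<^sub>R y)"
     "a - t *\<^sub>R y \<in> \<Omega>" "w (a - t *\<^sub>R y) \<le> w a + quad p M (- (t *\<^sub>R y))"
    using eventually_happens'[OF trivial_limit_at_right_real] by blast
  have "0 \<le> quad p M (t *\<^sub>R y) + quad p M (- (t *\<^sub>R y))"
    using convex_on_midpoint_line[OF assms(3) t(2,4)] t(3,5) by linarith
  then have "0 \<le> t\<^sup>2 * (y \<bullet> (M *v y))"
    by (simp add: quad_def matrix_vector_mult_scaleR power2_eq_square linear_neg[OF matrix_vector_mul_linear])
  then show "0 \<le> y \<bullet> (M *v y)" using t(1) by (simp add: zero_le_mult_iff)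
qed

text \<open>Both conclusions are open conditions in \<open>t\<close>. The slack later absorbs the
  Taylor remainder and makes room for the bump in Perron's method.\<close>

lemma pos_def_shrink:
  fixes M :: "real^'n^'n"
  assumes "pos_def M" "c < det M"
  obtains t where "t > 0" "pos_def (M + mat (- t))" "c < det (M + mat (- t))"
proof -
  obtain k where k: "k > 0" "\<And>x. k * (x \<bullet> x) \<le> x \<bullet> (M *v x)" using assms(1) by (auto simp: pos_def_def)
  have "\<forall>\<^sub>F t in at_right 0. c < det (M + mat (- t))"
    using assms(2) by (intro order_tendstoD(1)[OF tendsto_det_add_mat[of uminus]]) (auto intro!: tendsto_eq_intros)
  moreover have "\<forall>\<^sub>F t in at_right 0. 0 < t \<and> t < k" using k by (auto simp: eventually_at_right_field)
  ultimately have "\<forall>\<^sub>F t in at_right 0. c < det (M + mat (- t)) \<and> 0 < t \<and> t < k" by eventually_elim simp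
  then obtain t where t: "c < det (M + mat (- t))" "0 < t" "t < k"
    using eventually_happens'[OF trivial_limit_at_right_real] by blast
  have "pos_def (M + mat (- t))"
    unfolding pos_def_def quad_form_add_mat
    using k t by (intro exI[of _ "k - t"]) (auto simp: left_diff_distrib)
  then show ?thesis using that t by blast
qed

text \<open>Near \<open>a\<close> the test function lies below its Taylor quadratic with the Hessian
  raised by \<open>k\<close>, which therefore touches \<open>w\<close> from above; afterwards
  \<open>k\<close> tends to 0.\<close>

lemma subsolution_C2_test:
  fixes w :: "real^'n \<Rightarrow> real"
  assumes "open \<Omega>" "subsolution \<Omega> f w" "C2_with_hessian \<Omega> \<phi> G D" "a \<in> \<Omega>"
    and max: "\<forall>\<^sub>F x in nhds a. w x - \<phi> x \<le> w a - \<phi> a"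
  shows "f a \<le> det (D a)"
proof (rule tendsto_lowerbound[OF tendsto_det_add_mat[OF tendsto_ident_at] _ trivial_limit_at_right_real])
  have "f a \<le> det (D a + mat k)" if "k > 0" for k
  proof -
    have "\<forall>\<^sub>F x in nhds a. w x \<le> w a + quad (G a) (D a + mat k) (x - a)"
      using C2_taylor[OF assms(1,3,4), of "k / 2", OF half_gt_zero[OF \<open>k > 0\<close>]] max
      by eventually_elim (unfold quad_add_mat abs_le_iff, linarith)
    then show ?thesis using assms(2,4) transpose_add_mat[OF C2_hessian_symmetric[OF assms(1,3,4)]]
      by (auto simp: subsolution_def)
  qed
  then show "\<forall>\<^sub>F k in at_right 0. f a \<le> det (D a + mat k)"
    by (auto simp: eventually_at_right_field intro!: exI[of _ 1])
qed

text \<open>Convexity of \<open>\<phi>\<close> makes \<open>D a\<close> positive semidefinite, and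
  \<open>det (D a) > f a \<ge> 0\<close> would make it positive definite, so a slightly lowered
  Taylor quadratic would be an admissible test.\<close>

lemma supersolution_C2_test:
  fixes w :: "real^'n \<Rightarrow> real"
  assumes "open \<Omega>" "supersolution \<Omega> f w" "C2_with_hessian \<Omega> \<phi> G D" "a \<in> \<Omega>" "convex_on \<Omega> \<phi>" "0 \<le> f a"
    and min: "\<forall>\<^sub>F x in nhds a. w a - \<phi> a \<le> w x - \<phi> x"
  shows "det (D a) \<le> f a"
proof (rule ccontr)
  assume "\<not> ?thesis"
  then have gt: "f a < det (D a)" by simp
  have sym: "transpose (D a) = D a" by (rule C2_hessian_symmetric[OF assms(1,3,4)])
  have "pos_semidef (D a)"
    unfolding pos_semidef_def
  proof
    fix y
    have "0 \<le> y \<bullet> (D a *v y) + e" if "e > 0" for e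
    proof -
      define k where "k = e / (y \<bullet> y + 1)"
      have k: "k > 0" "k * (y \<bullet> y) \<le> e"
        using \<open>e > 0\<close> by (auto simp: k_def field_simps add_nonneg_pos add_pos_nonneg)
      \<comment> \<open>The convex function \<open>\<phi>\<close> is itself touched from above by
        its own raised Taylor quadratic, so semidefiniteness can be read off from this
        touching.\<close>
      have "\<forall>\<^sub>F x in nhds a. \<phi> x \<le> \<phi> a + quad (G a) (D a + mat k) (x - a)"
        using C2_taylor[OF assms(1,3,4), of "k / 2", OF half_gt_zero[OF k(1)]]
        by eventually_elim (unfold quad_add_mat abs_le_iff, linarith)
      from convex_touching_quad_psd[OF assms(1,4,5) this] show ?thesis
        using k by (auto simp: pos_semidef_def quad_form_add_mat elim!: allE[of _ y])
    qed
    then show "0 \<le> y \<bullet> (D a *v y)" by (rule field_le_epsilon)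
  qed
  then have "pos_def (D a)" using pos_semidef_det_nonzero[OF sym] gt assms(6) by auto
  then obtain t where t: "t > 0" "pos_def (D a + mat (- t))" "f a < det (D a + mat (- t))"
    by (rule pos_def_shrink[OF _ gt])
  note t(2)
  moreover have "\<forall>\<^sub>F x in nhds a. w a + quad (G a) (D a + mat (- t)) (x - a) \<le> w x"
    using C2_taylor[OF assms(1,3,4), of "t / 2", OF half_gt_zero[OF \<open>t > 0\<close>]] min
    by eventually_elim (unfold quad_add_mat abs_le_iff minus_divide_left[symmetric] mult_minus_left, linarith)
  ultimately have "det (D a + mat (- t)) \<le> f a"
    using assms(2,4) transpose_add_mat[OF sym] by (auto simp: supersolution_def)
  then show False using t(3) by simp
qed

section \<open>Perron's method\<close>

text \<open>The competitors of Perron's method with obstacle \<open>V\<close>. Convexity makes each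
  of them continuous on the open set.\<close>

definition subsolutions_below :: "(real^'n) set \<Rightarrow> (real^'n \<Rightarrow> real) \<Rightarrow> (real^'n \<Rightarrow> real) \<Rightarrow> (real^'n \<Rightarrow> real) set" where
  "subsolutions_below \<Omega> f V = {v. convex_on \<Omega> v \<and> subsolution \<Omega> f v \<and> (\<forall>x\<in>\<Omega>. v x \<le> V x)}"

lemma eventually_nhds_less_continuous:
  fixes h :: "'a::t2_space \<Rightarrow> real"
  assumes "open A" "continuous_on A h" "a \<in> A" "c < h a"
  shows "\<forall>\<^sub>F x in nhds a. c < h x"
  using continuous_on_open_imp_lsc[OF assms(1,2)] assms(3,4) by (auto simp: lsc_on_def)

text \<open>Strict inequality on the sphere pushes a maximum of \<open>v\<close> minus the quadratic
  into the open ball. Unlike exact touching at \<open>a\<close>, this condition survives replacing a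
  supremum by one nearly optimal competitor.\<close>

lemma subsolution_strict_test:
  fixes v :: "real^'n \<Rightarrow> real"
  assumes sub: "subsolution \<Omega> f v" and cont: "continuous_on (cball a r) v" and r: "r > 0" "cball a r \<subseteq> \<Omega>"
    and sym: "transpose M = M"
    and bd: "\<And>x. dist a x = r \<Longrightarrow> v x - quad p M (x - a) < v a"
  obtains y where "y \<in> ball a r" "f y \<le> det M"
proof -
  have "continuous_on (cball a r) (\<lambda>x. v x - quad p M (x - a))"
    by (intro continuous_on_diff cont continuous_intros)
  moreover have "cball a r \<noteq> {}" using r by auto
  ultimately have "\<exists>y\<in>cball a r. \<forall>x\<in>cball a r. v x - quad p M (x - a) \<le> v y - quad p M (y - a)"
    by (intro continuous_attains_sup) auto
  then obtain y where y: "y \<in> cball a r" and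
    max: "\<And>x. x \<in> cball a r \<Longrightarrow> v x - quad p M (x - a) \<le> v y - quad p M (y - a)" by blast
  have "dist a y \<noteq> r" using bd[of y] max[of a] r by auto
  then have yb: "y \<in> ball a r" using y by simp
  have "\<forall>\<^sub>F x in nhds y. x \<in> ball a r" using yb by (intro eventually_nhds_in_open) auto
  then have "\<forall>\<^sub>F x in nhds y. v x \<le> v y + quad (p + M *v (y - a)) M (x - y)"
  proof eventually_elim
    case (elim x)
    then show ?case using max[of x] quad_recenter[OF sym, of p x a y] by simp
  qed
  moreover have "y \<in> \<Omega>" using y r by auto
  ultimately have "f y \<le> det M" using sub sym by (auto simp: subsolution_def)
  then show ?thesis using that yb by blast
qed

theorem SUP_subsolution:
  fixes V :: "real^'n \<Rightarrow> real"
  assumes op: "open \<Omega>" and cv: "convex \<Omega>" and f: "continuous_on \<Omega> f"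
    and ne: "subsolutions_below \<Omega> f V \<noteq> {}"
  defines "w \<equiv> \<lambda>x. SUP v\<in>subsolutions_below \<Omega> f V. v x"
  shows "w \<in> subsolutions_below \<Omega> f V"
    and "\<And>v x. v \<in> subsolutions_below \<Omega> f V \<Longrightarrow> x \<in> \<Omega> \<Longrightarrow> v x \<le> w x"
proof -
  let ?S = "subsolutions_below \<Omega> f V"
  have bdd: "bdd_above ((\<lambda>v. v x) ` ?S)" if "x \<in> \<Omega>" for x
    using that by (intro bdd_aboveI[of _ "V x"]) (auto simp: subsolutions_below_def)
  show le: "v x \<le> w x" if "v \<in> ?S" "x \<in> \<Omega>" for v x
    unfolding w_def using that bdd by (intro cSUP_upper) auto
  have wV: "w x \<le> V x" if "x \<in> \<Omega>" for x
    unfolding w_def using that ne by (intro cSUP_least) (auto simp: subsolutions_below_def)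
  have cw: "convex_on \<Omega> w"
  proof (rule convex_onI[OF _ cv])
    fix t :: real and x y assume t: "0 < t" "t < 1" and xy: "x \<in> \<Omega>" "y \<in> \<Omega>"
    have "(SUP v\<in>?S. v ((1 - t) *\<^sub>R x + t *\<^sub>R y)) \<le> (1 - t) * w x + t * w y"
    proof (rule cSUP_least[OF ne])
      fix v assume v: "v \<in> ?S"
      then have "v ((1 - t) *\<^sub>R x + t *\<^sub>R y) \<le> (1 - t) * v x + t * v y"
        using t xy by (intro convex_onD) (auto simp: subsolutions_below_def)
      also have "\<dots> \<le> (1 - t) * w x + t * w y"
        using t le[OF v xy(1)] le[OF v xy(2)] by (intro add_mono mult_left_mono) auto
      finally show "v ((1 - t) *\<^sub>R x + t *\<^sub>R y) \<le> (1 - t) * w x + t * w y" .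
    qed
    then show "w ((1 - t) *\<^sub>R x + t *\<^sub>R y) \<le> (1 - t) * w x + t * w y" by (simp add: w_def)
  qed
  have "subsolution \<Omega> f w"
    unfolding subsolution_def
  proof (intro ballI allI impI, elim conjE)
    fix a p M assume a: "a \<in> \<Omega>" and sym: "transpose M = M"
      and max: "\<forall>\<^sub>F x in nhds a. w x \<le> w a + quad p M (x - a)"
    have "f a \<le> det (M + mat k)" if k: "k > 0" for k
    proof (rule field_le_epsilon)
      fix e :: real assume e: "e > 0"
      have "\<forall>\<^sub>F x in nhds a. f a - e < f x"
        using a e by (intro eventually_nhds_less_continuous[OF op f]) auto
      moreover have "\<forall>\<^sub>F x in nhds a. x \<in> \<Omega>" using op a by (rule eventually_nhds_in_open)
      ultimately have "\<forall>\<^sub>F x in nhds a. f a - e < f x \<and> x \<in> \<Omega> \<and> w x \<le> w a + quad p M (x - a)"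
        using max by eventually_elim simp
      then obtain d where d: "d > 0" "\<And>x. dist x a < d \<Longrightarrow> f a - e < f x \<and> x \<in> \<Omega> \<and> w x \<le> w a + quad p M (x - a)"
        unfolding eventually_nhds_metric by blast
      define r where "r = d / 2"
      have r: "r > 0" "\<And>x. dist a x \<le> r \<Longrightarrow> dist x a < d" using d(1) by (auto simp: r_def dist_commute)
      have rO: "cball a r \<subseteq> \<Omega>" using d(2) r(2) by auto
      \<comment> \<open>The added \<open>mat k\<close> lowers the difference by exactly
        \<open>k / 2 * r\<^sup>2\<close> on the sphere of radius \<open>r\<close>, so a competitor
        within this margin of \<open>w\<close> at \<open>a\<close> meets the strict condition
        there.\<close>
      have "w a - k / 2 * r\<^sup>2 < w a" using k r by simp
      then obtain v where v: "v \<in> ?S" "w a - k / 2 * r\<^sup>2 < v a"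
        unfolding w_def using less_cSUP_iff[OF ne bdd[OF a]] by blast
      have "continuous_on \<Omega> v" using v(1) op by (auto simp: subsolutions_below_def intro: convex_on_continuous)
      then have vc: "continuous_on (cball a r) v" using rO continuous_on_subset by blast
      have "v x - quad p (M + mat k) (x - a) < v a" if x: "dist a x = r" for x
      proof -
        have "(x - a) \<bullet> (x - a) = r\<^sup>2"
          using x by (simp add: dist_norm norm_minus_commute flip: power2_norm_eq_inner)
        moreover have "w x \<le> w a + quad p M (x - a)" "x \<in> \<Omega>" using d(2)[of x] r(2)[of x] x by auto
        moreover have "v x \<le> w x" using le[OF v(1)] \<open>x \<in> \<Omega>\<close> by blast
        ultimately show ?thesis using v(2) unfolding quad_add_mat by simp
      qed
      moreover have "subsolution \<Omega> f v" using v(1) by (simp add: subsolutions_below_def)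
      ultimately obtain y where y: "y \<in> ball a r" "f y \<le> det (M + mat k)"
        using subsolution_strict_test[OF _ vc r(1) rO transpose_add_mat[OF sym]] by blast
      then show "f a \<le> det (M + mat k) + e" using d(2)[of y] r(2)[of y] by auto
    qed
    then have "\<forall>\<^sub>F k in at_right 0. f a \<le> det (M + mat k)"
      by (auto simp: eventually_at_right_field intro!: exI[of _ 1])
    then have "f a \<le> det M"
      by (rule tendsto_lowerbound[OF tendsto_det_add_mat[OF tendsto_ident_at] _ trivial_limit_at_right_real])
    then show "pos_semidef M \<and> f a \<le> det M"
      using convex_touching_quad_psd[OF op a cw max] by blast
  qed
  then show "w \<in> ?S" using cw wV by (simp add: subsolutions_below_def)
qed

text \<open>A maximal subsolution below \<open>V\<close> that is touched from below by a quadratic with too large a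
  determinant could be raised by a bump, unless it touches \<open>V\<close> there.\<close>

theorem maximal_subsolution_is_supersolution:
  fixes V w :: "real^'n \<Rightarrow> real"
  assumes op: "open \<Omega>" and cv: "convex \<Omega>" and f: "continuous_on \<Omega> f"
    and lsc: "lsc_on \<Omega> V" and super: "supersolution \<Omega> f V"
    and w: "w \<in> subsolutions_below \<Omega> f V"
    and maximal: "\<And>v x. v \<in> subsolutions_below \<Omega> f V \<Longrightarrow> x \<in> \<Omega> \<Longrightarrow> v x \<le> w x"
  shows "supersolution \<Omega> f w"
  unfolding supersolution_def
proof (intro ballI allI impI, elim conjE, rule ccontr)
  fix a p M assume a: "a \<in> \<Omega>" and sym: "transpose M = M" and pd: "pos_def M"
    and min: "\<forall>\<^sub>F x in nhds a. w a + quad p M (x - a) \<le> w x" and "\<not> det M \<le> f a"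
  then have gt: "f a < det M" by simp
  have wconv: "convex_on \<Omega> w" and wsub: "subsolution \<Omega> f w" and wV: "\<And>x. x \<in> \<Omega> \<Longrightarrow> w x \<le> V x"
    using w by (auto simp: subsolutions_below_def)
  have wcont: "continuous_on \<Omega> w" using op wconv by (rule convex_on_continuous)
  have inO: "\<forall>\<^sub>F x in nhds a. x \<in> \<Omega>" using op a by (rule eventually_nhds_in_open)
  have "w a \<noteq> V a"
  proof
    assume eq: "w a = V a"
    have "\<forall>\<^sub>F x in nhds a. V a + quad p M (x - a) \<le> V x"
      using min inO by eventually_elim (use wV eq in fastforce)
    then have "det M \<le> f a" using super a sym pd by (auto simp: supersolution_def)
    then show False using gt by simp
  qed
  then have wVa: "w a < V a" using wV[OF a] by simp
  obtain t where t: "t > 0" "pos_def (M + mat (- t))" "f a < det (M + mat (- t))"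
    by (rule pos_def_shrink[OF pd gt])
  \<comment> \<open>Lowering the Hessian by \<open>t\<close> opens a gap growing like
    \<open>t / 2\<close> times the squared distance to \<open>a\<close>, so the lowered quadratic
    can be lifted near \<open>a\<close> without affecting \<open>w\<close> farther out.\<close>
  define N where "N = M + mat (- t)"
  have Nsym: "transpose N = N" using transpose_add_mat[OF sym] by (simp add: N_def)
  have Npd: "pos_def N" using t(2) by (simp add: N_def)
  define q where "q x = w a + quad p N (x - a)" for x
  have qcont: "continuous_on A q" for A unfolding q_def by (intro continuous_intros)
  have qa: "q a = w a" by (simp add: q_def)
  \<comment> \<open>A quarter of the gap to the obstacle: near \<open>a\<close> the lifted quadratic
    stays below \<open>w a + 2 * m\<close>, and \<open>V\<close> stays above it.\<close>
  define m where "m = (V a - w a) / 4"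
  have m: "m > 0" using wVa by (simp add: m_def)
  have "\<forall>\<^sub>F x in nhds a. w a + 2 * m < V x"
    using wVa by (intro lsc[unfolded lsc_on_def, rule_format, OF a]) (simp add: m_def field_simps)
  moreover have "\<forall>\<^sub>F x in nhds a. - (w a + m) < - q x"
    using m qa by (intro eventually_nhds_less_continuous[OF open_UNIV]) (auto intro!: continuous_on_minus qcont)
  moreover have "\<forall>\<^sub>F x in nhds a. - det N < - f x"
    using t(3) by (intro eventually_nhds_less_continuous[OF op _ a]) (auto intro!: continuous_on_minus f simp: N_def)
  ultimately have "\<forall>\<^sub>F x in nhds a. w a + 2 * m < V x \<and> q x < w a + m \<and> f x < det N \<and> x \<in> \<Omega>
     \<and> w a + quad p M (x - a) \<le> w x"
    using inO min by eventually_elim simp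
  then obtain d where d: "d > 0" "\<And>x. dist x a < d \<Longrightarrow> w a + 2 * m < V x \<and> q x < w a + m \<and> f x < det N \<and> x \<in> \<Omega>
     \<and> w a + quad p M (x - a) \<le> w x"
    unfolding eventually_nhds_metric by blast
  \<comment> \<open>The second bound is the gap at radius \<open>d / 2\<close>; from there on the
    lifted quadratic no longer exceeds \<open>w\<close>.\<close>
  define \<gamma> where "\<gamma> = min m (t * d\<^sup>2 / 8)"
  have \<gamma>: "\<gamma> > 0" "\<gamma> \<le> m" "\<gamma> \<le> t * d\<^sup>2 / 8" using m t d(1) by (auto simp: \<gamma>_def)
  have ring: "q x + \<gamma> \<le> w x" if x: "dist x a < d" "dist x a \<ge> d / 2" for x
  proof -
    have "(d / 2)\<^sup>2 \<le> (norm (x - a))\<^sup>2" using x d(1) by (intro power_mono) (auto simp: dist_norm)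
    then have "d\<^sup>2 / 4 \<le> (x - a) \<bullet> (x - a)" by (simp add: power2_norm_eq_inner power_divide)
    then have "t / 2 * (d\<^sup>2 / 4) \<le> t / 2 * ((x - a) \<bullet> (x - a))" using t by (intro mult_left_mono) auto
    then show ?thesis using d(2)[OF x(1)] \<gamma>(3)
      unfolding q_def N_def quad_add_mat by (simp add: field_simps)
  qed
  define W where "W x = (if dist x a < d then max (w x) (q x + \<gamma>) else w x)" for x
  have wW: "w x \<le> W x" for x by (simp add: W_def)
  have W_far: "W x = w x" if "dist x a > d / 2" for x using ring[of x] that by (auto simp: W_def max_def)
  \<comment> \<open>\<open>W\<close> equals \<open>w\<close> beyond radius \<open>d / 2\<close> and
    a maximum of continuous functions within radius \<open>d\<close>; these two regions are open and
    overlap.\<close>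
  have Wcont: "isCont W x" if x: "x \<in> \<Omega>" for x
  proof (cases "dist x a < d")
    case True
    then have "x \<in> ball a d" by (simp add: dist_commute)
    moreover have "continuous_on (ball a d) (\<lambda>x. max (w x) (q x + \<gamma>))"
      by (intro continuous_on_max continuous_on_add qcont continuous_on_const continuous_on_subset[OF wcont])
        (use d(2) in \<open>auto simp: dist_commute\<close>)
    then have "continuous_on (ball a d) W"
      by (rule continuous_on_eq) (simp add: W_def dist_commute)
    ultimately show ?thesis using continuous_on_eq_continuous_at[OF open_ball] by blast
  next
    case False
    let ?A = "\<Omega> - cball a (d / 2)"
    have "x \<in> ?A" "open ?A" using False d(1) x op by (auto simp: dist_commute)
    moreover have "continuous_on ?A W"
      by (rule continuous_on_eq[OF continuous_on_subset[OF wcont, of ?A]]) (auto simp: W_far dist_commute)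
    ultimately show ?thesis using continuous_on_eq_continuous_at by blast
  qed
  then have "continuous_on \<Omega> W" by (simp add: continuous_at_imp_continuous_on)
  then have Wusc: "usc_on \<Omega> W" using op by (intro continuous_on_open_imp_usc)
  have Wsub: "subsolution \<Omega> f W"
    unfolding subsolution_def
  proof (intro ballI allI impI, elim conjE)
    fix b p' N' assume b: "b \<in> \<Omega>" and sym': "transpose N' = N'"
      and max: "\<forall>\<^sub>F x in nhds b. W x \<le> W b + quad p' N' (x - b)"
    show "pos_semidef N' \<and> f b \<le> det N'"
    \<comment> \<open>Where \<open>W\<close> equals \<open>w\<close>, a test of \<open>W\<close> is
      a test of \<open>w\<close>. Elsewhere the test dominates the lifted quadratic, so its matrix
      dominates \<open>N\<close>, whose determinant exceeds \<open>f\<close>.\<close>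
    proof (cases "W b = w b")
      case True
      have "\<forall>\<^sub>F x in nhds b. w x \<le> w b + quad p' N' (x - b)"
        using max by eventually_elim (use wW True in \<open>auto intro: order_trans\<close>)
      then show ?thesis using wsub b sym' by (auto simp: subsolution_def)
    next
      case False
      then have bd: "dist b a < d" "W b = q b + \<gamma>" by (auto simp: W_def max_def split: if_splits)
      have "\<forall>\<^sub>F x in nhds b. x \<in> ball a d"
        using bd by (intro eventually_nhds_in_open) (auto simp: dist_commute)
      with max have "\<forall>\<^sub>F x in nhds b. quad (p + N *v (b - a)) N (x - b) \<le> quad p' N' (x - b)"
      proof eventually_elim
        case (elim x)
        have "q x + \<gamma> \<le> W x" using elim(2) by (simp add: W_def dist_commute)
        also have "q x = q b + quad (p + N *v (b - a)) N (x - b)"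
          using quad_recenter[OF Nsym, of p x a b] by (simp add: q_def)
        finally show ?case using elim(1) bd(2) by simp
      qed
      from quad_le_near[OF this] have NN: "y \<bullet> (N *v y) \<le> y \<bullet> (N' *v y)" for y .
      have "det N \<le> det N'" by (rule det_mono[OF Nsym sym' Npd NN])
      moreover have "f b < det N" using d(2)[OF bd(1)] by blast
      moreover have "pos_semidef N'"
        using pos_def_imp_semidef[OF Npd] NN unfolding pos_semidef_def by (meson order_trans)
      ultimately show ?thesis by simp
    qed
  qed
  \<comment> \<open>Convexity is not evident from the gluing; it is recovered from the
    semidefiniteness built into the subsolution tests.\<close>
  have "convex_on \<Omega> W"
    by (rule psd_tests_imp_convex[OF op cv Wusc subsolution_imp_psd_tests[OF Wsub]])
  moreover have "W x \<le> V x" if "x \<in> \<Omega>" for x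
    using wV[OF that] d(2)[of x] \<gamma>(2) by (auto simp: W_def)
  ultimately have "W \<in> subsolutions_below \<Omega> f V" using Wsub by (simp add: subsolutions_below_def)
  from maximal[OF this a] have "q a + \<gamma> \<le> w a" using d(1) by (simp add: W_def)
  then show False using \<gamma>(1) qa by simp
qed

text \<open>The supremum of the competitors solves the equation inside. At a frontier point
  \<open>low\<close> and \<open>up\<close> squeeze it between functions that are continuous up to
  the frontier and close to \<open>g z\<close> there, so extending by \<open>g\<close> gives a
  continuous function.\<close>

theorem perron:
  fixes V :: "real^'n \<Rightarrow> real"
  assumes op: "open \<Omega>" and cv: "convex \<Omega>" and f: "continuous_on \<Omega> f" "\<And>x. x \<in> \<Omega> \<Longrightarrow> 0 \<le> f x"
    and g: "continuous_on (frontier \<Omega>) g"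
    and lsc: "lsc_on \<Omega> V" and super: "supersolution \<Omega> f V"
    and ne: "subsolutions_below \<Omega> f V \<noteq> {}"
    and low: "\<And>z e. z \<in> frontier \<Omega> \<Longrightarrow> e > 0 \<Longrightarrow>
       \<exists>v\<in>subsolutions_below \<Omega> f V. continuous_on (closure \<Omega>) v \<and> (\<forall>x\<in>frontier \<Omega>. v x \<le> g x) \<and> g z - e \<le> v z"
    and up: "\<And>z e. z \<in> frontier \<Omega> \<Longrightarrow> e > 0 \<Longrightarrow>
       \<exists>l. continuous_on (closure \<Omega>) l \<and> (\<forall>x\<in>\<Omega>. V x \<le> l x) \<and> (\<forall>x\<in>frontier \<Omega>. g x \<le> l x) \<and> l z \<le> g z + e"
  obtains W where "viscosity_solution \<Omega> f g W" "\<And>x. x \<in> \<Omega> \<Longrightarrow> W x \<le> V x"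
    "\<And>v x. v \<in> subsolutions_below \<Omega> f V \<Longrightarrow> x \<in> \<Omega> \<Longrightarrow> v x \<le> W x"
proof -
  define w where "w = (\<lambda>x. SUP v\<in>subsolutions_below \<Omega> f V. v x)"
  have wS: "w \<in> subsolutions_below \<Omega> f V"
    and wmax: "\<And>v x. v \<in> subsolutions_below \<Omega> f V \<Longrightarrow> x \<in> \<Omega> \<Longrightarrow> v x \<le> w x"
    using SUP_subsolution[OF op cv f(1) ne] by (auto simp: w_def)
  have wconv: "convex_on \<Omega> w" and wsub: "subsolution \<Omega> f w" and wV: "\<And>x. x \<in> \<Omega> \<Longrightarrow> w x \<le> V x"
    using wS by (auto simp: subsolutions_below_def)
  have wcont: "continuous_on \<Omega> w" using op wconv by (rule convex_on_continuous)
  have wsuper: "supersolution \<Omega> f w"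
    by (rule maximal_subsolution_is_supersolution[OF op cv f(1) lsc super wS]) (rule wmax)
  define W where "W x = (if x \<in> \<Omega> then w x else g x)" for x
  have clos: "x \<in> \<Omega> \<or> x \<in> frontier \<Omega>" if "x \<in> closure \<Omega>" for x
    using that op by (auto simp: frontier_def interior_open)
  have frO: "x \<notin> \<Omega>" if "x \<in> frontier \<Omega>" for x using that op by (simp add: frontier_def interior_open)
  have Wcont: "continuous_on (closure \<Omega>) W"
    unfolding continuous_on
  proof
    fix z assume z: "z \<in> closure \<Omega>"
    show "(W \<longlongrightarrow> W z) (at z within closure \<Omega>)"
    proof (cases "z \<in> \<Omega>")
      case True
      have "continuous_on \<Omega> W" using wcont by (rule continuous_on_eq) (simp add: W_def)
      then have "isCont W z" using continuous_on_eq_continuous_at[OF op] True by blast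
      then show ?thesis
        using continuous_at_imp_continuous_at_within[of z W "closure \<Omega>"] by (simp add: continuous_within)
    next
      case False
      then have zf: "z \<in> frontier \<Omega>" using clos z by blast
      show ?thesis
      proof (rule tendstoI)
        fix e :: real assume e: "e > 0"
        obtain v where v: "v \<in> subsolutions_below \<Omega> f V" "continuous_on (closure \<Omega>) v"
          "\<forall>x\<in>frontier \<Omega>. v x \<le> g x" "g z - e / 2 \<le> v z" using low[OF zf, of "e / 2"] e by auto
        obtain l where l: "continuous_on (closure \<Omega>) l" "\<forall>x\<in>\<Omega>. V x \<le> l x"
          "\<forall>x\<in>frontier \<Omega>. g x \<le> l x" "l z \<le> g z + e / 2" using up[OF zf, of "e / 2"] e by auto
        have "(v \<longlongrightarrow> v z) (at z within closure \<Omega>)" "(l \<longlongrightarrow> l z) (at z within closure \<Omega>)"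
          using v(2) l(1) z by (auto simp: continuous_on)
        then have "\<forall>\<^sub>F x in at z within closure \<Omega>. g z - e < v x" "\<forall>\<^sub>F x in at z within closure \<Omega>. l x < g z + e"
          using v(4) l(4) e by (auto intro: order_tendstoD)
        moreover have "\<forall>\<^sub>F x in at z within closure \<Omega>. x \<in> closure \<Omega>" by (simp add: eventually_at_filter)
        ultimately show "\<forall>\<^sub>F x in at z within closure \<Omega>. dist (W x) (W z) < e"
        proof eventually_elim
          case (elim x)
          have "v x \<le> W x \<and> W x \<le> l x"
          proof (cases "x \<in> \<Omega>")
            case True
            then show ?thesis using wmax[OF v(1) True] wV[OF True] l(2) by (force simp: W_def)
          next
            case False
            then have "x \<in> frontier \<Omega>" using clos elim by blast
            then show ?thesis using v(3) l(3) False by (auto simp: W_def)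
          qed
          moreover have "W z = g z" using False by (simp add: W_def)
          ultimately show ?case using elim(1,2) unfolding dist_real_def by linarith
        qed
      qed
    qed
  qed
  have Wconv: "convex_on (closure \<Omega>) W"
  proof (rule convex_onI)
    fix t :: real and x y assume t: "0 < t" "t < 1" and xy: "x \<in> closure \<Omega>" "y \<in> closure \<Omega>"
    \<comment> \<open>The convexity defect as a continuous function of both endpoints; its sign on
      \<open>\<Omega> \<times> \<Omega>\<close> passes to the closure.\<close>
    let ?h = "\<lambda>(x, y). (1 - t) * W x + t * W y - W ((1 - t) *\<^sub>R x + t *\<^sub>R y)"
    have ccl: "convex (closure \<Omega>)" using cv by (rule convex_closure)
    have hc: "continuous_on (closure (\<Omega> \<times> \<Omega>)) ?h"
      unfolding closure_Times split_def
      by (intro continuous_intros continuous_on_compose2[OF Wcont])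
        (use t in \<open>auto intro!: convexD_alt[OF ccl]\<close>)
    have h0: "?h z \<ge> 0" if z: "z \<in> \<Omega> \<times> \<Omega>" for z
    proof -
      obtain a b where ab: "z = (a, b)" "a \<in> \<Omega>" "b \<in> \<Omega>" using z by auto
      then have "(1 - t) *\<^sub>R a + t *\<^sub>R b \<in> \<Omega>" using t by (intro convexD_alt[OF cv]) auto
      moreover have "w ((1 - t) *\<^sub>R a + t *\<^sub>R b) \<le> (1 - t) * w a + t * w b"
        using ab t by (intro convex_onD[OF wconv]) auto
      ultimately show ?thesis using ab by (simp add: W_def)
    qed
    have "(x, y) \<in> closure (\<Omega> \<times> \<Omega>)" using xy by (simp add: closure_Times)
    from continuous_ge_on_closure[OF hc this h0]
    show "W ((1 - t) *\<^sub>R x + t *\<^sub>R y) \<le> (1 - t) * W x + t * W y" by simp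
  qed (use cv in \<open>rule convex_closure\<close>)
  have near: "\<forall>\<^sub>F x in nhds a. W x = w x" if "a \<in> \<Omega>" for a
    using eventually_nhds_in_open[OF op that] by eventually_elim (simp add: W_def)
  have "viscosity_solution \<Omega> f g W"
    unfolding viscosity_solution_def
  proof (intro conjI allI ballI impI, goal_cases)
    case (3 x) then show ?case using frO by (simp add: W_def)
  next
    case (4 \<phi> G D a)
    have "\<forall>\<^sub>F x in nhds a. w x - \<phi> x \<le> w a - \<phi> a"
      using 4(3) near[OF 4(1)] by eventually_elim (use 4(1) in \<open>simp add: W_def\<close>)
    then show ?case using subsolution_C2_test[OF op wsub] 4 by blast
  next
    case (5 \<phi> G D a)
    have "\<forall>\<^sub>F x in nhds a. w a - \<phi> a \<le> w x - \<phi> x"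
      using 5(3) near[OF 5(1)] by eventually_elim (use 5(1) in \<open>simp add: W_def\<close>)
    then show ?case using supersolution_C2_test[OF op wsuper] 5 f(2) by blast
  qed (fact Wcont Wconv)+
  then show ?thesis using that wV wmax by (simp add: W_def)
qed

section \<open>Discrete comparison with quadratics\<close>

text \<open>Expanded around the convex combination, the convexity defect is exactly
  \<open>(1 - t) * t * (d \<bullet> (M *v d)) / 2\<close>.\<close>

lemma convex_on_quad:
  fixes M :: "real^'n^'n"
  assumes "convex S" "transpose M = M" "pos_semidef M"
  shows "convex_on S (\<lambda>x. c + quad p M (x - z))"
proof (rule convex_onI[OF _ assms(1)])
  fix t :: real and x y :: "real^'n" assume t: "0 < t" "t < 1"
  define m where "m = (1 - t) *\<^sub>R x + t *\<^sub>R y"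
  define d where "d = x - y"
  define p' where "p' = p + M *v (m - z)"
  have "x - m = t *\<^sub>R d" "y - m = (t - 1) *\<^sub>R d" by (simp_all add: m_def d_def algebra_simps)
  then have eqs: "quad p M (x - z) = quad p M (m - z) + (t * (p' \<bullet> d) + t\<^sup>2 * (d \<bullet> (M *v d)) / 2)"
    "quad p M (y - z) = quad p M (m - z) + ((t - 1) * (p' \<bullet> d) + (t - 1)\<^sup>2 * (d \<bullet> (M *v d)) / 2)"
    using quad_recenter[OF assms(2), of p x z m] quad_recenter[OF assms(2), of p y z m]
    by (simp_all add: p'_def[symmetric] quad_def[of p'] matrix_vector_mult_scaleR power2_eq_square)
  have "(1 - t) * (c + quad p M (x - z)) + t * (c + quad p M (y - z)) - (c + quad p M (m - z))
    = (1 - t) * t * (d \<bullet> (M *v d)) / 2"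
    unfolding eqs by (simp add: field_simps power2_eq_square)
  moreover have "0 \<le> (1 - t) * t * (d \<bullet> (M *v d)) / 2"
    using t assms(3) by (simp add: pos_semidef_def)
  ultimately show "c + quad p M ((1 - t) *\<^sub>R x + t *\<^sub>R y - z) \<le> (1 - t) * (c + quad p M (x - z)) + t * (c + quad p M (y - z))"
    by (simp add: m_def)
qed

section \<open>Piecewise affine functions on simplicial meshes\<close>

lemma simplex_extreme_points:
  fixes K :: "(real^'n) set"
  assumes "simplicial_mesh \<T>" "K \<in> \<T>"
  shows "K = convex hull {x. x extreme_point_of K}" "{x. x extreme_point_of K} \<subseteq> nodes \<T>" "compact K" "convex K" "K \<noteq> {}"
proof -
  have s: "int CARD('n) simplex K" using assms by (auto simp: simplicial_mesh_def)
  show "compact K" "convex K" using s by (auto intro: compact_simplex convex_simplex)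
  then show "K = convex hull {x. x extreme_point_of K}" by (rule Krein_Milman_Minkowski)
  show "K \<noteq> {}" using s by (auto simp: simplex_empty)
  show "{x. x extreme_point_of K} \<subseteq> nodes \<T>" using assms by (auto simp: nodes_def)
qed

lemma finite_nodes:
  fixes \<T> :: "(real^'n) set set"
  assumes "simplicial_mesh \<T>"
  shows "finite (nodes \<T>)"
  unfolding nodes_def
proof (rule finite_UN_I)
  show "finite \<T>" using assms by (simp add: simplicial_mesh_def triangulation_def)
  fix K assume "K \<in> \<T>"
  then have "int CARD('n) simplex K" using assms by (simp add: simplicial_mesh_def)
  then show "finite {x. x extreme_point_of K}"
    by (intro finite_polyhedron_extreme_points simplex_imp_polyhedron)
qed

lemma nodes_nonempty:
  fixes \<T> :: "(real^'n) set set"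
  assumes "simplicial_mesh \<T>" shows "nodes \<T> \<noteq> {}"
proof -
  obtain K where K: "K \<in> \<T>" using assms by (auto simp: simplicial_mesh_def)
  have "{x. x extreme_point_of K} \<noteq> {}"
    using simplex_extreme_points(1,5)[OF assms K] by (metis convex_hull_empty)
  then show ?thesis using simplex_extreme_points(2)[OF assms K] by blast
qed

lemma nodes_subset_mesh_domain: "nodes \<T> \<subseteq> mesh_domain \<T>"
  by (auto simp: nodes_def mesh_domain_def extreme_point_of_def)

lemma compact_mesh_domain:
  fixes \<T> :: "(real^'n) set set"
  assumes "simplicial_mesh \<T>" shows "compact (mesh_domain \<T>)"
  unfolding mesh_domain_def
  using assms simplex_extreme_points(3)[OF assms]
  by (intro compact_Union) (auto simp: simplicial_mesh_def triangulation_def)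

lemma interior_nodes_interior:
  fixes \<T> :: "(real^'n) set set"
  assumes "simplicial_mesh \<T>"
  shows "x \<in> interior_nodes \<T> \<longleftrightarrow> x \<in> nodes \<T> \<and> x \<in> interior (mesh_domain \<T>)"
  using nodes_subset_mesh_domain[of \<T>] compact_mesh_domain[OF assms, THEN compact_imp_closed]
  by (auto simp: interior_nodes_def boundary_nodes_def frontier_def closure_closed)

lemma dist_le_mesh_size:
  fixes K :: "(real^'n) set"
  assumes "simplicial_mesh \<T>" "K \<in> \<T>" "x \<in> K" "y \<in> K"
  shows "dist x y \<le> mesh_size \<T>"
proof -
  have "dist x y \<le> diameter K"
    using simplex_extreme_points(3)[OF assms(1,2)] assms(3,4)
    by (intro diameter_bounded_bound compact_imp_bounded)
  also have "\<dots> \<le> mesh_size \<T>"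
    using assms(1,2) by (auto simp: mesh_size_def simplicial_mesh_def triangulation_def intro: Max_ge)
  finally show ?thesis .
qed

lemma fe_space_uminus: "w \<in> fe_space \<T> \<Longrightarrow> (\<lambda>x. - w x) \<in> fe_space \<T>"
  unfolding fe_space_def
proof (intro CollectI conjI ballI)
  fix K assume w: "w \<in> {w. continuous_on (mesh_domain \<T>) w \<and> (\<forall>K\<in>\<T>. \<exists>a b. \<forall>x\<in>K. w x = a \<bullet> x + b)}" and "K \<in> \<T>"
  then obtain a b where "\<forall>x\<in>K. w x = a \<bullet> x + b" by blast
  then show "\<exists>a b. \<forall>x\<in>K. - w x = a \<bullet> x + b" by (intro exI[of _ "- a"] exI[of _ "- b"]) simp
qed (auto intro: continuous_on_minus)

text \<open>Subtracting from \<open>\<phi>\<close> the affine function that \<open>w\<close> is on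
  \<open>K\<close> leaves a convex function, which on a simplex is bounded by its values at the
  vertices.\<close>

lemma fe_ge_convex:
  fixes w :: "real^'n \<Rightarrow> real"
  assumes T: "simplicial_mesh \<T>" "K \<in> \<T>" and w: "w \<in> fe_space \<T>" and \<phi>: "convex_on K \<phi>"
    and le: "\<And>x. x extreme_point_of K \<Longrightarrow> \<phi> x \<le> w x" and y: "y \<in> K"
  shows "\<phi> y \<le> w y"
proof -
  obtain a b where ab: "\<And>x. x \<in> K \<Longrightarrow> w x = a \<bullet> x + b" using w T(2) by (auto simp: fe_space_def)
  note K = simplex_extreme_points[OF T]
  have "convex_on K (\<lambda>x. - (a \<bullet> x) - b)"
    by (rule convex_onI[OF _ K(4)]) (simp add: inner_add_right algebra_simps)
  then have "convex_on K (\<lambda>x. \<phi> x + (- (a \<bullet> x) - b))" by (rule convex_on_add[OF \<phi>])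
  then have "convex_on (convex hull {x. x extreme_point_of K}) (\<lambda>x. \<phi> x + (- (a \<bullet> x) - b))"
    using K(1) by simp
  moreover have "\<forall>x\<in>{x. x extreme_point_of K}. \<phi> x + (- (a \<bullet> x) - b) \<le> 0"
    using le ab by (fastforce simp: extreme_point_of_def)
  ultimately have "\<forall>x\<in>convex hull {x. x extreme_point_of K}. \<phi> x + (- (a \<bullet> x) - b) \<le> 0"
    by (rule convex_on_convex_hull_bound)
  then have "\<phi> y + (- (a \<bullet> y) - b) \<le> 0" using y K(1) by blast
  then show ?thesis using ab[OF y] by simp
qed

text \<open>On each element \<open>w - \<phi>\<close> is concave, so its minimum sits at a vertex.
  Comparison with convex barriers is therefore exact, free of interpolation error.\<close>

lemma fe_minus_convex_min_at_node:
  fixes w :: "real^'n \<Rightarrow> real"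
  assumes T: "simplicial_mesh \<T>" and w: "w \<in> fe_space \<T>" and \<phi>: "convex_on UNIV \<phi>"
  obtains a where "a \<in> nodes \<T>" "\<And>x. x \<in> mesh_domain \<T> \<Longrightarrow> \<phi> x + (w a - \<phi> a) \<le> w x"
proof -
  define a where "a = arg_min_on (\<lambda>x. w x - \<phi> x) (nodes \<T>)"
  have a: "a \<in> nodes \<T>" "\<And>x. x \<in> nodes \<T> \<Longrightarrow> w a - \<phi> a \<le> w x - \<phi> x"
    using arg_min_if_finite(1)[OF finite_nodes[OF T] nodes_nonempty[OF T], of "\<lambda>x. w x - \<phi> x"]
      arg_min_least[OF finite_nodes[OF T] nodes_nonempty[OF T], of _ "\<lambda>x. w x - \<phi> x"]
    by (auto simp: a_def)
  have "\<phi> x + (w a - \<phi> a) \<le> w x" if x: "x \<in> mesh_domain \<T>" for x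
  proof -
    obtain K where K: "K \<in> \<T>" "x \<in> K" using x by (auto simp: mesh_domain_def)
    have "convex_on K (\<lambda>x. \<phi> x + (w a - \<phi> a))"
      using convex_on_subset[OF \<phi>, of K] simplex_extreme_points(4)[OF T K(1)]
      by (intro convex_on_add) (auto simp: convex_on_const)
    then show ?thesis
    proof (rule fe_ge_convex[OF T K(1) w _ _ K(2)])
      fix y assume "y extreme_point_of K"
      then have "y \<in> nodes \<T>" using simplex_extreme_points(2)[OF T K(1)] by blast
      from a(2)[OF this] show "\<phi> y + (w a - \<phi> a) \<le> w y" by simp
    qed
  qed
  then show ?thesis using that a(1) by blast
qed

text \<open>At the vertices the quadratic exceeds its tangent plane at \<open>y\<close> by at most
  \<open>C / 2\<close> times the squared mesh size; the affine piece of \<open>w\<close> is compared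
  with the plane raised by this amount.\<close>

lemma fe_le_quad:
  fixes w :: "real^'n \<Rightarrow> real"
  assumes T: "simplicial_mesh \<T>" "K \<in> \<T>" and w: "w \<in> fe_space \<T>" and sym: "transpose M = M"
    and C: "\<And>x. x \<bullet> (M *v x) \<le> C * (x \<bullet> x)" "C \<ge> 0"
    and le: "\<And>x. x extreme_point_of K \<Longrightarrow> w x \<le> s + quad p M (x - a)" and y: "y \<in> K"
  shows "w y \<le> s + quad p M (y - a) + C / 2 * (mesh_size \<T>)\<^sup>2"
proof -
  define p' where "p' = p + M *v (y - a)"
  define e where "e = C / 2 * (mesh_size \<T>)\<^sup>2"
  define \<phi> where "\<phi> x = - (s + quad p M (y - a) + e) - p' \<bullet> (x - y)" for x
  have "convex_on K \<phi>"
    unfolding \<phi>_def by (rule convex_onI[OF _ simplex_extreme_points(4)[OF T]]) (simp add: inner_add_right inner_diff_right algebra_simps)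
  then have "\<phi> y \<le> - w y"
  proof (rule fe_ge_convex[OF T fe_space_uminus[OF w] _ _ y])
    fix x assume x: "x extreme_point_of K"
    then have "norm (x - y) \<le> mesh_size \<T>"
      using dist_le_mesh_size[OF T _ y, of x] by (simp add: extreme_point_of_def dist_norm)
    then have "(norm (x - y))\<^sup>2 \<le> (mesh_size \<T>)\<^sup>2" by (intro power_mono) auto
    then have "C * ((x - y) \<bullet> (x - y)) \<le> C * (mesh_size \<T>)\<^sup>2"
      using C(2) by (simp add: power2_norm_eq_inner mult_left_mono)
    then have "(x - y) \<bullet> (M *v (x - y)) / 2 \<le> e" using C(1)[of "x - y"] by (simp add: e_def)
    moreover have "quad p M (x - a) = quad p M (y - a) + (p' \<bullet> (x - y) + (x - y) \<bullet> (M *v (x - y)) / 2)"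
      using quad_recenter[OF sym, of p x a y] by (simp add: p'_def quad_def)
    ultimately show "\<phi> x \<le> - w x" using le[OF x] by (simp add: \<phi>_def)
  qed
  then show ?thesis by (simp add: \<phi>_def e_def)
qed

section \<open>Second differences and the discrete operator\<close>

lemma step_factor_eqI:
  assumes "cball x \<delta> \<subseteq> mesh_domain \<T>" "\<delta> > 0"
  shows "step_factor \<T> \<delta> x = 1"
  unfolding step_factor_def
proof (rule Greatest_equality)
  show "0 < (1::real) \<and> 1 \<le> (1::real) \<and> (\<forall>v\<in>sphere 0 1. x + (1 * \<delta>) *\<^sub>R v \<in> mesh_domain \<T> \<and> x - (1 * \<delta>) *\<^sub>R v \<in> mesh_domain \<T>)"
    using assms by (auto simp: dist_norm subset_eq)
qed auto

text \<open>\<open>GREATEST\<close> is meaningful only if the maximum is attained. Closedness of the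
  mesh domain makes the supremum of the admissible factors admissible, and interiority of
  \<open>x\<close> provides a positive one.\<close>

lemma step_factor:
  fixes x :: "real^'n"
  assumes "closed (mesh_domain \<T>)" "x \<in> interior (mesh_domain \<T>)" "\<delta> > 0"
  shows "0 < step_factor \<T> \<delta> x" "step_factor \<T> \<delta> x \<le> 1"
    "\<And>v. norm v = 1 \<Longrightarrow> x + (step_factor \<T> \<delta> x * \<delta>) *\<^sub>R v \<in> mesh_domain \<T>"
    "\<And>v. norm v = 1 \<Longrightarrow> x - (step_factor \<T> \<delta> x * \<delta>) *\<^sub>R v \<in> mesh_domain \<T>"
proof -
  let ?D = "mesh_domain \<T>"
  let ?Q = "\<lambda>t. 0 < t \<and> t \<le> 1 \<and> (\<forall>v\<in>sphere 0 1. x + (t * \<delta>) *\<^sub>R v \<in> ?D \<and> x - (t * \<delta>) *\<^sub>R v \<in> ?D)"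
  define R where "R = Collect ?Q"
  have R_iff: "t \<in> R \<longleftrightarrow> ?Q t" for t
    by (simp only: R_def mem_Collect_eq)
  obtain r where r: "r > 0" "cball x r \<subseteq> ?D" using assms(2) mem_interior_cball by blast
  define \<rho> where "\<rho> = min 1 (r / \<delta>)"
  have \<rho>: "\<rho> > 0" "\<rho> \<le> 1" "\<rho> * \<delta> \<le> r" using r(1) assms(3) by (simp_all add: \<rho>_def min_le_iff_disj pos_le_divide_eq[symmetric])
  have "x + (\<rho> * \<delta>) *\<^sub>R v \<in> cball x r \<and> x - (\<rho> * \<delta>) *\<^sub>R v \<in> cball x r" if "v \<in> sphere 0 1" for v
    using that \<rho> assms(3) by (simp add: dist_norm abs_mult)
  then have "\<forall>v\<in>sphere 0 1. x + (\<rho> * \<delta>) *\<^sub>R v \<in> ?D \<and> x - (\<rho> * \<delta>) *\<^sub>R v \<in> ?D" using r(2) by blast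
  then have RI: "\<rho> \<in> R" using \<rho>(1,2) unfolding R_iff by blast
  have bdd: "bdd_above R" by (intro bdd_aboveI[of _ 1]) (simp add: R_def)
  have cl: "Sup R \<in> closure R" using RI bdd by (intro closure_contains_Sup) auto
  have closedR: "closed {t. x + (t * \<delta>) *\<^sub>R v \<in> ?D \<and> x - (t * \<delta>) *\<^sub>R v \<in> ?D}" for v
  proof -
    have "closed ((\<lambda>t. x + (t * \<delta>) *\<^sub>R v) -` ?D)" "closed ((\<lambda>t. x - (t * \<delta>) *\<^sub>R v) -` ?D)"
      by (intro continuous_closed_vimage assms(1) continuous_intros)+
    then show ?thesis by (simp add: closed_Int vimage_def Collect_conj_eq)
  qed
  have "Sup R \<in> {t. x + (t * \<delta>) *\<^sub>R v \<in> ?D \<and> x - (t * \<delta>) *\<^sub>R v \<in> ?D}" if "v \<in> sphere 0 1" for v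
  proof -
    have "R \<subseteq> {t. x + (t * \<delta>) *\<^sub>R v \<in> ?D \<and> x - (t * \<delta>) *\<^sub>R v \<in> ?D}"
      using that unfolding R_def by blast
    from closure_minimal[OF this closedR[of v]] show ?thesis using cl by blast
  qed
  moreover have "0 < Sup R" using cSup_upper[OF RI bdd] \<rho> by simp
  moreover have "Sup R \<le> 1" using RI by (intro cSup_least) (blast, simp add: R_iff)
  ultimately have SR: "Sup R \<in> R" unfolding R_iff by blast
  have "step_factor \<T> \<delta> x = Sup R"
    unfolding step_factor_def
  proof (rule Greatest_equality)
    show "?Q (Sup R)"
      using SR unfolding R_iff .
  next
    fix y assume "?Q y"
    then have "y \<in> R" unfolding R_iff .
    then show "y \<le> Sup R" using bdd by (rule cSup_upper)
  qed
  then show "0 < step_factor \<T> \<delta> x" "step_factor \<T> \<delta> x \<le> 1"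
    "\<And>v. norm v = 1 \<Longrightarrow> x + (step_factor \<T> \<delta> x * \<delta>) *\<^sub>R v \<in> mesh_domain \<T>"
    "\<And>v. norm v = 1 \<Longrightarrow> x - (step_factor \<T> \<delta> x * \<delta>) *\<^sub>R v \<in> mesh_domain \<T>"
    using SR unfolding R_iff by auto
qed

lemma second_difference_uminus:
  "second_difference \<T> \<delta> (\<lambda>x. - w x) x v = - second_difference \<T> \<delta> w x v"
  unfolding second_difference_def Let_def minus_divide_left by (rule arg_cong2[where f = "(/)"]) auto

text \<open>Opposite steps cancel the gradient, while the error \<open>e\<close>, incurred at both
  endpoints, is divided by the squared step length.\<close>

lemma second_difference_le_quad:
  fixes w :: "real^'n \<Rightarrow> real"
  assumes "0 < step_factor \<T> \<delta> x" "\<delta> > 0"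
    and "w (x + (step_factor \<T> \<delta> x * \<delta>) *\<^sub>R v) \<le> w x + quad p M ((step_factor \<T> \<delta> x * \<delta>) *\<^sub>R v) + e"
    and "w (x - (step_factor \<T> \<delta> x * \<delta>) *\<^sub>R v) \<le> w x + quad p M (- ((step_factor \<T> \<delta> x * \<delta>) *\<^sub>R v)) + e"
  shows "second_difference \<T> \<delta> w x v \<le> v \<bullet> (M *v v) + 2 * e / (step_factor \<T> \<delta> x * \<delta>)\<^sup>2"
proof -
  define s where "s = step_factor \<T> \<delta> x * \<delta>"
  have s: "s > 0" using assms by (simp add: s_def)
  have "w (x + s *\<^sub>R v) - 2 * w x + w (x - s *\<^sub>R v) \<le> quad p M (s *\<^sub>R v) + quad p M (- (s *\<^sub>R v)) + 2 * e"
    using assms(3,4) by (simp add: s_def)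
  also have "\<dots> = s\<^sup>2 * (v \<bullet> (M *v v)) + 2 * e"
    by (simp add: quad_def matrix_vector_mult_scaleR power2_eq_square linear_neg[OF matrix_vector_mul_linear])
  finally have "(w (x + s *\<^sub>R v) - 2 * w x + w (x - s *\<^sub>R v)) / s\<^sup>2 \<le> (s\<^sup>2 * (v \<bullet> (M *v v)) + 2 * e) / s\<^sup>2"
    by (intro divide_right_mono) auto
  also have "\<dots> = v \<bullet> (M *v v) + 2 * e / s\<^sup>2" using s by (simp add: add_divide_distrib)
  finally show ?thesis
    by (simp add: second_difference_def Let_def s_def[symmetric] power_mult_distrib[symmetric])
qed

text \<open>Monotonicity of the scheme: the bracket is nondecreasing in every second difference, and
  the minimum is at most its value at any one basis.\<close>

lemma two_scale_operator_le:
  fixes v :: "'n \<Rightarrow> real^'n"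
  assumes "finite P" "v \<in> P" and le: "\<And>j. second_difference \<T> \<delta> w x (v j) \<le> b j"
  shows "two_scale_operator \<T> \<delta> P w x \<le> (\<Prod>j\<in>UNIV. max (b j) 0) - (\<Sum>j\<in>UNIV. - min (b j) 0)"
proof -
  have "two_scale_operator \<T> \<delta> P w x \<le> (\<Prod>j\<in>UNIV. max (second_difference \<T> \<delta> w x (v j)) 0)
             - (\<Sum>j\<in>UNIV. - min (second_difference \<T> \<delta> w x (v j)) 0)"
    unfolding two_scale_operator_def using assms(1,2) by (intro Min_le) auto
  also have "\<dots> \<le> (\<Prod>j\<in>UNIV. max (b j) 0) - (\<Sum>j\<in>UNIV. - min (b j) 0)"
    using le by (intro diff_mono prod_mono sum_mono) (auto simp: min_def max_def intro: order_trans)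
  finally show ?thesis .
qed

lemma two_scale_operator_ge:
  fixes P :: "('n \<Rightarrow> real^'n) set"
  assumes "finite P" "P \<noteq> {}"
    and "\<And>v j. v \<in> P \<Longrightarrow> 0 \<le> second_difference \<T> \<delta> w x (v j)"
    and "\<And>v. v \<in> P \<Longrightarrow> m \<le> (\<Prod>j\<in>UNIV. second_difference \<T> \<delta> w x (v j))"
  shows "m \<le> two_scale_operator \<T> \<delta> P w x"
  unfolding two_scale_operator_def
proof (rule Min.boundedI)
  fix y assume "y \<in> (\<lambda>v. (\<Prod>j\<in>UNIV. max (second_difference \<T> \<delta> w x (v j)) 0)
             - (\<Sum>j\<in>UNIV. - min (second_difference \<T> \<delta> w x (v j)) 0)) ` P"
  then obtain v where v: "v \<in> P" and y: "y = (\<Prod>j\<in>UNIV. max (second_difference \<T> \<delta> w x (v j)) 0)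
             - (\<Sum>j\<in>UNIV. - min (second_difference \<T> \<delta> w x (v j)) 0)" by blast
  have "max (second_difference \<T> \<delta> w x (v j)) 0 = second_difference \<T> \<delta> w x (v j)"
    "min (second_difference \<T> \<delta> w x (v j)) 0 = 0" for j
    using assms(3)[OF v, of j] by auto
  then show "m \<le> y" using assms(4)[OF v] y by simp
qed (use assms in auto)

lemma quad_uminus_scalar_mat: "quad (- p) (mat (- A)) y = - quad p (mat A) y"
  by (simp add: quad_def scalar_mat_mult_vec)

text \<open>At the node where \<open>w - q\<close> is smallest every second difference of
  \<open>w\<close> is at least \<open>A\<close>, whatever the step factor, because that of
  \<open>q\<close> is exactly \<open>A\<close>. If this node were interior, the operator would be at
  least \<open>A ^ CARD('n)\<close> there, which exceeds \<open>f\<close>.\<close>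

lemma discrete_lower_barrier:
  fixes w :: "real^'n \<Rightarrow> real"
  assumes T: "simplicial_mesh \<T>" and sol: "discrete_solution \<T> \<delta> P f g w" and \<delta>: "\<delta> > 0"
    and P: "finite P" "P \<noteq> {}" "P \<subseteq> orthonormal_bases" and A: "A \<ge> 0"
    and f: "\<And>x. x \<in> interior_nodes \<T> \<Longrightarrow> f x < A ^ CARD('n)"
    and g: "\<And>x. x \<in> boundary_nodes \<T> \<Longrightarrow> c + quad p (mat A) (x - z) \<le> g x"
    and x: "x \<in> mesh_domain \<T>"
  shows "c + quad p (mat A) (x - z) \<le> w x"
proof -
  define q where "q x = c + quad p (mat A) (x - z)" for x :: "real^'n"
  have w: "w \<in> fe_space \<T>" and wb: "\<And>x. x \<in> boundary_nodes \<T> \<Longrightarrow> w x = g x"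
    and wi: "\<And>x. x \<in> interior_nodes \<T> \<Longrightarrow> two_scale_operator \<T> \<delta> P w x = f x"
    using sol by (auto simp: discrete_solution_def)
  have "pos_semidef (mat A :: real^'n^'n)" using A by (simp add: pos_semidef_def scalar_mat_mult_vec)
  then have "convex_on UNIV q"
    unfolding q_def by (intro convex_on_quad transpose_scalar_mat) auto
  then obtain a where a: "a \<in> nodes \<T>" and min: "\<And>x. x \<in> mesh_domain \<T> \<Longrightarrow> q x + (w a - q a) \<le> w x"
    using fe_minus_convex_min_at_node[OF T w] by blast
  have "a \<notin> interior_nodes \<T>"
  proof
    assume ai: "a \<in> interior_nodes \<T>"
    then have "a \<in> interior (mesh_domain \<T>)" using interior_nodes_interior[OF T] by blast
    note sf = step_factor[OF compact_imp_closed[OF compact_mesh_domain[OF T]] this \<delta>]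
    have sd: "A \<le> second_difference \<T> \<delta> w a v" if v: "norm v = 1" for v
    proof -
      let ?p = "- (p + mat A *v (a - z))"
      have q: "q (a + y) = q a - quad ?p (mat (- A)) y" for y
        using quad_recenter[OF transpose_scalar_mat, of p A "a + y" z a]
        unfolding q_def quad_uminus_scalar_mat by simp
      have "second_difference \<T> \<delta> (\<lambda>x. - w x) a v \<le> v \<bullet> ((mat (- A)) *v v) + 2 * 0 / (step_factor \<T> \<delta> a * \<delta>)\<^sup>2"
      proof (rule second_difference_le_quad[OF sf(1) \<delta>, where p = ?p])
        let ?s = "(step_factor \<T> \<delta> a * \<delta>) *\<^sub>R v"
        show "- w (a + ?s) \<le> - w a + quad ?p (mat (- A)) ?s + 0" using min[OF sf(3)[OF v]] q[of ?s] by simp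
        show "- w (a - ?s) \<le> - w a + quad ?p (mat (- A)) (- ?s) + 0" using min[OF sf(4)[OF v]] q[of "- ?s"] by simp
      qed
      moreover have "v \<bullet> v = 1" using v by (simp add: norm_eq_1)
      ultimately show ?thesis by (simp add: second_difference_uminus scalar_mat_mult_vec)
    qed
    have nv: "norm (v j) = 1" if "v \<in> P" for v j using that P(3) by (auto simp: orthonormal_bases_def norm_eq_1)
    have "A ^ CARD('n) \<le> two_scale_operator \<T> \<delta> P w a"
    proof (rule two_scale_operator_ge[OF P(1,2)])
      show "0 \<le> second_difference \<T> \<delta> w a (v j)" if "v \<in> P" for v j using sd[OF nv[OF that, of j]] A by simp
      show "A ^ CARD('n) \<le> (\<Prod>j\<in>UNIV. second_difference \<T> \<delta> w a (v j))" if "v \<in> P" for v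
        using prod_mono[of UNIV "\<lambda>_. A" "\<lambda>j. second_difference \<T> \<delta> w a (v j)"] sd[OF nv[OF that]] A by simp
    qed
    then show False using f[OF ai] wi[OF ai] by linarith
  qed
  then have ab: "a \<in> boundary_nodes \<T>" using a unfolding interior_nodes_def by blast
  have "q a \<le> w a" unfolding q_def wb[OF ab] by (rule g[OF ab])
  then show ?thesis using min[OF x] unfolding q_def by linarith
qed

text \<open>An affine function has zero second differences, which gives no strict contradiction, so
  it is bent downwards by a small quadratic. At an interior maximum of the difference the second
  differences of \<open>w\<close> would be at most \<open>- k\<close>: the product vanishes and the
  operator is negative, against \<open>f \<ge> 0\<close>.\<close>

lemma discrete_upper_barrier:
  fixes w :: "real^'n \<Rightarrow> real"
  assumes T: "simplicial_mesh \<T>" and sol: "discrete_solution \<T> \<delta> P f g w" and \<delta>: "\<delta> > 0"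
    and P: "finite P" "P \<noteq> {}" "P \<subseteq> orthonormal_bases"
    and f: "\<And>x. x \<in> interior_nodes \<T> \<Longrightarrow> 0 \<le> f x"
    and g: "\<And>x. x \<in> boundary_nodes \<T> \<Longrightarrow> g x \<le> c + p \<bullet> x"
    and x: "x \<in> mesh_domain \<T>"
  shows "w x \<le> c + p \<bullet> x"
proof (rule field_le_epsilon)
  fix e :: real assume e: "e > 0"
  have w: "w \<in> fe_space \<T>" and wb: "\<And>x. x \<in> boundary_nodes \<T> \<Longrightarrow> w x = g x"
    and wi: "\<And>x. x \<in> interior_nodes \<T> \<Longrightarrow> two_scale_operator \<T> \<delta> P w x = f x"
    using sol by (auto simp: discrete_solution_def)
  obtain B where B: "B > 0" "\<And>x. x \<in> mesh_domain \<T> \<Longrightarrow> norm x \<le> B"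
    using compact_imp_bounded[OF compact_mesh_domain[OF T]] bounded_pos by blast
  \<comment> \<open>Scaled so that the bend amounts to at most \<open>e\<close> over the mesh
    domain.\<close>
  define k where "k = 2 * e / B\<^sup>2"
  have k: "k > 0" "k / 2 * B\<^sup>2 = e" using e B by (auto simp: k_def)
  define q where "q x = - (c + e) + quad (- p) (mat k) (x - 0)" for x :: "real^'n"
  have qx: "q x = k / 2 * (x \<bullet> x) - (c + e) - p \<bullet> x" for x
    by (simp add: q_def quad_def scalar_mat_mult_vec)
  have "pos_semidef (mat k :: real^'n^'n)" using k(1) by (simp add: pos_semidef_def scalar_mat_mult_vec)
  then have "convex_on UNIV q"
    unfolding q_def by (intro convex_on_quad transpose_scalar_mat) auto
  then obtain a where a: "a \<in> nodes \<T>" and min: "\<And>x. x \<in> mesh_domain \<T> \<Longrightarrow> q x + (- w a - q a) \<le> - w x"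
    using fe_minus_convex_min_at_node[OF T fe_space_uminus[OF w]] by blast
  have "a \<notin> interior_nodes \<T>"
  proof
    assume ai: "a \<in> interior_nodes \<T>"
    then have "a \<in> interior (mesh_domain \<T>)" using interior_nodes_interior[OF T] by blast
    note sf = step_factor[OF compact_imp_closed[OF compact_mesh_domain[OF T]] this \<delta>]
    have sd: "second_difference \<T> \<delta> w a v \<le> - k" if v: "norm v = 1" for v
    proof -
      define r where "r = - p + mat k *v (a - 0)"
      have q: "q (a + y) = q a + quad r (mat k) y" for y
        unfolding q_def r_def
        using quad_recenter[OF transpose_scalar_mat, of "- p" k "a + y" 0 a]
        by (simp only: add_diff_cancel_left' add.assoc)
      have "second_difference \<T> \<delta> w a v \<le> v \<bullet> ((mat (- k)) *v v) + 2 * 0 / (step_factor \<T> \<delta> a * \<delta>)\<^sup>2"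
      proof (rule second_difference_le_quad[OF sf(1) \<delta>, where p = "- r"])
        let ?s = "(step_factor \<T> \<delta> a * \<delta>) *\<^sub>R v"
        show "w (a + ?s) \<le> w a + quad (- r) (mat (- k)) ?s + 0"
          using min[OF sf(3)[OF v]] q[of ?s] unfolding quad_uminus_scalar_mat by linarith
        show "w (a - ?s) \<le> w a + quad (- r) (mat (- k)) (- ?s) + 0"
          using min[OF sf(4)[OF v]] q[of "- ?s"] unfolding quad_uminus_scalar_mat by simp
      qed
      moreover have "v \<bullet> v = 1" using v by (simp add: norm_eq_1)
      ultimately show ?thesis by (simp add: scalar_mat_mult_vec)
    qed
    obtain v where v: "v \<in> P" using P(2) by blast
    then have nv: "norm (v j) = 1" for j using P(3) by (auto simp: orthonormal_bases_def norm_eq_1)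
    have "two_scale_operator \<T> \<delta> P w a \<le> (\<Prod>j\<in>(UNIV::'n set). max (- k) 0) - (\<Sum>j\<in>(UNIV::'n set). - min (- k) 0)"
      by (rule two_scale_operator_le[OF P(1) v, where b = "\<lambda>_. - k"]) (rule sd[OF nv])
    moreover have "max (- k) 0 = 0" "min (- k) 0 = - k" using k(1) by auto
    ultimately have "two_scale_operator \<T> \<delta> P w a \<le> - (real CARD('n) * k)" by (simp add: zero_power)
    moreover have "real CARD('n) * k > 0" using k(1) by (intro mult_pos_pos) auto
    ultimately have "two_scale_operator \<T> \<delta> P w a < 0" by linarith
    then show False using f[OF ai] wi[OF ai] by linarith
  qed
  then have ab: "a \<in> boundary_nodes \<T>" using a unfolding interior_nodes_def by blast
  have "w a \<le> c + p \<bullet> a" unfolding wb[OF ab] by (rule g[OF ab])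
  moreover have "a \<bullet> a \<le> B\<^sup>2" "x \<bullet> x \<ge> 0"
    using power_mono[OF B(2)[of a] norm_ge_zero, of 2] a nodes_subset_mesh_domain[of \<T>]
    by (auto simp: power2_norm_eq_inner)
  moreover have "k / 2 * (a \<bullet> a) \<le> e" "0 \<le> k / 2 * (x \<bullet> x)"
    using mult_left_mono[OF \<open>a \<bullet> a \<le> B\<^sup>2\<close>, of "k / 2"] k(1) unfolding k(2) by auto
  ultimately show "w x \<le> c + p \<bullet> x + e" using min[OF x] unfolding qx by linarith
qed

section \<open>Relaxed limits\<close>

lemma quad_form_bound:
  fixes M :: "real^'n^'n"
  obtains C where "C \<ge> 0" "\<And>x. norm (M *v x) \<le> C * norm x" "\<And>x. x \<bullet> (M *v x) \<le> C * (x \<bullet> x)"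
proof -
  obtain C where C: "C > 0" "\<And>x. norm (M *v x) \<le> norm x * C"
    using bounded_linear.pos_bounded[OF matrix_vector_mul_bounded_linear[of M]] by blast
  have "x \<bullet> (M *v x) \<le> C * (x \<bullet> x)" for x
  proof -
    have "x \<bullet> (M *v x) \<le> norm x * norm (M *v x)" by (rule norm_cauchy_schwarz)
    also have "\<dots> \<le> norm x * (norm x * C)" by (intro mult_left_mono C) simp
    also have "\<dots> = C * (x \<bullet> x)" by (simp add: power2_norm_eq_inner[symmetric] power2_eq_square)
    finally show ?thesis .
  qed
  then show ?thesis using that[of C] C by (simp add: mult.commute)
qed

text \<open>A finite subcover leaves finitely many eventual statements to combine. The sets
  \<open>D e\<close> let the points range over a domain that moves with the filter.\<close>

lemma eventually_uniform_on_compact: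
  fixes A :: "'a::metric_space set"
  assumes A: "compact A"
    and local: "\<And>x. x \<in> A \<Longrightarrow> \<exists>d>0. \<forall>\<^sub>F e in F. \<forall>y\<in>D e. dist y x < d \<longrightarrow> Q e y"
  shows "\<forall>\<^sub>F e in F. \<forall>y\<in>D e \<inter> A. Q e y"
proof -
  have "\<forall>x\<in>A. \<exists>d. d > 0 \<and> (\<forall>\<^sub>F e in F. \<forall>y\<in>D e. dist y x < d \<longrightarrow> Q e y)" using local by blast
  from bchoice[OF this] obtain d where d: "\<And>x. x \<in> A \<Longrightarrow> d x > 0"
    "\<And>x. x \<in> A \<Longrightarrow> \<forall>\<^sub>F e in F. \<forall>y\<in>D e. dist y x < d x \<longrightarrow> Q e y" by blast
  have "\<And>x. x \<in> A \<Longrightarrow> open (ball x (d x))" by simp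
  moreover have "A \<subseteq> (\<Union>x\<in>A. ball x (d x))" using d(1) by auto
  ultimately obtain A' where A': "A' \<subseteq> A" "finite A'" "A \<subseteq> (\<Union>x\<in>A'. ball x (d x))"
    by (rule compactE_image[OF A(1)])
  have "\<forall>\<^sub>F e in F. \<forall>x\<in>A'. \<forall>y\<in>D e. dist y x < d x \<longrightarrow> Q e y"
    using A'(1,2) d(2) by (intro eventually_ball_finite) auto
  then show ?thesis
  proof eventually_elim
    case (elim e)
    show ?case
    proof
      fix y assume y: "y \<in> D e \<inter> A"
      then obtain x where "x \<in> A'" "dist y x < d x" using A'(3) by (auto simp: dist_commute)
      then show "Q e y" using elim y by blast
    qed
  qed
qed

text \<open>The relaxed upper limit \<open>limsup w(y)\<close> as \<open>y \<rightarrow> x\<close> along the filter; the relaxed lower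
  limit is obtained by negating the functions.\<close>

locale discrete_family =
  fixes F :: "'e filter" and \<T> :: "'e \<Rightarrow> (real^'n) set set" and \<delta> :: "'e \<Rightarrow> real"
    and \<Omega> :: "(real^'n) set" and B :: real and w :: "'e \<Rightarrow> real^'n \<Rightarrow> real"
  assumes nontrivial: "F \<noteq> bot" and op: "open \<Omega>"
    and mesh: "\<forall>\<^sub>F e in F. simplicial_mesh (\<T> e)"
    and fe: "\<forall>\<^sub>F e in F. w e \<in> fe_space (\<T> e)"
    and step_pos: "\<forall>\<^sub>F e in F. 0 < \<delta> e"
    and size: "((\<lambda>e. mesh_size (\<T> e)) \<longlongrightarrow> 0) F"
    and step: "(\<delta> \<longlongrightarrow> 0) F"
    and ratio: "((\<lambda>e. mesh_size (\<T> e) / \<delta> e) \<longlongrightarrow> 0) F"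
    and exhaust: "x \<in> \<Omega> \<Longrightarrow> \<exists>r>0. \<forall>\<^sub>F e in F. cball x r \<subseteq> mesh_domain (\<T> e)"
    and bounded: "\<forall>\<^sub>F e in F. \<forall>y\<in>mesh_domain (\<T> e). \<bar>w e y\<bar> \<le> B"
begin

abbreviation D :: "'e \<Rightarrow> (real^'n) set" where
  "D e \<equiv> mesh_domain (\<T> e)"

definition upper_bounds :: "real^'n \<Rightarrow> real set" where
  "upper_bounds x = {c. \<exists>d>0. \<forall>\<^sub>F e in F. \<forall>y\<in>D e. dist y x < d \<longrightarrow> w e y \<le> c}"

definition upper_limit :: "real^'n \<Rightarrow> real" where
  "upper_limit x = Inf (upper_bounds x)"

lemma upper_bounds_nonempty: "upper_bounds x \<noteq> {}"
proof -
  have "\<forall>\<^sub>F e in F. \<forall>y\<in>D e. dist y x < 1 \<longrightarrow> w e y \<le> B"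
    using bounded by eventually_elim force
  then have "B \<in> upper_bounds x" by (auto simp: upper_bounds_def intro!: exI[of _ 1])
  then show ?thesis by blast
qed

lemma eventually_in_mesh_domain: "x \<in> \<Omega> \<Longrightarrow> \<forall>\<^sub>F e in F. x \<in> D e"
proof -
  assume "x \<in> \<Omega>"
  then obtain r where "r > 0" "\<forall>\<^sub>F e in F. cball x r \<subseteq> D e" using exhaust by blast
  then show ?thesis by (auto elim!: eventually_mono simp: subset_eq)
qed

text \<open>If the mesh domains had no points near \<open>x\<close>, every real number would be an
  eventual bound; \<open>exhaust\<close> supplies such points and keeps the infimum finite.\<close>

lemma upper_bounds_lower:
  assumes "x \<in> \<Omega>" "c \<in> upper_bounds x" shows "- B \<le> c"
proof -
  obtain d where d: "d > 0" "\<forall>\<^sub>F e in F. \<forall>y\<in>D e. dist y x < d \<longrightarrow> w e y \<le> c"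
    using assms(2) by (auto simp: upper_bounds_def)
  have "\<forall>\<^sub>F e in F. \<bar>w e x\<bar> \<le> B \<and> w e x \<le> c"
    using eventually_in_mesh_domain[OF assms(1)] bounded d(2) by eventually_elim (use d(1) in auto)
  then obtain e where "\<bar>w e x\<bar> \<le> B \<and> w e x \<le> c" using eventually_happens'[OF nontrivial] by blast
  then show ?thesis by linarith
qed

lemma upper_bounds_bdd: "x \<in> \<Omega> \<Longrightarrow> bdd_below (upper_bounds x)"
  using upper_bounds_lower by (intro bdd_belowI)

lemma upper_limit_less:
  assumes "x \<in> \<Omega>" "upper_limit x < c"
  obtains d where "d > 0" "\<forall>\<^sub>F e in F. \<forall>y\<in>D e. dist y x < d \<longrightarrow> w e y < c"
proof -
  obtain c' where c': "c' \<in> upper_bounds x" "c' < c"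
    using cInf_lessD[OF upper_bounds_nonempty assms(2)[unfolded upper_limit_def]] by blast
  then obtain d where d: "d > 0" "\<forall>\<^sub>F e in F. \<forall>y\<in>D e. dist y x < d \<longrightarrow> w e y \<le> c'"
    by (auto simp: upper_bounds_def)
  have "\<forall>\<^sub>F e in F. \<forall>y\<in>D e. dist y x < d \<longrightarrow> w e y < c"
    using d(2) by eventually_elim (use c'(2) in force)
  then show ?thesis using that d(1) by blast
qed

text \<open>Failure of an eventual bound produces frequent, not eventual, points, which is why the
  consistency arguments below run with \<open>frequently\<close>.\<close>

lemma less_upper_limit:
  assumes "x \<in> \<Omega>" "c < upper_limit x" "d > 0"
  shows "\<exists>\<^sub>F e in F. \<exists>y\<in>D e. dist y x < d \<and> c < w e y"
  unfolding frequently_def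
proof
  assume "\<forall>\<^sub>F e in F. \<not> (\<exists>y\<in>D e. dist y x < d \<and> c < w e y)"
  then have "\<forall>\<^sub>F e in F. \<forall>y\<in>D e. dist y x < d \<longrightarrow> w e y \<le> c"
    by eventually_elim force
  then have "c \<in> upper_bounds x" using assms(3) by (auto simp: upper_bounds_def)
  then have "upper_limit x \<le> c" unfolding upper_limit_def by (rule cInf_lower[OF _ upper_bounds_bdd[OF assms(1)]])
  then show False using assms(2) by simp
qed

text \<open>A bound on the ball of radius \<open>d\<close> around \<open>x\<close> is a bound on the
  balls of radius \<open>d / 2\<close> around all nearby points.\<close>

lemma usc_upper_limit: "usc_on \<Omega> upper_limit"
  unfolding usc_on_def
proof (intro ballI allI impI)
  fix x c assume x: "x \<in> \<Omega>" and c: "upper_limit x < c"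
  then obtain c' where c': "upper_limit x < c'" "c' < c" using dense by blast
  obtain d where d: "d > 0" "\<forall>\<^sub>F e in F. \<forall>y\<in>D e. dist y x < d \<longrightarrow> w e y < c'"
    using upper_limit_less[OF x c'(1)] by blast
  have "\<forall>\<^sub>F y in nhds x. y \<in> ball x (d / 2) \<inter> \<Omega>"
    using d(1) x op by (intro eventually_nhds_in_open) auto
  then show "\<forall>\<^sub>F y in nhds x. upper_limit y < c"
  proof eventually_elim
    case (elim z)
    have "\<forall>\<^sub>F e in F. \<forall>y\<in>D e. dist y z < d / 2 \<longrightarrow> w e y \<le> c'"
      using d(2)
    proof eventually_elim
      case (elim e)
      show ?case
      proof (intro ballI impI)
        fix y assume y: "y \<in> D e" "dist y z < d / 2"
        have "dist y x < d" using y(2) \<open>z \<in> ball x (d / 2) \<inter> \<Omega>\<close> dist_triangle[of y x z] by (auto simp: dist_commute)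
        then show "w e y \<le> c'" using elim y(1) by force
      qed
    qed
    then have "c' \<in> upper_bounds z" using d(1) by (auto simp: upper_bounds_def intro!: exI[of _ "d / 2"])
    then have "upper_limit z \<le> c'"
      unfolding upper_limit_def by (rule cInf_lower[OF _ upper_bounds_bdd]) (use elim in auto)
    then show ?case using c'(2) by simp
  qed
qed

lemma upper_limit_le_continuous:
  assumes x: "x \<in> \<Omega>" and l: "isCont l x" and le: "\<forall>\<^sub>F e in F. \<forall>y\<in>D e. w e y \<le> l y"
  shows "upper_limit x \<le> l x"
proof (rule field_le_epsilon)
  fix k :: real assume k: "k > 0"
  have "(l \<longlongrightarrow> l x) (nhds x)" using l by (simp add: isCont_def tendsto_at_iff_tendsto_nhds)
  then have "\<forall>\<^sub>F y in nhds x. l y < l x + k" using k by (intro order_tendstoD(2)) auto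
  then obtain d where d: "d > 0" "\<And>y. dist y x < d \<Longrightarrow> l y < l x + k" unfolding eventually_nhds_metric by blast
  have "\<forall>\<^sub>F e in F. \<forall>y\<in>D e. dist y x < d \<longrightarrow> w e y \<le> l x + k"
    using le by eventually_elim (use d(2) in force)
  then have "l x + k \<in> upper_bounds x" using d(1) by (auto simp: upper_bounds_def)
  then show "upper_limit x \<le> l x + k" unfolding upper_limit_def by (rule cInf_lower[OF _ upper_bounds_bdd[OF x]])
qed

lemma eventually_less_on_compact:
  assumes A: "compact A" "A \<subseteq> \<Omega>" and s: "\<And>x. isCont s x" and less: "\<And>x. x \<in> A \<Longrightarrow> upper_limit x < s x"
  shows "\<forall>\<^sub>F e in F. \<forall>y\<in>D e \<inter> A. w e y < s y"
proof (rule eventually_uniform_on_compact[OF A(1)])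
  fix x assume x: "x \<in> A"
  obtain c where c: "upper_limit x < c" "c < s x" using dense[OF less[OF x]] by blast
  obtain d where d: "d > 0" "\<forall>\<^sub>F e in F. \<forall>y\<in>D e. dist y x < d \<longrightarrow> w e y < c"
    using upper_limit_less[OF subsetD[OF A(2) x] c(1)] by blast
  have "(s \<longlongrightarrow> s x) (nhds x)" using s[of x] by (simp add: isCont_def tendsto_at_iff_tendsto_nhds)
  then have "\<forall>\<^sub>F y in nhds x. c < s y" using c(2) by (intro order_tendstoD(1)) auto
  then obtain d' where d': "d' > 0" "\<And>y. dist y x < d' \<Longrightarrow> c < s y" unfolding eventually_nhds_metric by blast
  have "\<forall>\<^sub>F e in F. \<forall>y\<in>D e. dist y x < min d d' \<longrightarrow> w e y < s y"
    using d(2) by eventually_elim (use d'(2) in force)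
  then show "\<exists>d>0. \<forall>\<^sub>F e in F. \<forall>y\<in>D e. dist y x < d \<longrightarrow> w e y < s y"
    using d(1) d'(1) by (intro exI[of _ "min d d'"]) auto
qed

text \<open>A quadratic touching the relaxed limit from above is perturbed to a strict maximum; then a
  nearby node maximizes \<open>w - q\<close> among the nodes around \<open>a\<close>, and interpolating the quadratic on
  the mesh costs \<open>h\<^sup>2\<close>, hence \<open>h\<^sup>2 / \<delta>\<^sup>2\<close> in the second differences.\<close>

theorem upper_limit_touching:
  fixes M :: "real^'n^'n"
  assumes a: "a \<in> \<Omega>" and sym: "transpose M = M"
    and max: "\<forall>\<^sub>F x in nhds a. upper_limit x \<le> upper_limit a + quad p M (x - a)"
    and k: "k > 0" and r: "r > 0"
  shows "\<exists>\<^sub>F e in F. \<exists>z\<in>interior_nodes (\<T> e). dist z a < r \<and>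
    (\<forall>v. norm v = 1 \<longrightarrow> second_difference (\<T> e) (\<delta> e) (w e) z v \<le> v \<bullet> (M *v v) + k)" (is "\<exists>\<^sub>F e in F. ?Q e")
proof -
  let ?U = "upper_limit a"
  \<comment> \<open>Half of the tolerance makes the touching strict; the other half pays for the
    interpolation error.\<close>
  define N where "N = M + mat (k / 2)"
  have Nsym: "transpose N = N" unfolding N_def by (rule transpose_add_mat[OF sym])
  define q where "q x = quad p N (x - a)" for x
  have qM: "q x = quad p M (x - a) + k / 4 * ((x - a) \<bullet> (x - a))" for x
    by (simp add: q_def N_def quad_add_mat)
  have "continuous_on UNIV q" unfolding q_def by (intro continuous_intros)
  then have qcont: "isCont q x" for x by (simp add: continuous_on_eq_continuous_at)
  have "\<forall>\<^sub>F x in nhds a. x \<in> \<Omega>" using op a by (rule eventually_nhds_in_open)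
  with max have "\<forall>\<^sub>F x in nhds a. x \<in> \<Omega> \<and> upper_limit x \<le> ?U + quad p M (x - a)" by eventually_elim simp
  then obtain d1 where d1: "d1 > 0" "\<And>x. dist x a < d1 \<Longrightarrow> x \<in> \<Omega> \<and> upper_limit x \<le> ?U + quad p M (x - a)"
    unfolding eventually_nhds_metric by blast
  obtain r0 where r0: "r0 > 0" "\<forall>\<^sub>F e in F. cball a r0 \<subseteq> D e" using exhaust[OF a] by blast
  define R where "R = min r (min d1 r0) / 2"
  have R: "R > 0" "R < r" "R < d1" "R < r0" using r d1(1) r0(1) by (auto simp: R_def)
  \<comment> \<open>On this annulus the strictness is worth at least \<open>m\<close>, so nodes
    there cannot compete with those near \<open>a\<close>.\<close>
  define A where "A = cball a R - ball a (R / 2)"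
  define m where "m = k * R\<^sup>2 / 16"
  have m: "m > 0" using k R by (simp add: m_def)
  have Aless: "upper_limit x < ?U + q x - m / 2" if x: "x \<in> A" for x
  proof -
    have x1: "dist x a < d1" "R / 2 \<le> norm (x - a)" using x R by (auto simp: A_def dist_norm norm_minus_commute)
    have "(R / 2)\<^sup>2 \<le> (norm (x - a))\<^sup>2" using x1(2) R by (intro power_mono) auto
    then have "R\<^sup>2 / 4 \<le> (x - a) \<bullet> (x - a)" by (simp add: power2_norm_eq_inner power_divide)
    then have "k / 4 * (R\<^sup>2 / 4) \<le> k / 4 * ((x - a) \<bullet> (x - a))" using k by (intro mult_left_mono) auto
    then show ?thesis using d1(2)[OF x1(1)] m unfolding qM by (simp add: m_def)
  qed
  have "compact A" "A \<subseteq> \<Omega>" using R d1(2) by (auto simp: A_def compact_diff dist_commute)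
  then have E1: "\<forall>\<^sub>F e in F. \<forall>y\<in>D e \<inter> A. w e y < ?U + q y - m / 2"
    using Aless by (intro eventually_less_on_compact) (auto intro!: continuous_intros qcont)
  obtain C where C: "C \<ge> 0" "\<And>x. norm (N *v x) \<le> C * norm x" "\<And>x. x \<bullet> (N *v x) \<le> C * (x \<bullet> x)"
    using quad_form_bound[of N] by blast
  have "q a = 0" by (simp add: q_def)
  moreover have "(q \<longlongrightarrow> q a) (nhds a)" using qcont[of a] by (simp add: isCont_def tendsto_at_iff_tendsto_nhds)
  ultimately have "\<forall>\<^sub>F x in nhds a. q x < m / 8" using m by (intro order_tendstoD(2)) auto
  then obtain d2 where d2: "d2 > 0" "\<And>x. dist x a < d2 \<Longrightarrow> q x < m / 8" unfolding eventually_nhds_metric by blast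
  let ?Y = "\<lambda>e. \<exists>y\<in>D e. dist y a < min d2 (R / 4) \<and> ?U - m / 8 < w e y"
  have "\<exists>\<^sub>F e in F. ?Y e"
    using m d2(1) R(1) by (intro less_upper_limit[OF a]) auto
  moreover
  have lim: "((\<lambda>e. C / 2 * (mesh_size (\<T> e))\<^sup>2) \<longlongrightarrow> C / 2 * 0\<^sup>2) F" "((\<lambda>e. C * (mesh_size (\<T> e) / \<delta> e)\<^sup>2) \<longlongrightarrow> C * 0\<^sup>2) F"
    by (intro tendsto_intros size ratio)+
  have "\<forall>\<^sub>F e in F. C / 2 * (mesh_size (\<T> e))\<^sup>2 < m / 8" "\<forall>\<^sub>F e in F. C * (mesh_size (\<T> e) / \<delta> e)\<^sup>2 < k / 2"
    "\<forall>\<^sub>F e in F. mesh_size (\<T> e) < R / 4" "\<forall>\<^sub>F e in F. \<delta> e < R / 4"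
    using order_tendstoD(2)[OF lim(1), of "m / 8"] order_tendstoD(2)[OF lim(2), of "k / 2"] m k R
      order_tendstoD(2)[OF size, of "R / 4"] order_tendstoD(2)[OF step, of "R / 4"]
    by simp_all
  then have "\<forall>\<^sub>F e in F. ?Y e \<longrightarrow>
    ?Q e"
    using E1 r0(2) mesh fe step_pos
  proof eventually_elim
    case (elim e)
    let ?h = "mesh_size (\<T> e)"
    note T = \<open>simplicial_mesh (\<T> e)\<close> and w = \<open>w e \<in> fe_space (\<T> e)\<close>
    note E1 = \<open>\<forall>y\<in>D e \<inter> A. w e y < ?U + q y - m / 2\<close>
    have RD: "cball a R \<subseteq> D e" using \<open>cball a r0 \<subseteq> D e\<close> R by (meson less_imp_le order_trans subset_cball)
    show ?case
    proof
      assume "?Y e"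
      then obtain y where y: "y \<in> D e" "dist y a < d2" "dist y a < R / 4" "?U - m / 8 < w e y" by auto
      then obtain K where K: "K \<in> \<T> e" "y \<in> K" by (auto simp: mesh_domain_def)
      have nodeK: "x \<in> nodes (\<T> e)" "dist x y \<le> ?h" if "x extreme_point_of K" for x
        using simplex_extreme_points(2)[OF T K(1)] that dist_le_mesh_size[OF T K(1) _ K(2)]
        by (auto simp: extreme_point_of_def)
      define Y where "Y = nodes (\<T> e) \<inter> cball a R"
      have inY: "x \<in> Y" if "x extreme_point_of K" for x
      proof -
        have "dist a x \<le> dist y a + dist x y" using dist_triangle[of a x y] by (simp add: dist_commute)
        then show ?thesis using nodeK[OF that] y(3) \<open>?h < R / 4\<close> R(1) by (simp add: Y_def)
      qed
      \<comment> \<open>The relaxed limit is nearly attained at a point \<open>y\<close> that need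
        not be a node. If all vertices of its element were low, interpolation would put
        \<open>w e y\<close> below \<open>?U - m / 2 + m / 8 + m / 8\<close>, which is too
        small.\<close>
      have "\<exists>x. x extreme_point_of K \<and> ?U - m / 2 \<le> w e x - q x"
      proof (rule ccontr)
        assume "\<not> ?thesis"
        then have "w e x \<le> (?U - m / 2) + quad p N (x - a)" if "x extreme_point_of K" for x
          using that by (force simp: q_def)
        from fe_le_quad[OF T K(1) w Nsym C(3,1) this K(2)]
        have "w e y \<le> ?U - m / 2 + q y + C / 2 * ?h\<^sup>2" by (simp add: q_def)
        then show False using y(4) d2(2)[OF y(2)] \<open>C / 2 * ?h\<^sup>2 < m / 8\<close> m by linarith
      qed
      then obtain y1 where y1: "y1 extreme_point_of K" "?U - m / 2 \<le> w e y1 - q y1" by blast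
      have "finite Y" "Y \<noteq> {}" using finite_nodes[OF T] inY[OF y1(1)] by (auto simp: Y_def)
      then have "Max ((\<lambda>x. w e x - q x) ` Y) \<in> (\<lambda>x. w e x - q x) ` Y" by (intro Max_in) auto
      then obtain z where z: "z \<in> Y" "w e z - q z = Max ((\<lambda>x. w e x - q x) ` Y)" by auto
      have zmax: "w e x - q x \<le> w e z - q z" if "x \<in> Y" for x
        unfolding z(2) using that \<open>finite Y\<close> by (intro Max_ge) auto
      have zU: "?U - m / 2 \<le> w e z - q z" using zmax[OF inY[OF y1(1)]] y1(2) by linarith
      have zD: "z \<in> D e" "dist a z \<le> R" using z(1) RD by (auto simp: Y_def)
      have "z \<notin> A"
      proof
        assume "z \<in> A" then have "w e z < ?U + q z - m / 2" using E1 zD by blast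
        then show False using zU by linarith
      qed
      then have zR: "dist a z < R / 2" using zD by (auto simp: A_def)
      have "z \<in> ball a R" using zR R(1) by simp
      moreover have "ball a R \<subseteq> interior (D e)" using RD by (intro interior_maximal) (auto simp: subset_eq)
      ultimately have "z \<in> interior_nodes (\<T> e)" using z(1) interior_nodes_interior[OF T] by (auto simp: Y_def)
      moreover have "dist z a < r" using zR R by (simp add: dist_commute)
      moreover have "second_difference (\<T> e) (\<delta> e) (w e) z v \<le> v \<bullet> (M *v v) + k" if v: "norm v = 1" for v
      proof -
        have sf: "step_factor (\<T> e) (\<delta> e) z = 1"
        proof (rule step_factor_eqI)
          show "cball z (\<delta> e) \<subseteq> D e"
          proof
            fix x assume "x \<in> cball z (\<delta> e)"
            then have "dist a x \<le> R" using dist_triangle[of a x z] zR \<open>\<delta> e < R / 4\<close> R(1) by simp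
            then show "x \<in> D e" using RD by auto
          qed
        qed (rule \<open>0 < \<delta> e\<close>)
        \<comment> \<open>Vertices of an element containing \<open>z + y\<close> lie within
          \<open>R / 2 + R / 4 + R / 4\<close> of \<open>a\<close>, hence still belong to the nodes
          over which \<open>z\<close> is maximal.\<close>
        have local: "w e (z + y) \<le> w e z + quad (p + N *v (z - a)) N y + C / 2 * ?h\<^sup>2" if ny: "norm y = \<delta> e" for y
        proof -
          have "dist a (z + y) \<le> dist a z + norm y" using dist_triangle[of a "z + y" z] by (simp add: dist_norm)
          then have ay: "dist a (z + y) \<le> 3 * R / 4" using zR ny \<open>\<delta> e < R / 4\<close> by simp
          then have "z + y \<in> D e" using RD R(1) by auto
          then obtain K' where K': "K' \<in> \<T> e" "z + y \<in> K'" by (auto simp: mesh_domain_def)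
          have "w e x \<le> (w e z - q z) + quad p N (x - a)" if x: "x extreme_point_of K'" for x
          proof -
            have "dist x (z + y) \<le> ?h" using dist_le_mesh_size[OF T K'(1) _ K'(2)] x by (simp add: extreme_point_of_def)
            then have "dist a x \<le> R" using dist_triangle[of a x "z + y"] ay \<open>?h < R / 4\<close> by (simp add: dist_commute)
            moreover have "x \<in> nodes (\<T> e)" using simplex_extreme_points(2)[OF T K'(1)] x by blast
            ultimately show ?thesis using zmax[of x] by (simp add: Y_def q_def)
          qed
          from fe_le_quad[OF T K'(1) w Nsym C(3,1) this K'(2)]
          show ?thesis using quad_recenter[OF Nsym, of p "z + y" a z] by (simp add: q_def)
        qed
        \<comment> \<open>The step factor is 1 here, so the interpolation error enters as
          \<open>C * (?h / \<delta> e)\<^sup>2\<close>; this is where \<open>h / \<delta>\<close>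
          has to tend to 0.\<close>
        have "second_difference (\<T> e) (\<delta> e) (w e) z v \<le> v \<bullet> (N *v v) + 2 * (C / 2 * ?h\<^sup>2) / (step_factor (\<T> e) (\<delta> e) z * \<delta> e)\<^sup>2"
          by (rule second_difference_le_quad[where p = "p + N *v (z - a)"])
            (use local[of "\<delta> e *\<^sub>R v"] local[of "- (\<delta> e *\<^sub>R v)"] v \<open>0 < \<delta> e\<close> in \<open>simp_all add: sf\<close>)
        also have "\<dots> = v \<bullet> (M *v v) + k / 2 * (v \<bullet> v) + C * (?h / \<delta> e)\<^sup>2"
          by (simp add: sf N_def quad_form_add_mat power_divide)
        also have "v \<bullet> v = 1" using v by (simp add: norm_eq_1)
        finally show ?thesis using \<open>C * (?h / \<delta> e)\<^sup>2 < k / 2\<close> by linarith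
      qed
      ultimately show "?Q e" by blast
    qed
  qed
  ultimately show ?thesis by (rule frequently_rev_mp)
qed

end

text \<open>The operator is not odd, but the locale speaks only of meshes, step sizes and bounded
  piecewise affine functions, so one touching theorem serves both relaxed limits.\<close>

lemma discrete_family_uminus:
  assumes "discrete_family F \<T> \<delta> \<Omega> B w"
  shows "discrete_family F \<T> \<delta> \<Omega> B (\<lambda>e x. - w e x)"
proof -
  interpret discrete_family F \<T> \<delta> \<Omega> B w by fact
  show ?thesis
  proof (unfold_locales, goal_cases)
    case 4 show ?case using fe by eventually_elim (rule fe_space_uminus)
  next
    case 10 show ?case using bounded by simp
  qed (use nontrivial op mesh step_pos size step ratio exhaust in auto)
qed

locale signed_family = discrete_family F \<T> \<delta> \<Omega> B w + neg: discrete_family F \<T> \<delta> \<Omega> B "\<lambda>e x. - w e x"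
  for F :: "'e filter" and \<T> :: "'e \<Rightarrow> (real^'n) set set" and \<delta> \<Omega> B w
begin

definition lower_limit :: "real^'n \<Rightarrow> real" where
  "lower_limit x = - neg.upper_limit x"

lemma lower_le_upper_limit:
  assumes x: "x \<in> \<Omega>" shows "lower_limit x \<le> upper_limit x"
proof (rule field_le_epsilon)
  fix k :: real assume k: "k > 0"
  obtain d where d: "d > 0" "\<forall>\<^sub>F e in F. \<forall>y\<in>D e. dist y x < d \<longrightarrow> w e y < upper_limit x + k / 2"
    using upper_limit_less[OF x, of "upper_limit x + k / 2"] k by auto
  obtain d' where d': "d' > 0" "\<forall>\<^sub>F e in F. \<forall>y\<in>D e. dist y x < d' \<longrightarrow> - w e y < neg.upper_limit x + k / 2"
    using neg.upper_limit_less[OF x, of "neg.upper_limit x + k / 2"] k by auto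
  have "\<forall>\<^sub>F e in F. w e x < upper_limit x + k / 2 \<and> - w e x < neg.upper_limit x + k / 2"
    using d(2) d'(2) eventually_in_mesh_domain[OF x] by eventually_elim (use d(1) d'(1) in auto)
  then obtain e where "w e x < upper_limit x + k / 2 \<and> - w e x < neg.upper_limit x + k / 2"
    using eventually_happens'[OF nontrivial] by blast
  then show "lower_limit x \<le> upper_limit x + k" unfolding lower_limit_def by linarith
qed

lemma lsc_lower_limit: "lsc_on \<Omega> lower_limit"
  unfolding lsc_on_def
proof (intro ballI allI impI)
  fix x c assume x: "x \<in> \<Omega>" and "c < lower_limit x"
  then have "neg.upper_limit x < - c" by (simp add: lower_limit_def)
  then have "\<forall>\<^sub>F y in nhds x. neg.upper_limit y < - c" using neg.usc_upper_limit x by (auto simp: usc_on_def)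
  then show "\<forall>\<^sub>F y in nhds x. c < lower_limit y" by eventually_elim (simp add: lower_limit_def)
qed

lemma lower_limit_ge_continuous:
  assumes x: "x \<in> \<Omega>" and l: "isCont l x" and le: "\<forall>\<^sub>F e in F. \<forall>y\<in>D e. l y \<le> w e y"
  shows "l x \<le> lower_limit x"
proof -
  have "neg.upper_limit x \<le> - l x"
    using le by (intro neg.upper_limit_le_continuous[OF x]) (auto intro!: continuous_minus l elim!: eventually_mono)
  then show ?thesis by (simp add: lower_limit_def)
qed

end

lemma orthonormal_basis_norm: "v \<in> orthonormal_bases \<Longrightarrow> norm (v j) = 1"
  by (simp add: orthonormal_bases_def norm_eq_1)

lemma orthonormal_bases_nonempty: "orthonormal_bases \<noteq> ({} :: ('n::finite \<Rightarrow> real^'n) set)"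
proof -
  have "\<exists>v :: 'n \<Rightarrow> real^'n. v \<in> orthonormal_bases"
    using symmetric_spectral[of "mat 1 :: real^'n^'n", OF transpose_scalar_mat] by metis
  then show ?thesis by blast
qed

text \<open>Lipschitz dependence of the form on the direction: it bounds the error of replacing an
  eigenbasis by a nearby basis from the net.\<close>

lemma quad_form_diff_le:
  fixes N :: "real^'n^'n"
  assumes C: "C \<ge> 0" "\<And>x. norm (N *v x) \<le> C * norm x" and n: "norm u = 1" "norm v = 1"
  shows "u \<bullet> (N *v u) \<le> v \<bullet> (N *v v) + 2 * C * norm (v - u)"
proof -
  have "u \<bullet> (N *v u) - v \<bullet> (N *v v) = (u - v) \<bullet> (N *v u) + v \<bullet> (N *v (u - v))"
    unfolding matrix_vector_mult_diff_distrib inner_diff_left inner_diff_right by simp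
  also have "\<dots> \<le> norm (u - v) * norm (N *v u) + norm v * norm (N *v (u - v))"
    by (intro add_mono norm_cauchy_schwarz)
  also have "norm (u - v) * norm (N *v u) \<le> norm (u - v) * C"
    using C(2)[of u] n(1) by (intro mult_left_mono) auto
  also have "norm v * norm (N *v (u - v)) \<le> C * norm (u - v)" using C(2)[of "u - v"] n(2) by simp
  also have "norm (u - v) * C + C * norm (u - v) = 2 * C * norm (v - u)"
    unfolding norm_minus_commute[of v u] by simp
  finally show ?thesis by linarith
qed

locale two_scale_family = signed_family F \<T> \<delta> \<Omega> B w
  for F :: "'e filter" and \<T> :: "'e \<Rightarrow> (real^'n) set set" and \<delta> \<Omega> B w +
  fixes f g :: "real^'n \<Rightarrow> real" and P :: "'e \<Rightarrow> ('n \<Rightarrow> real^'n) set" and \<theta> :: "'e \<Rightarrow> real"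
  assumes solution: "\<forall>\<^sub>F e in F. discrete_solution (\<T> e) (\<delta> e) (P e) f g (w e)"
    and net: "\<forall>\<^sub>F e in F. finite (P e) \<and> P e \<subseteq> orthonormal_bases \<and>
       (\<forall>v\<in>orthonormal_bases. \<exists>u\<in>P e. \<forall>j. norm (v j - u j) \<le> \<theta> e)"
    and angle: "(\<theta> \<longlongrightarrow> 0) F"
    and f_cont: "continuous_on \<Omega> f" and f_nonneg: "\<And>x. x \<in> \<Omega> \<Longrightarrow> 0 \<le> f x"
begin

text \<open>The minimum in the operator is bounded by its value at one basis, taken from the net
  close to an eigenbasis of \<open>M\<close>, where the second differences are at most eigenvalue
  plus \<open>t\<close>.\<close>

theorem upper_limit_subsolution: "subsolution \<Omega> f upper_limit"
  unfolding subsolution_def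
proof (intro ballI allI impI, elim conjE)
  fix a p and M :: "real^'n^'n"
  assume a: "a \<in> \<Omega>" and sym: "transpose M = M"
    and max: "\<forall>\<^sub>F x in nhds a. upper_limit x \<le> upper_limit a + quad p M (x - a)"
  obtain v c where v: "v \<in> orthonormal_bases" "\<And>i. M *v v i = c i *\<^sub>R v i" "det M = (\<Prod>i\<in>UNIV. c i)"
    using symmetric_spectral[OF sym] by blast
  have vM: "v j \<bullet> (M *v v j) = c j" for j
    unfolding v(2) using orthonormal_basis_norm[OF v(1), of j] by (simp add: norm_eq_1)
  obtain C where C: "C \<ge> 0" "\<And>x. norm (M *v x) \<le> C * norm x" "\<And>x. x \<bullet> (M *v x) \<le> C * (x \<bullet> x)"
    using quad_form_bound[of M] by blast
  define Q where "Q t = (\<Prod>j\<in>UNIV. max (c j + t) 0) - (\<Sum>j\<in>UNIV. - min (c j + t) 0)" for t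
  have le: "f a \<le> Q t" if t: "t > 0" for t
  proof (rule field_le_epsilon)
    fix k :: real assume k: "k > 0"
    have "\<forall>\<^sub>F x in nhds a. f a - k < f x" using a k by (intro eventually_nhds_less_continuous[OF op f_cont]) auto
    then obtain r where r: "r > 0" "\<And>x. dist x a < r \<Longrightarrow> f a - k < f x" unfolding eventually_nhds_metric by blast
    let ?Q = "\<lambda>e. \<exists>z\<in>interior_nodes (\<T> e). dist z a < r \<and>
      (\<forall>v. norm v = 1 \<longrightarrow> second_difference (\<T> e) (\<delta> e) (w e) z v \<le> v \<bullet> (M *v v) + t / 2)"
    have "((\<lambda>e. 2 * C * \<theta> e) \<longlongrightarrow> 2 * C * 0) F" by (intro tendsto_intros angle)
    then have "\<forall>\<^sub>F e in F. 2 * C * \<theta> e < t / 2" using t by (intro order_tendstoD(2)) auto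
    then have "\<forall>\<^sub>F e in F. ?Q e \<longrightarrow> f a - k \<le> Q t"
      using solution net
    proof eventually_elim
      case (elim e)
      show ?case
      proof
        assume "?Q e"
        then obtain z where z: "z \<in> interior_nodes (\<T> e)" "dist z a < r"
          "\<And>v. norm v = 1 \<Longrightarrow> second_difference (\<T> e) (\<delta> e) (w e) z v \<le> v \<bullet> (M *v v) + t / 2" by blast
        obtain u where u: "u \<in> P e" "\<And>j. norm (v j - u j) \<le> \<theta> e" using elim(3) v(1) by blast
        have un: "norm (u j) = 1" for j using u(1) elim(3) by (intro orthonormal_basis_norm) auto
        have "second_difference (\<T> e) (\<delta> e) (w e) z (u j) \<le> c j + t" for j
        proof -
          have "u j \<bullet> (M *v u j) \<le> c j + 2 * C * norm (v j - u j)"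
            using quad_form_diff_le[OF C(1,2) un[of j] orthonormal_basis_norm[OF v(1), of j]] by (simp add: vM)
          also have "2 * C * norm (v j - u j) \<le> 2 * C * \<theta> e" using u(2) C(1) by (intro mult_left_mono) auto
          finally show ?thesis using z(3)[OF un[of j]] elim(1) by linarith
        qed
        then have "two_scale_operator (\<T> e) (\<delta> e) (P e) (w e) z \<le> Q t"
          unfolding Q_def using elim(3) u(1) by (intro two_scale_operator_le[where v = u]) auto
        moreover have "two_scale_operator (\<T> e) (\<delta> e) (P e) (w e) z = f z"
          using elim(2) z(1) by (simp add: discrete_solution_def)
        ultimately show "f a - k \<le> Q t" using r(2)[OF z(2)] by linarith
      qed
    qed
    with upper_limit_touching[OF a sym max half_gt_zero[OF t] r(1)]
    have "\<exists>\<^sub>F e in F. f a - k \<le> Q t" by (rule frequently_rev_mp)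
    then show "f a \<le> Q t + k" using frequently_ex by fastforce
  qed
  have "(Q \<longlongrightarrow> Q 0) (at_right 0)" unfolding Q_def
    by (intro tendsto_diff tendsto_prod tendsto_sum tendsto_minus tendsto_max tendsto_min tendsto_add tendsto_const tendsto_ident_at)
  moreover have "\<forall>\<^sub>F t in at_right 0. f a \<le> Q t" using le by (auto simp: eventually_at_right_field intro!: exI[of _ 1])
  ultimately have Q0: "f a \<le> Q 0" by (rule tendsto_lowerbound[OF _ _ trivial_limit_at_right_real])
  \<comment> \<open>A negative eigenvalue would annihilate the product and leave a positive sum to
    subtract, making \<open>Q 0\<close> negative, against \<open>0 \<le> f a\<close>.\<close>
  have c0: "c j \<ge> 0" for j
  proof (rule ccontr)
    assume "\<not> ?thesis"
    then have cj: "c j < 0" by simp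
    then have "(\<Prod>j\<in>UNIV. max (c j + 0) 0) = 0"
      by (intro prod_zero) (auto intro!: exI[of _ j])
    moreover have "0 < (\<Sum>j\<in>UNIV. - min (c j + 0) 0)"
      by (rule sum_pos2[of UNIV j]) (use cj in auto)
    ultimately show False using Q0 f_nonneg[OF a] unfolding Q_def by linarith
  qed
  have "Q 0 = det M" using c0 by (simp add: Q_def v(3))
  moreover have "pos_semidef M"
    unfolding pos_semidef_def quadratic_form_eigenbasis[OF v(1,2)] using c0 by (auto intro!: sum_nonneg mult_nonneg_nonneg)
  ultimately show "pos_semidef M \<and> f a \<le> det M" using Q0 by simp
qed

text \<open>For every basis in \<open>P e\<close> the product of the second differences is at least
  the product of the diagonal entries of the lowered matrix, hence at least its determinant; the
  minimum inherits the bound.\<close>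

theorem lower_limit_supersolution: "supersolution \<Omega> f lower_limit"
  unfolding supersolution_def
proof (intro ballI allI impI, elim conjE)
  fix a p and M :: "real^'n^'n"
  assume a: "a \<in> \<Omega>" and sym: "transpose M = M" and pd: "pos_def M"
    and min: "\<forall>\<^sub>F x in nhds a. lower_limit a + quad p M (x - a) \<le> lower_limit x"
  have neg_mat: "(- M) *v x = - (M *v x)" for x
    by (simp add: vec_eq_iff matrix_vector_mult_def sum_negf)
  have nsym: "transpose (- M) = - M" using sym by (simp add: transpose_def vec_eq_iff)
  have max: "\<forall>\<^sub>F x in nhds a. neg.upper_limit x \<le> neg.upper_limit a + quad (- p) (- M) (x - a)"
    using min by eventually_elim (simp add: lower_limit_def quad_def neg_mat)
  obtain k0 where k0: "k0 > 0" "\<And>x. k0 * (x \<bullet> x) \<le> x \<bullet> (M *v x)" using pd by (auto simp: pos_def_def)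
  \<comment> \<open>With \<open>t < k0\<close> the lowered matrix stays positive definite, so the
    second differences are nonnegative and the subtracted sum vanishes.\<close>
  have le: "det (M + mat (- t)) \<le> f a" if t: "0 < t" "t < k0" for t
  proof (rule field_le_epsilon)
    fix k :: real assume k: "k > 0"
    define N where "N = M + mat (- t)"
    have Nsym: "transpose N = N" unfolding N_def by (rule transpose_add_mat[OF sym])
    have Nlow: "(k0 - t) * (x \<bullet> x) \<le> x \<bullet> (N *v x)" for x
      unfolding N_def quad_form_add_mat using k0(2)[of x] by (simp add: left_diff_distrib)
    have Npd: "pos_def N" unfolding pos_def_def using t Nlow by (intro exI[of _ "k0 - t"]) auto
    have "\<forall>\<^sub>F x in nhds a. - (f a + k) < - f x"
      using a k by (intro eventually_nhds_less_continuous[OF op]) (auto intro!: continuous_on_minus f_cont)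
    then have "\<forall>\<^sub>F x in nhds a. f x < f a + k" by eventually_elim simp
    then obtain r where r: "r > 0" "\<And>x. dist x a < r \<Longrightarrow> f x < f a + k" unfolding eventually_nhds_metric by blast
    let ?Q = "\<lambda>e. \<exists>z\<in>interior_nodes (\<T> e). dist z a < r \<and>
      (\<forall>v. norm v = 1 \<longrightarrow> second_difference (\<T> e) (\<delta> e) (\<lambda>x. - w e x) z v \<le> v \<bullet> ((- M) *v v) + t)"
    have "\<forall>\<^sub>F e in F. ?Q e \<longrightarrow> det N \<le> f a + k"
      using solution net
    proof eventually_elim
      case (elim e)
      show ?case
      proof
        assume "?Q e"
        then obtain z where z: "z \<in> interior_nodes (\<T> e)" "dist z a < r"
          "\<And>v. norm v = 1 \<Longrightarrow> - second_difference (\<T> e) (\<delta> e) (w e) z v \<le> v \<bullet> ((- M) *v v) + t"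
          unfolding second_difference_uminus by blast
        have sd: "v \<bullet> (N *v v) \<le> second_difference (\<T> e) (\<delta> e) (w e) z v" if "norm v = 1" for v
        proof -
          have "v \<bullet> v = 1" using that by (simp add: norm_eq_1)
          then show ?thesis using z(3)[OF that] by (simp add: N_def quad_form_add_mat neg_mat)
        qed
        have un: "norm (u j) = 1" if "u \<in> P e" for u j using that elim(2) by (intro orthonormal_basis_norm) auto
        have Npos: "0 \<le> x \<bullet> (N *v x)" for x using pos_def_imp_semidef[OF Npd] by (simp add: pos_semidef_def)
        have "det N \<le> two_scale_operator (\<T> e) (\<delta> e) (P e) (w e) z"
        proof (rule two_scale_operator_ge)
          show "finite (P e)" using elim(2) by blast
          show "P e \<noteq> {}" using elim(2) orthonormal_bases_nonempty by blast
          show "0 \<le> second_difference (\<T> e) (\<delta> e) (w e) z (u j)" if "u \<in> P e" for u j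
            using sd[OF un[OF that, of j]] Npos[of "u j"] by linarith
          show "det N \<le> (\<Prod>j\<in>UNIV. second_difference (\<T> e) (\<delta> e) (w e) z (u j))" if u: "u \<in> P e" for u
          proof -
            have "det N \<le> (\<Prod>j\<in>UNIV. u j \<bullet> (N *v u j))"
              using elim(2) u by (intro det_le_prod_orthonormal[OF Nsym Npd]) auto
            also have "\<dots> \<le> (\<Prod>j\<in>UNIV. second_difference (\<T> e) (\<delta> e) (w e) z (u j))"
              using sd[OF un[OF u]] Npos by (intro prod_mono) auto
            finally show ?thesis .
          qed
        qed
        moreover have "two_scale_operator (\<T> e) (\<delta> e) (P e) (w e) z = f z"
          using elim(1) z(1) by (simp add: discrete_solution_def)
        ultimately show "det N \<le> f a + k" using r(2)[OF z(2)] by linarith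
      qed
    qed
    with neg.upper_limit_touching[OF a nsym max t(1) r(1)]
    have "\<exists>\<^sub>F e in F. det N \<le> f a + k" by (rule frequently_rev_mp)
    then show "det (M + mat (- t)) \<le> f a + k" using frequently_ex unfolding N_def by fastforce
  qed
  have "((\<lambda>t. det (M + mat (- t))) \<longlongrightarrow> det M) (at_right 0)"
    by (rule tendsto_det_add_mat) (auto intro!: tendsto_eq_intros)
  moreover have "\<forall>\<^sub>F t in at_right 0. det (M + mat (- t)) \<le> f a"
    using le k0(1) by (auto simp: eventually_at_right_field intro!: exI[of _ k0])
  ultimately show "det M \<le> f a" by (rule tendsto_upperbound[OF _ _ trivial_limit_at_right_real])
qed

end

section \<open>Boundary barriers\<close>

lemma infdist_le_hausdorff_distance:
  fixes A B :: "'a::metric_space set"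
  assumes "bounded A" "B \<noteq> {}" "x \<in> A"
  shows "infdist x B \<le> hausdorff_distance A B"
proof -
  obtain b where b: "b \<in> B" using assms(2) by blast
  obtain c where c: "\<And>y. y \<in> A \<Longrightarrow> dist b y \<le> c" using assms(1) bounded_any_center[of A b] by blast
  have "bdd_above ((\<lambda>x. infdist x B) ` A)"
  proof (intro bdd_aboveI[of _ c])
    fix t assume "t \<in> (\<lambda>x. infdist x B) ` A"
    then obtain y where y: "y \<in> A" "t = infdist y B" by blast
    have "infdist y B \<le> dist y b" using b by (rule infdist_le)
    then show "t \<le> c" using c[OF y(1)] y(2) by (simp add: dist_commute)
  qed
  then have "infdist x B \<le> (SUP x\<in>A. infdist x B)" using assms(3) by (rule cSUP_upper[rotated])
  then show ?thesis by (simp add: hausdorff_distance_def)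
qed

text \<open>A point of the ball outside the convex set \<open>D\<close> is separated from it by a
  hyperplane. Moving a further distance \<open>r\<close> along the normal, away from
  \<open>D\<close>, stays in \<open>A\<close> but ends farther than \<open>r\<close> from
  \<open>D\<close>.\<close>

lemma cball_subset_of_hausdorff_distance:
  fixes D :: "'a::euclidean_space set"
  assumes "bounded A" and D: "closed D" "convex D" "D \<noteq> {}" and ball: "cball x (2 * r) \<subseteq> A" and r: "r > 0"
    and less: "hausdorff_distance A D < r"
  shows "cball x r \<subseteq> D"
proof (rule ccontr)
  assume "\<not> ?thesis"
  then obtain y where "y \<in> cball x r" and yD: "y \<notin> D" by blast
  then have y: "dist x y \<le> r" "y \<notin> D" by auto
  obtain a b where ab: "a \<bullet> y < b" "\<And>z. z \<in> D \<Longrightarrow> b < a \<bullet> z"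
    using separating_hyperplane_closed_point[OF D(2,1) y(2)] by blast
  have "a \<noteq> 0" using ab D(3) by fastforce
  define y' where "y' = y - (r / norm a) *\<^sub>R a"
  have "dist y y' = r" using \<open>a \<noteq> 0\<close> r by (simp add: y'_def dist_norm)
  then have "y' \<in> A" using ball y(1) dist_triangle[of x y' y] by auto
  obtain z where z: "z \<in> D" "infdist y' D = dist y' z" using infdist_attains_inf[OF D(1,3)] by blast
  have "a \<bullet> (z - y') = a \<bullet> z - a \<bullet> y + r * norm a"
    using \<open>a \<noteq> 0\<close> by (simp add: y'_def inner_diff_right power2_norm_eq_inner[symmetric] power2_eq_square)
  then have "r * norm a < a \<bullet> (z - y')" using ab(1) ab(2)[OF z(1)] by linarith
  also have "\<dots> \<le> norm a * norm (z - y')" by (rule norm_cauchy_schwarz)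
  finally have "norm a * r < norm a * dist y' z" by (simp add: dist_norm norm_minus_commute mult.commute)
  then have "r < dist y' z" by (rule mult_left_less_imp_less) simp
  then show False
    using z(2) infdist_le_hausdorff_distance[OF assms(1) D(3) \<open>y' \<in> A\<close>] less by linarith
qed

lemma supporting_normal:
  fixes \<Omega> :: "'a::euclidean_space set"
  assumes "open \<Omega>" "convex \<Omega>" "z \<in> frontier \<Omega>"
  obtains \<nu> where "norm \<nu> = 1" "\<And>x. x \<in> closure \<Omega> \<Longrightarrow> 0 \<le> \<nu> \<bullet> (x - z)"
proof -
  have "z \<in> closure \<Omega>" "z \<notin> rel_interior \<Omega>"
    using assms(1,3) by (auto simp: frontier_def rel_interior_open interior_open)
  then obtain a where a: "a \<noteq> 0" "\<And>y. y \<in> closure \<Omega> \<Longrightarrow> a \<bullet> z \<le> a \<bullet> y"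
    using supporting_hyperplane_relative_frontier[OF assms(2)] by metis
  show ?thesis
    by (rule that[of "(1 / norm a) *\<^sub>R a"]) (use a in \<open>auto simp: inner_diff_right divide_right_mono\<close>)
qed

text \<open>Uniform convexity gives \<open>|x - z|\<^sup>2 \<le> 2 R \<nu> \<bullet> (x - z)\<close> on the closure of \<open>\<Omega>\<close>, so a
  large multiple of \<open>\<nu> \<bullet> (x - z)\<close> dominates the oscillation of \<open>g\<close> and the quadratic term.\<close>

lemma boundary_barrier:
  fixes \<Omega> :: "(real^'n) set"
  assumes uc: "uniformly_convex \<Omega>" and op: "open \<Omega>" and bd: "bounded \<Omega>"
    and g: "continuous_on (closure \<Omega>) g" and z: "z \<in> frontier \<Omega>" and e: "e > 0" and A: "A \<ge> 0"
  obtains p where "\<And>x. x \<in> frontier \<Omega> \<Longrightarrow> (g z - e) + quad (- p) (mat A) (x - z) \<le> g x"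
    "\<And>x. x \<in> frontier \<Omega> \<Longrightarrow> g x \<le> (g z + e) + p \<bullet> (x - z)"
proof -
  have cv: "convex \<Omega>" using uc by (simp add: uniformly_convex_def)
  obtain R where R: "R > 0" "\<And>z \<nu>. z \<in> frontier \<Omega> \<Longrightarrow> norm \<nu> = 1 \<Longrightarrow> (\<forall>x\<in>\<Omega>. 0 \<le> \<nu> \<bullet> (x - z)) \<Longrightarrow> \<Omega> \<subseteq> cball (z + R *\<^sub>R \<nu>) R"
    using uc unfolding uniformly_convex_def by blast
  obtain \<nu> where \<nu>: "norm \<nu> = 1" "\<And>x. x \<in> closure \<Omega> \<Longrightarrow> 0 \<le> \<nu> \<bullet> (x - z)"
    using supporting_normal[OF op cv z] by blast
  have "\<Omega> \<subseteq> cball (z + R *\<^sub>R \<nu>) R" using R(2)[OF z \<nu>(1)] \<nu>(2) closure_subset by blast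
  then have clb: "closure \<Omega> \<subseteq> cball (z + R *\<^sub>R \<nu>) R" by (rule closure_minimal) simp
  have sq: "(x - z) \<bullet> (x - z) \<le> 2 * R * (\<nu> \<bullet> (x - z))" if x: "x \<in> closure \<Omega>" for x
  proof -
    have "norm ((x - z) - R *\<^sub>R \<nu>) \<le> R"
      using clb x by (auto simp: dist_norm norm_minus_commute algebra_simps)
    then have "(norm ((x - z) - R *\<^sub>R \<nu>))\<^sup>2 \<le> R\<^sup>2" by (intro power_mono) auto
    moreover have "(norm ((x - z) - R *\<^sub>R \<nu>))\<^sup>2 = (x - z) \<bullet> (x - z) - 2 * R * (\<nu> \<bullet> (x - z)) + R\<^sup>2 * (\<nu> \<bullet> \<nu>)"
      unfolding power2_norm_eq_inner
      by (simp only: inner_diff_left[of "x - z"] inner_diff_right[of _ "x - z"] inner_scaleR_left inner_scaleR_right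
          inner_commute[of "x - z" \<nu>]) (simp add: power2_eq_square right_diff_distrib)
    moreover have "\<nu> \<bullet> \<nu> = 1" using \<nu>(1) by (simp add: norm_eq_1)
    ultimately show ?thesis by simp
  qed
  have fr: "frontier \<Omega> \<subseteq> closure \<Omega>" by (simp add: frontier_def)
  have "compact (closure \<Omega>)" using bd by (simp add: compact_closure)
  then have "bounded (g ` closure \<Omega>)" using g by (intro compact_imp_bounded compact_continuous_image)
  then obtain G where G: "G > 0" "\<And>x. x \<in> closure \<Omega> \<Longrightarrow> \<bar>g x\<bar> \<le> G" by (auto simp: bounded_pos)
  obtain d where d: "d > 0" "\<And>x. x \<in> closure \<Omega> \<Longrightarrow> dist x z < d \<Longrightarrow> dist (g x) (g z) < e"
    using g z fr e unfolding continuous_on_iff by blast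
  \<comment> \<open>Beyond distance \<open>d\<close> from \<open>z\<close> the term with factor
    \<open>C\<close> is at least the full oscillation \<open>2 * G\<close>; within it,
    \<open>e\<close> suffices.\<close>
  define C where "C = 2 * G / d\<^sup>2"
  have C: "C \<ge> 0" using G by (simp add: C_def)
  have osc: "\<bar>g x - g z\<bar> \<le> e + C * ((x - z) \<bullet> (x - z))" if x: "x \<in> frontier \<Omega>" for x
  proof (cases "dist x z < d")
    case True
    then have "\<bar>g x - g z\<bar> < e" using d(2)[of x] x fr by (auto simp: dist_real_def)
    moreover have "0 \<le> C * ((x - z) \<bullet> (x - z))" using C by simp
    ultimately show ?thesis by linarith
  next
    case False
    then have "d\<^sup>2 \<le> (norm (x - z))\<^sup>2" using d(1) by (intro power_mono) (auto simp: dist_norm)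
    then have "C * d\<^sup>2 \<le> C * ((x - z) \<bullet> (x - z))" using C by (simp add: power2_norm_eq_inner mult_left_mono)
    moreover have "C * d\<^sup>2 = 2 * G" using d(1) by (simp add: C_def)
    moreover have "\<bar>g x\<bar> \<le> G" "\<bar>g z\<bar> \<le> G" using G(2) x z fr by auto
    ultimately show ?thesis using e by linarith
  qed
  \<comment> \<open>Through the enclosing ball of radius \<open>R\<close>, this slope dominates both
    the oscillation term with factor \<open>C\<close> and the barrier's own quadratic term.\<close>
  define K where "K = 2 * R * (C + A)"
  have K: "(C + A) * ((x - z) \<bullet> (x - z)) \<le> K * (\<nu> \<bullet> (x - z))" if "x \<in> frontier \<Omega>" for x
  proof -
    have "(C + A) * ((x - z) \<bullet> (x - z)) \<le> (C + A) * (2 * R * (\<nu> \<bullet> (x - z)))"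
      using sq[of x] that fr C A by (intro mult_left_mono) auto
    also have "\<dots> = K * (\<nu> \<bullet> (x - z))" unfolding K_def by (simp only: mult_ac)
    finally show ?thesis .
  qed
  have nn: "0 \<le> C * ((x - z) \<bullet> (x - z))" "0 \<le> A * ((x - z) \<bullet> (x - z))" for x using C A by auto
  show ?thesis
  proof (rule that[of "K *\<^sub>R \<nu>"])
    fix x assume x: "x \<in> frontier \<Omega>"
    have q: "quad (- (K *\<^sub>R \<nu>)) (mat A) (x - z) = - (K * (\<nu> \<bullet> (x - z))) + A * ((x - z) \<bullet> (x - z)) / 2"
      unfolding quad_def scalar_mat_mult_vec inner_minus_left inner_scaleR_left inner_scaleR_right ..
    show "(g z - e) + quad (- (K *\<^sub>R \<nu>)) (mat A) (x - z) \<le> g x"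
      using osc[OF x] K[OF x] nn[of x] unfolding q distrib_right by linarith
    show "g x \<le> (g z + e) + (K *\<^sub>R \<nu>) \<bullet> (x - z)"
      using osc[OF x] K[OF x] nn[of x] unfolding inner_scaleR_left distrib_right by linarith
  qed
qed

text \<open>The mesh domain is only known to lie in the closure, but a convex open set is the
  interior of its closure.\<close>

lemma interior_nodes_subset:
  fixes \<Omega> :: "(real^'n) set"
  assumes "simplicial_mesh \<T>" "mesh_domain \<T> \<subseteq> closure \<Omega>" "open \<Omega>" "convex \<Omega>"
  shows "interior_nodes \<T> \<subseteq> \<Omega>"
proof
  fix x assume "x \<in> interior_nodes \<T>"
  then have "x \<in> interior (closure \<Omega>)" using interior_nodes_interior[OF assms(1)] interior_mono[OF assms(2)] by blast
  then show "x \<in> \<Omega>" using assms(3,4) by (simp add: convex_interior_closure interior_open)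
qed

lemma discrete_solution_barriers:
  fixes \<Omega> :: "(real^'n) set"
  assumes T: "simplicial_mesh \<T>" and sol: "discrete_solution \<T> \<delta> P f g w" and \<delta>: "\<delta> > 0"
    and P: "finite P" "P \<noteq> {}" "P \<subseteq> orthonormal_bases"
    and dom: "boundary_nodes \<T> \<subseteq> frontier \<Omega>" "mesh_domain \<T> \<subseteq> closure \<Omega>"
    and op: "open \<Omega>" and cv: "convex \<Omega>" and y: "y \<in> mesh_domain \<T>"
  shows "A \<ge> 0 \<Longrightarrow> (\<And>x. x \<in> \<Omega> \<Longrightarrow> f x < A ^ CARD('n)) \<Longrightarrow>
      (\<And>x. x \<in> frontier \<Omega> \<Longrightarrow> c + quad p (mat A) (x - z) \<le> g x) \<Longrightarrow> c + quad p (mat A) (y - z) \<le> w y"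
    and "(\<And>x. x \<in> \<Omega> \<Longrightarrow> 0 \<le> f x) \<Longrightarrow>
      (\<And>x. x \<in> frontier \<Omega> \<Longrightarrow> g x \<le> c + p \<bullet> x) \<Longrightarrow> w y \<le> c + p \<bullet> y"
  using interior_nodes_subset[OF T dom(2) op cv] dom(1)
  by (auto intro!: discrete_lower_barrier[OF T sol \<delta> P _ _ _ y] discrete_upper_barrier[OF T sol \<delta> P _ _ y])

text \<open>A matrix touching from above dominates \<open>A\<close> times the identity, and the
  determinant increases above a positive definite matrix.\<close>

lemma quad_scalar_subsolution:
  fixes \<Omega> :: "(real^'n) set"
  assumes A: "A > 0" and f: "\<And>x. x \<in> \<Omega> \<Longrightarrow> f x \<le> A ^ CARD('n)"
  shows "subsolution \<Omega> f (\<lambda>x. c + quad p (mat A) (x - z))"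
  unfolding subsolution_def
proof (intro ballI allI impI, elim conjE)
  fix a p' and M :: "real^'n^'n" assume a: "a \<in> \<Omega>" and sym: "transpose M = M"
    and max: "\<forall>\<^sub>F x in nhds a. c + quad p (mat A) (x - z) \<le> c + quad p (mat A) (a - z) + quad p' M (x - a)"
  have "\<forall>\<^sub>F x in nhds a. quad (p + mat A *v (a - z)) (mat A) (x - a) \<le> quad p' M (x - a)"
    using max
  proof eventually_elim
    case (elim x)
    then show ?case using quad_recenter[OF transpose_scalar_mat, of p A x z a] by linarith
  qed
  from quad_le_near[OF this] have le: "y \<bullet> (mat A *v y) \<le> y \<bullet> (M *v y)" for y .
  have pd: "pos_def (mat A :: real^'n^'n)"
    unfolding pos_def_def scalar_mat_mult_vec using A by (intro exI[of _ A]) simp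
  have "det (mat A :: real^'n^'n) \<le> det M" by (rule det_mono[OF transpose_scalar_mat sym pd le])
  moreover have "pos_semidef M"
    using pos_def_imp_semidef[OF pd] le unfolding pos_semidef_def by (meson order_trans)
  ultimately show "pos_semidef M \<and> f a \<le> det M" using f[OF a] by (simp add: det_scalar_mat)
qed

text \<open>A concave function admits no positive definite quadratic touching from below, so the
  condition is vacuous.\<close>

lemma convex_minus_imp_supersolution:
  fixes V :: "real^'n \<Rightarrow> real"
  assumes "open \<Omega>" "convex_on \<Omega> (\<lambda>x. - V x)"
  shows "supersolution \<Omega> f V"
  unfolding supersolution_def
proof (intro ballI allI impI, elim conjE)
  fix a p and M :: "real^'n^'n" assume a: "a \<in> \<Omega>" and pd: "pos_def M"
    and min: "\<forall>\<^sub>F x in nhds a. V a + quad p M (x - a) \<le> V x"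
  have neg_mat: "(- M) *v x = - (M *v x)" for x
    by (simp add: vec_eq_iff matrix_vector_mult_def sum_negf)
  have "\<forall>\<^sub>F x in nhds a. - V x \<le> - V a + quad (- p) (- M) (x - a)"
    using min by eventually_elim (simp add: quad_def neg_mat)
  from convex_touching_quad_psd[OF assms(1) a assms(2) this]
  have neg: "x \<bullet> (M *v x) \<le> 0" for x by (simp add: pos_semidef_def neg_mat)
  obtain k where k: "k > 0" "\<And>x. k * (x \<bullet> x) \<le> x \<bullet> (M *v x)" using pd by (auto simp: pos_def_def)
  obtain v :: "'n \<Rightarrow> real^'n" where "v \<in> orthonormal_bases" using orthonormal_bases_nonempty by blast
  then have "v j \<bullet> v j = 1" for j by (simp add: orthonormal_bases_def)
  then have "k \<le> 0" using k(2)[of "v undefined"] neg[of "v undefined"] by simp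
  then show "det M \<le> f a" using k(1) by simp
qed

section \<open>Convergence\<close>

lemma (in two_scale_family) convergence_on_mesh_domain:
  assumes uc: "uniformly_convex \<Omega>" and bd: "Elementary_Metric_Spaces.bounded \<Omega>" and ne: "\<Omega> \<noteq> {}"
    and fc: "continuous_on (closure \<Omega>) f" and gc: "continuous_on (closure \<Omega>) g"
    and unique: "unique_viscosity_solution \<Omega> f g u"
    and dom: "\<forall>\<^sub>F e in F. boundary_nodes (\<T> e) \<subseteq> frontier \<Omega> \<and> D e \<subseteq> closure \<Omega>"
    and \<eta>: "\<eta> > 0"
  shows "\<forall>\<^sub>F e in F. \<forall>y\<in>D e. \<bar>w e y - u y\<bar> < \<eta>"
proof -
  have cv: "convex \<Omega>" using uc by (simp add: uniformly_convex_def)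
  have comp: "compact (closure \<Omega>)" using bd by (simp add: compact_closure)
  have fr: "frontier \<Omega> \<subseteq> closure \<Omega>" by (simp add: frontier_def)
  have clos: "x \<in> \<Omega> \<or> x \<in> frontier \<Omega>" if "x \<in> closure \<Omega>" for x
    using that op by (auto simp: frontier_def interior_open)
  have uvs: "viscosity_solution \<Omega> f g u" using unique by (simp add: unique_viscosity_solution_def)
  then have uc': "continuous_on (closure \<Omega>) u" and ug: "\<And>x. x \<in> frontier \<Omega> \<Longrightarrow> u x = g x"
    by (auto simp: viscosity_solution_def)
  have "Elementary_Metric_Spaces.bounded (f ` closure \<Omega>)" using fc comp by (intro compact_imp_bounded compact_continuous_image)
  then obtain G where G: "G > 0" "\<And>x. x \<in> closure \<Omega> \<Longrightarrow> \<bar>f x\<bar> \<le> G" by (auto simp: bounded_pos)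
  \<comment> \<open>Adding 1 makes \<open>A\<close> a strict bound of \<open>f\<close> and at least
    1, so that its power is no smaller.\<close>
  define A where "A = G + 1"
  have A: "A > 0" "A \<ge> 0" using G by (auto simp: A_def)
  have "A \<le> A ^ CARD('n)" using G by (intro self_le_power) (auto simp: A_def)
  then have fA: "f x < A ^ CARD('n)" if "x \<in> \<Omega>" for x
  proof -
    have "x \<in> closure \<Omega>" using that closure_subset by blast
    then have "\<bar>f x\<bar> \<le> G" by (rule G(2))
    then show ?thesis using \<open>A \<le> A ^ CARD('n)\<close> by (simp add: A_def)
  qed
  have lower: "\<forall>\<^sub>F e in F. \<forall>x\<in>D e. c + quad p (mat A) (x - z) \<le> w e x"
    if q: "\<And>x. x \<in> frontier \<Omega> \<Longrightarrow> c + quad p (mat A) (x - z) \<le> g x" for c p z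
    using mesh solution step_pos net dom
  proof eventually_elim
    case (elim e)
    have P: "finite (P e)" "P e \<noteq> {}" "P e \<subseteq> orthonormal_bases"
      using elim(4) orthonormal_bases_nonempty by blast+
    show ?case using elim(5) by (intro ballI discrete_solution_barriers(1)[OF elim(1,2,3) P _ _ op cv] A(2) fA q) auto
  qed
  have upper: "\<forall>\<^sub>F e in F. \<forall>x\<in>D e. w e x \<le> c + p \<bullet> x"
    if l: "\<And>x. x \<in> frontier \<Omega> \<Longrightarrow> g x \<le> c + p \<bullet> x" for c p
    using mesh solution step_pos net dom
  proof eventually_elim
    case (elim e)
    have P: "finite (P e)" "P e \<noteq> {}" "P e \<subseteq> orthonormal_bases"
      using elim(4) orthonormal_bases_nonempty by blast+
    show ?case using elim(5) by (intro ballI discrete_solution_barriers(2)[OF elim(1,2,3) P _ _ op cv] f_nonneg l) auto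
  qed
  have contq: "continuous_on S (\<lambda>x. c + quad p (mat A) (x - z))" for S c p z by (intro continuous_intros)
  have contl: "continuous_on S (\<lambda>x. c + p \<bullet> x)" for S c and p :: "real^'n" by (intro continuous_intros)
  have lower_limit_ge: "c + quad p (mat A) (x - z) \<le> lower_limit x"
    if "x \<in> \<Omega>" "\<And>x. x \<in> frontier \<Omega> \<Longrightarrow> c + quad p (mat A) (x - z) \<le> g x" for c p z x
    using lower[OF that(2)] contq[of UNIV c p z]
    by (intro lower_limit_ge_continuous[OF that(1), of "\<lambda>x. c + quad p (mat A) (x - z)"])
      (auto simp: continuous_on_eq_continuous_at)
  have upper_limit_le: "upper_limit x \<le> c + p \<bullet> x"
    if "x \<in> \<Omega>" "\<And>x. x \<in> frontier \<Omega> \<Longrightarrow> g x \<le> c + p \<bullet> x" for c p x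
    using upper[OF that(2)] contl[of UNIV c p]
    by (intro upper_limit_le_continuous[OF that(1), of "\<lambda>x. c + p \<bullet> x"]) (auto simp: continuous_on_eq_continuous_at)
  have barrier: "\<exists>p p' c. (\<forall>x\<in>frontier \<Omega>. (g z - e) + quad p (mat A) (x - z) \<le> g x) \<and>
     (\<forall>x\<in>frontier \<Omega>. g x \<le> c + p' \<bullet> x) \<and> c + p' \<bullet> z = g z + e"
    if ze: "z \<in> frontier \<Omega>" "e > 0" for z e
  proof -
    obtain p where p: "\<And>x. x \<in> frontier \<Omega> \<Longrightarrow> (g z - e) + quad (- p) (mat A) (x - z) \<le> g x"
      "\<And>x. x \<in> frontier \<Omega> \<Longrightarrow> g x \<le> (g z + e) + p \<bullet> (x - z)"
      using boundary_barrier[OF uc op bd gc ze A(2)] by blast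
    show ?thesis
      by (rule exI[of _ "- p"], rule exI[of _ p], rule exI[of _ "g z + e - p \<bullet> z"])
        (use p in \<open>simp add: inner_diff_right add_diff_eq diff_add_eq\<close>)
  qed
  have quadS: "(\<lambda>x. c + quad p (mat A) (x - z)) \<in> subsolutions_below \<Omega> f V"
    if q: "\<And>x. x \<in> frontier \<Omega> \<Longrightarrow> c + quad p (mat A) (x - z) \<le> g x"
      and V: "\<And>x. x \<in> \<Omega> \<Longrightarrow> lower_limit x \<le> V x" for c p z V
  proof -
    have "pos_semidef (mat A :: real^'n^'n)" using A by (simp add: pos_semidef_def scalar_mat_mult_vec)
    then have "convex_on \<Omega> (\<lambda>x. c + quad p (mat A) (x - z))"
      by (intro convex_on_quad cv transpose_scalar_mat)
    moreover have "subsolution \<Omega> f (\<lambda>x. c + quad p (mat A) (x - z))"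
      by (rule quad_scalar_subsolution[OF A(1) less_imp_le[OF fA]])
    moreover have "c + quad p (mat A) (x - z) \<le> V x" if x: "x \<in> \<Omega>" for x
      using lower_limit_ge[OF x q] V[OF x] by linarith
    ultimately show ?thesis by (simp add: subsolutions_below_def)
  qed
  obtain z0 where z0: "z0 \<in> frontier \<Omega>" using frontier_eq_empty[of \<Omega>] ne bd not_bounded_UNIV by blast
  \<comment> \<open>The step shared by both inequalities: Perron's method below the obstacle
    \<open>V\<close> yields a viscosity solution, and uniqueness identifies it with
    \<open>u\<close>.\<close>
  have solution_between: "\<exists>W. (\<forall>x\<in>\<Omega>. W x = u x) \<and> (\<forall>x\<in>\<Omega>. W x \<le> V x) \<and> (\<forall>v\<in>subsolutions_below \<Omega> f V. \<forall>x\<in>\<Omega>. v x \<le> W x)"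
    if V: "lsc_on \<Omega> V" "supersolution \<Omega> f V" "\<And>x. x \<in> \<Omega> \<Longrightarrow> lower_limit x \<le> V x"
      and Vl: "\<And>c p x. x \<in> \<Omega> \<Longrightarrow> \<forall>y\<in>frontier \<Omega>. g y \<le> c + p \<bullet> y \<Longrightarrow> V x \<le> c + p \<bullet> x" for V
  proof -
    have ne': "subsolutions_below \<Omega> f V \<noteq> {}"
      using barrier[OF z0 zero_less_one] quadS[OF _ V(3)] by blast
    have Vlow: "\<exists>v\<in>subsolutions_below \<Omega> f V. continuous_on (closure \<Omega>) v \<and> (\<forall>x\<in>frontier \<Omega>. v x \<le> g x) \<and> g z - e \<le> v z"
      if ze: "z \<in> frontier \<Omega>" "e > 0" for z e
    proof -
      obtain p where p: "\<forall>x\<in>frontier \<Omega>. (g z - e) + quad p (mat A) (x - z) \<le> g x" using barrier[OF ze] by blast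
      show ?thesis
        using quadS[OF _ V(3), of "g z - e" p z] p contq[of "closure \<Omega>" "g z - e" p z]
        by (intro bexI[of _ "\<lambda>x. (g z - e) + quad p (mat A) (x - z)"]) auto
    qed
    have Vup: "\<exists>l. continuous_on (closure \<Omega>) l \<and> (\<forall>x\<in>\<Omega>. V x \<le> l x) \<and> (\<forall>x\<in>frontier \<Omega>. g x \<le> l x) \<and> l z \<le> g z + e"
      if ze: "z \<in> frontier \<Omega>" "e > 0" for z e
    proof -
      obtain p' c where p: "\<forall>x\<in>frontier \<Omega>. g x \<le> c + p' \<bullet> x" "c + p' \<bullet> z = g z + e" using barrier[OF ze] by blast
      show ?thesis
        using p Vl contl[of "closure \<Omega>" c p'] by (intro exI[of _ "\<lambda>x. c + p' \<bullet> x"]) auto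
    qed
    have gf: "continuous_on (frontier \<Omega>) g" by (rule continuous_on_subset[OF gc fr])
    obtain W where W: "viscosity_solution \<Omega> f g W" "\<And>x. x \<in> \<Omega> \<Longrightarrow> W x \<le> V x"
      "\<And>v x. v \<in> subsolutions_below \<Omega> f V \<Longrightarrow> x \<in> \<Omega> \<Longrightarrow> v x \<le> W x"
      using perron[OF op cv f_cont f_nonneg gf V(1,2) ne' Vlow Vup] by blast
    have "\<forall>x\<in>closure \<Omega>. W x = u x" using unique W(1) by (simp add: unique_viscosity_solution_def)
    then show ?thesis using W(2,3) closure_subset[of \<Omega>] by (intro exI[of _ W]) auto
  qed
  have low: "u x \<le> lower_limit x" if x: "x \<in> \<Omega>" for x
  proof -
    have "\<exists>W. (\<forall>x\<in>\<Omega>. W x = u x) \<and> (\<forall>x\<in>\<Omega>. W x \<le> lower_limit x) \<and>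
       (\<forall>v\<in>subsolutions_below \<Omega> f lower_limit. \<forall>x\<in>\<Omega>. v x \<le> W x)"
    proof (rule solution_between[OF lsc_lower_limit lower_limit_supersolution])
      fix c p x assume x: "x \<in> \<Omega>" and l: "\<forall>y\<in>frontier \<Omega>. g y \<le> c + p \<bullet> y"
      have "upper_limit x \<le> c + p \<bullet> x" by (rule upper_limit_le[OF x]) (use l in blast)
      then show "lower_limit x \<le> c + p \<bullet> x" using lower_le_upper_limit[OF x] by linarith
    qed (rule order_refl)
    then obtain W where W: "\<forall>x\<in>\<Omega>. W x = u x" "\<forall>x\<in>\<Omega>. W x \<le> lower_limit x" by blast
    then show ?thesis using x by auto
  qed
  have up: "upper_limit x \<le> u x" if x: "x \<in> \<Omega>" for x
  proof -
    \<comment> \<open>All affine majorants of \<open>g\<close> on the frontier.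
      \<open>upper_limit\<close> lies below each of them, so their infimum \<open>V\<close> is
      finite.\<close>
    define I where "I = {(c, p). \<forall>x\<in>frontier \<Omega>. g x \<le> c + p \<bullet> x}"
    define V where "V x = (INF (c, p)\<in>I. c + p \<bullet> x)" for x
    have "I \<noteq> {}" using barrier[OF z0 zero_less_one] by (auto simp: I_def)
    have UI: "upper_limit x \<le> c + p \<bullet> x" if "x \<in> \<Omega>" "(c, p) \<in> I" for x c p
      using upper_limit_le[OF that(1), of c p] that(2) by (auto simp: I_def)
    have bdd: "bdd_below ((\<lambda>(c, p). c + p \<bullet> x) ` I)" if "x \<in> \<Omega>" for x
      using UI[OF that] by (intro bdd_belowI[of _ "upper_limit x"]) auto
    have UV: "upper_limit x \<le> V x" if "x \<in> \<Omega>" for x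
      unfolding V_def using UI[OF that] \<open>I \<noteq> {}\<close> by (intro cINF_greatest) auto
    have Vle: "V x \<le> c + p \<bullet> x" if "x \<in> \<Omega>" "(c, p) \<in> I" for x c p
      unfolding V_def using cINF_lower[OF bdd[OF that(1)] that(2)] by simp
    have Vcv: "convex_on \<Omega> (\<lambda>x. - V x)"
    proof (rule convex_onI[OF _ cv])
      fix t :: real and x y assume t: "0 < t" "t < 1" and xy: "x \<in> \<Omega>" "y \<in> \<Omega>"
      have "(1 - t) * V x + t * V y \<le> V ((1 - t) *\<^sub>R x + t *\<^sub>R y)"
        unfolding V_def[of "(1 - t) *\<^sub>R x + t *\<^sub>R y"]
      proof (rule cINF_greatest[OF \<open>I \<noteq> {}\<close>])
        fix i assume "i \<in> I"
        then obtain c p where i: "i = (c, p)" "(c, p) \<in> I" by (cases i) auto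
        have "(1 - t) * V x + t * V y \<le> (1 - t) * (c + p \<bullet> x) + t * (c + p \<bullet> y)"
          using Vle[OF xy(1) i(2)] Vle[OF xy(2) i(2)] t by (intro add_mono mult_left_mono) auto
        also have "\<dots> = c + p \<bullet> ((1 - t) *\<^sub>R x + t *\<^sub>R y)" by (simp add: inner_add_right algebra_simps)
        finally show "(1 - t) * V x + t * V y \<le> (case i of (c, p) \<Rightarrow> c + p \<bullet> ((1 - t) *\<^sub>R x + t *\<^sub>R y))"
          using i by simp
      qed
      then show "- V ((1 - t) *\<^sub>R x + t *\<^sub>R y) \<le> (1 - t) * - V x + t * - V y" by simp
    qed
    have "continuous_on \<Omega> V"
      using continuous_on_minus[OF convex_on_continuous[OF op Vcv]] unfolding minus_minus .
    then have "lsc_on \<Omega> V" by (rule continuous_on_open_imp_lsc[OF op])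
    moreover have "supersolution \<Omega> f V" by (rule convex_minus_imp_supersolution[OF op Vcv])
    moreover have "lower_limit x \<le> V x" if "x \<in> \<Omega>" for x
      using UV[OF that] lower_le_upper_limit[OF that] by linarith
    moreover have "V x \<le> c + p \<bullet> x" if "x \<in> \<Omega>" "\<forall>y\<in>frontier \<Omega>. g y \<le> c + p \<bullet> y" for c p x
      using Vle[OF that(1)] that(2) by (simp add: I_def)
    ultimately obtain W where W: "\<forall>x\<in>\<Omega>. W x = u x" "\<forall>v\<in>subsolutions_below \<Omega> f V. \<forall>x\<in>\<Omega>. v x \<le> W x"
      using solution_between by blast
    \<comment> \<open>This makes the relaxed upper limit itself a competitor below \<open>V\<close>,
      so maximality of \<open>W\<close> applies to it.\<close>
    have "convex_on \<Omega> upper_limit"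
      by (rule psd_tests_imp_convex[OF op cv usc_upper_limit subsolution_imp_psd_tests[OF upper_limit_subsolution]])
    then have "upper_limit \<in> subsolutions_below \<Omega> f V"
      using UV upper_limit_subsolution by (simp add: subsolutions_below_def)
    then have "upper_limit x \<le> W x" using W(2) x by blast
    then show ?thesis using W(1) x by simp
  qed
  have "\<forall>\<^sub>F e in F. \<forall>y\<in>D e \<inter> closure \<Omega>. \<bar>w e y - u y\<bar> < \<eta>"
  proof (rule eventually_uniform_on_compact[OF comp])
    fix x assume x: "x \<in> closure \<Omega>"
    obtain d0 where d0: "d0 > 0" "\<And>y. y \<in> closure \<Omega> \<Longrightarrow> dist y x < d0 \<Longrightarrow> dist (u y) (u x) < \<eta> / 2"
      using uc' x half_gt_zero[OF \<eta>] unfolding continuous_on_iff by blast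
    \<comment> \<open>Inside, closeness is read off from the relaxed limits; at the frontier the
      barriers pinch \<open>w e\<close> directly.\<close>
    have "\<exists>d>0. \<forall>\<^sub>F e in F. \<forall>y\<in>D e. dist y x < d \<longrightarrow> \<bar>w e y - u x\<bar> < \<eta> / 2"
    proof (cases "x \<in> \<Omega>")
      case True
      have "upper_limit x < u x + \<eta> / 2" using up[OF True] \<eta> by linarith
      then obtain d1 where d1: "d1 > 0" "\<forall>\<^sub>F e in F. \<forall>y\<in>D e. dist y x < d1 \<longrightarrow> w e y < u x + \<eta> / 2"
        using upper_limit_less[OF True] by blast
      have "neg.upper_limit x < - u x + \<eta> / 2" using low[OF True] \<eta> unfolding lower_limit_def by linarith
      then obtain d2 where d2: "d2 > 0" "\<forall>\<^sub>F e in F. \<forall>y\<in>D e. dist y x < d2 \<longrightarrow> - w e y < - u x + \<eta> / 2"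
        using neg.upper_limit_less[OF True] by blast
      have "\<forall>\<^sub>F e in F. \<forall>y\<in>D e. dist y x < min d1 d2 \<longrightarrow> \<bar>w e y - u x\<bar> < \<eta> / 2"
        using d1(2) d2(2)
      proof eventually_elim
        case (elim e)
        show ?case
        proof (intro ballI impI)
          fix y assume "y \<in> D e" "dist y x < min d1 d2"
          then have "w e y < u x + \<eta> / 2" "- w e y < - u x + \<eta> / 2" using elim by auto
          then show "\<bar>w e y - u x\<bar> < \<eta> / 2" by linarith
        qed
      qed
      then show ?thesis using d1(1) d2(1) by (intro exI[of _ "min d1 d2"]) auto
    next
      case False
      then have xf: "x \<in> frontier \<Omega>" using clos x by blast
      obtain p p' c where
        p: "\<forall>y\<in>frontier \<Omega>. (g x - \<eta> / 4) + quad p (mat A) (y - x) \<le> g y"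
          "\<forall>y\<in>frontier \<Omega>. g y \<le> c + p' \<bullet> y" "c + p' \<bullet> x = g x + \<eta> / 4"
        using barrier[OF xf, of "\<eta> / 4"] \<eta> by auto
      have "\<forall>\<^sub>F y in nhds x. g x - \<eta> / 2 < (g x - \<eta> / 4) + quad p (mat A) (y - x)"
        using \<eta> by (intro eventually_nhds_less_continuous[OF open_UNIV contq]) auto
      moreover have "\<forall>\<^sub>F y in nhds x. - (g x + \<eta> / 2) < - (c + p' \<bullet> y)"
        using \<eta> p(3) by (intro eventually_nhds_less_continuous[OF open_UNIV continuous_on_minus[OF contl]]) auto
      ultimately have "\<forall>\<^sub>F y in nhds x. g x - \<eta> / 2 < (g x - \<eta> / 4) + quad p (mat A) (y - x) \<and> c + p' \<bullet> y < g x + \<eta> / 2"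
        by eventually_elim simp
      then obtain d where d: "d > 0" "\<And>y. dist y x < d \<Longrightarrow>
          g x - \<eta> / 2 < (g x - \<eta> / 4) + quad p (mat A) (y - x) \<and> c + p' \<bullet> y < g x + \<eta> / 2"
        unfolding eventually_nhds_metric by blast
      have "\<forall>\<^sub>F e in F. \<forall>y\<in>D e. (g x - \<eta> / 4) + quad p (mat A) (y - x) \<le> w e y"
        by (rule lower) (use p(1) in blast)
      moreover have "\<forall>\<^sub>F e in F. \<forall>y\<in>D e. w e y \<le> c + p' \<bullet> y"
        by (rule upper) (use p(2) in blast)
      ultimately have "\<forall>\<^sub>F e in F. \<forall>y\<in>D e. dist y x < d \<longrightarrow> \<bar>w e y - u x\<bar> < \<eta> / 2"
      proof eventually_elim
        case (elim e)
        show ?case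
        proof (intro ballI impI)
          fix y assume y: "y \<in> D e" "dist y x < d"
          have "(g x - \<eta> / 4) + quad p (mat A) (y - x) \<le> w e y" "w e y \<le> c + p' \<bullet> y" using elim y(1) by blast+
          then show "\<bar>w e y - u x\<bar> < \<eta> / 2" using d(2)[OF y(2)] unfolding ug[OF xf] by linarith
        qed
      qed
      then show ?thesis using d(1) by blast
    qed
    then obtain d where d: "d > 0" "\<forall>\<^sub>F e in F. \<forall>y\<in>D e. dist y x < d \<longrightarrow> \<bar>w e y - u x\<bar> < \<eta> / 2" by blast
    have "\<forall>\<^sub>F e in F. \<forall>y\<in>D e. dist y x < min d d0 \<longrightarrow> \<bar>w e y - u y\<bar> < \<eta>"
      using d(2) dom
    proof eventually_elim
      case (elim e)
      show ?case
      proof (intro ballI impI)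
        fix y assume y: "y \<in> D e" "dist y x < min d d0"
        have "dist (u y) (u x) < \<eta> / 2" using d0(2)[of y] y elim(2) by auto
        moreover have "\<bar>w e y - u x\<bar> < \<eta> / 2" using elim(1) y by auto
        ultimately show "\<bar>w e y - u y\<bar> < \<eta>" unfolding dist_real_def by linarith
      qed
    qed
    then show "\<exists>d>0. \<forall>\<^sub>F e in F. \<forall>y\<in>D e. dist y x < d \<longrightarrow> \<bar>w e y - u y\<bar> < \<eta>"
      using d(1) d0(1) by (intro exI[of _ "min d d0"]) auto
  qed
  with dom show ?thesis by eventually_elim blast
qed

section \<open>The joint limit of the parameters\<close>

lemma eventually_two_scale_limit:
  "\<forall>\<^sub>F e in two_scale_limit H. fst e \<in> H \<and> 0 < fst (snd e) \<and> 0 < snd (snd e)"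
proof -
  have "\<forall>\<^sub>F e in two_scale_limit H. e \<in> {(h, \<delta>, \<theta>). h \<in> H \<and> 0 < \<delta> \<and> 0 < \<theta>}"
    unfolding two_scale_limit_def by (rule filter_leD[OF inf_le2]) (simp add: eventually_principal)
  then show ?thesis by eventually_elim auto
qed

lemma tendsto_two_scale_limit:
  shows "((\<lambda>e. fst e) \<longlongrightarrow> 0) (two_scale_limit H)" (is ?A)
    and "((\<lambda>e. fst (snd e)) \<longlongrightarrow> 0) (two_scale_limit H)" (is ?B)
    and "((\<lambda>e. snd (snd e)) \<longlongrightarrow> 0) (two_scale_limit H)" (is ?C)
    and "((\<lambda>e. fst e / fst (snd e)) \<longlongrightarrow> 0) (two_scale_limit H)" (is ?E)
proof -
  let ?G = "\<lambda>(h::real, \<delta>::real, \<theta>::real). (h, \<delta>, \<theta>, h / \<delta>)"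
  have G: "(?G \<longlongrightarrow> (0, 0, 0, 0)) (two_scale_limit H)"
    unfolding two_scale_limit_def by (rule filterlim_mono[OF filterlim_filtercomap]) auto
  show ?A ?B ?C ?E
    using tendsto_fst[OF G] tendsto_fst[OF tendsto_snd[OF G]] tendsto_fst[OF tendsto_snd[OF tendsto_snd[OF G]]]
      tendsto_snd[OF tendsto_snd[OF tendsto_snd[OF G]]]
    by (simp_all add: split_def)
qed

theorem theorem5p5:
  fixes \<Omega> :: "(real^'n) set"
    and f g u :: "real^'n \<Rightarrow> real"
    and H :: "real set"
    and \<T> :: "real \<Rightarrow> (real^'n) set set"
    and S :: "real \<Rightarrow> (real^'n) set"
    and P :: "real \<Rightarrow> ('n \<Rightarrow> real^'n) set"
    and u\<^sub>\<epsilon> :: "real \<Rightarrow> real \<Rightarrow> real \<Rightarrow> real^'n \<Rightarrow> real"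
  assumes "2 \<le> CARD('n)"
    and "open \<Omega>" "connected \<Omega>" "\<Omega> \<noteq> {}" "bounded \<Omega>"
    and "uniformly_convex \<Omega>"
    and "continuous_on (closure \<Omega>) f" "continuous_on (closure \<Omega>) g"
    and "\<forall>x\<in>\<Omega>. 0 \<le> f x"
    and "unique_viscosity_solution \<Omega> f g u"
    and "H \<subseteq> {0<..}"
    and "discretizes H \<T> \<Omega>" "shape_regular H \<T>" "quasi_uniform H \<T>"
    and "\<forall>\<theta>>0. direction_net \<theta> (S \<theta>) \<and> basis_net \<theta> (S \<theta>) (P \<theta>)"
    and "\<forall>h\<in>H. \<forall>\<delta>>0. \<forall>\<theta>>0. discrete_solution (\<T> h) \<delta> (P \<theta>) f g (u\<^sub>\<epsilon> h \<delta> \<theta>)"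
  shows "uniform_limit \<Omega> (\<lambda>(h, \<delta>, \<theta>). extend_closest (\<T> h) (u\<^sub>\<epsilon> h \<delta> \<theta>)) u (two_scale_limit H)"
proof (cases "two_scale_limit H = bot")
  \<comment> \<open>This happens when \<open>H\<close> does not accumulate at 0. It is split off
    because the relaxed limits require a nontrivial filter.\<close>
  case True
  then show ?thesis by (simp add: uniform_limit_iff)
next
  case False
  define F where "F = two_scale_limit H"
  define T where "T e = \<T> (fst e)" for e :: "real \<times> real \<times> real"
  define w where "w e = u\<^sub>\<epsilon> (fst e) (fst (snd e)) (snd (snd e))" for e :: "real \<times> real \<times> real"
  note op = \<open>open \<Omega>\<close> and bd = \<open>bounded \<Omega>\<close> and ne = \<open>\<Omega> \<noteq> {}\<close> and uc = \<open>uniformly_convex \<Omega>\<close>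
    and fc = \<open>continuous_on (closure \<Omega>) f\<close> and gc = \<open>continuous_on (closure \<Omega>) g\<close>
    and unique = \<open>unique_viscosity_solution \<Omega> f g u\<close>
  have cv: "convex \<Omega>" using uc by (simp add: uniformly_convex_def)
  have f0: "\<And>x. x \<in> \<Omega> \<Longrightarrow> 0 \<le> f x" using assms(9) by blast
  note lim = tendsto_two_scale_limit[of H, folded F_def] eventually_two_scale_limit[of H, folded F_def]
  have mesh: "simplicial_mesh (\<T> h)" "mesh_size (\<T> h) = h" "boundary_nodes (\<T> h) \<subseteq> frontier \<Omega>"
    "convex (mesh_domain (\<T> h))" "mesh_domain (\<T> h) \<subseteq> closure \<Omega>" if "h \<in> H" for h
    using assms(12) that by (auto simp: discretizes_def)
  have netP: "finite (P \<theta>) \<and> P \<theta> \<subseteq> orthonormal_bases \<and> (\<forall>v\<in>orthonormal_bases. \<exists>u\<in>P \<theta>. \<forall>j. norm (v j - u j) \<le> \<theta>)"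
    if "\<theta> > 0" for \<theta> using assms(15) that by (simp add: basis_net_def)
  have Dne: "closed (mesh_domain (\<T> h))" "mesh_domain (\<T> h) \<noteq> {}" if "h \<in> H" for h
    using compact_imp_closed[OF compact_mesh_domain[OF mesh(1)[OF that]]] nodes_nonempty[OF mesh(1)[OF that]]
      nodes_subset_mesh_domain[of "\<T> h"] by auto
  have evH: "\<forall>\<^sub>F e in F. fst e \<in> H" using lim(5) by eventually_elim blast
  \<comment> \<open>\<open>H\<close> contains only positive numbers, so \<open>h\<close> tends to 0
    through nonzero mesh sizes.\<close>
  have "filterlim fst (at 0 within H) F"
    unfolding filterlim_at
  proof
    show "\<forall>\<^sub>F e in F. fst e \<in> H \<and> fst e \<noteq> 0" using evH by eventually_elim (use assms(11) in auto)
  qed (rule lim(1))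
  then have haus: "((\<lambda>e. hausdorff_distance \<Omega> (mesh_domain (T e))) \<longlongrightarrow> 0) F"
    using assms(12) filterlim_compose[of "\<lambda>h. hausdorff_distance \<Omega> (mesh_domain (\<T> h))" "nhds 0" "at 0 within H" fst F]
    unfolding discretizes_def T_def by blast
  have exhaust: "\<exists>r>0. \<forall>\<^sub>F e in F. cball x r \<subseteq> mesh_domain (T e)" if x: "x \<in> \<Omega>" for x
  proof -
    obtain r where r: "r > 0" "cball x r \<subseteq> \<Omega>" using op x open_contains_cball by blast
    have "\<forall>\<^sub>F e in F. hausdorff_distance \<Omega> (mesh_domain (T e)) < r / 2"
      using r by (intro order_tendstoD(2)[OF haus]) simp
    then have "\<forall>\<^sub>F e in F. cball x (r / 2) \<subseteq> mesh_domain (T e)"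
      using evH
    proof eventually_elim
      case (elim e)
      show ?case
        unfolding T_def
        by (rule cball_subset_of_hausdorff_distance[OF bd Dne(1)[OF elim(2)] mesh(4)[OF elim(2)] Dne(2)[OF elim(2)]])
          (use r elim(1) in \<open>auto simp: T_def\<close>)
    qed
    then show ?thesis using r(1) by (intro exI[of _ "r / 2"]) simp
  qed
  have comp: "compact (closure \<Omega>)" using bd by (simp add: compact_closure)
  have "bounded (f ` closure \<Omega>)" by (rule compact_imp_bounded[OF compact_continuous_image[OF fc comp]])
  then obtain Gf where Gf: "Gf > 0" "\<And>x. x \<in> closure \<Omega> \<Longrightarrow> \<bar>f x\<bar> \<le> Gf" by (auto simp: bounded_pos)
  have "bounded (g ` closure \<Omega>)" by (rule compact_imp_bounded[OF compact_continuous_image[OF gc comp]])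
  then obtain Gg where Gg: "Gg > 0" "\<And>x. x \<in> closure \<Omega> \<Longrightarrow> \<bar>g x\<bar> \<le> Gg" by (auto simp: bounded_pos)
  obtain R where R: "R > 0" "\<And>x. x \<in> closure \<Omega> \<Longrightarrow> norm x \<le> R"
    using compact_imp_bounded[OF comp] unfolding bounded_pos by blast
  define A where "A = Gf + 1"
  have A: "A \<ge> 0" "A \<le> A ^ CARD('n)" using Gf(1) by (auto simp: A_def intro!: self_le_power)
  \<comment> \<open>The lower barrier has constant term \<open>- B\<close> and Hessian
    \<open>A\<close>; the summand \<open>A * R\<^sup>2 / 2\<close> keeps it below \<open>g\<close>
    on the frontier. The same \<open>B\<close> is a constant upper barrier.\<close>
  define B where "B = Gg + A * R\<^sup>2 / 2"
  have fr: "frontier \<Omega> \<subseteq> closure \<Omega>" by (simp add: frontier_def)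
  have bound: "\<forall>\<^sub>F e in F. \<forall>y\<in>mesh_domain (T e). \<bar>w e y\<bar> \<le> B"
    using lim(5)
  proof eventually_elim
    case (elim e)
    then have h: "fst e \<in> H" by blast
    note T = mesh(1)[OF h]
    have sol: "discrete_solution (T e) (fst (snd e)) (P (snd (snd e))) f g (w e)"
      using assms(16) elim by (auto simp: T_def w_def)
    have PP: "finite (P (snd (snd e)))" "P (snd (snd e)) \<noteq> {}" "P (snd (snd e)) \<subseteq> orthonormal_bases"
      using netP[of "snd (snd e)"] elim orthonormal_bases_nonempty by blast+
    note barriers = discrete_solution_barriers[OF T[folded T_def] sol _ PP mesh(3,5)[OF h, folded T_def] op cv]
    show ?case
    proof
      fix y assume y: "y \<in> mesh_domain (T e)"
      have q: "quad 0 (mat A) (x - 0) = A / 2 * (x \<bullet> x)" for x :: "real^'n"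
        by (simp add: quad_def scalar_mat_mult_vec)
      have "- B + quad 0 (mat A) (y - 0) \<le> w e y"
      proof (rule barriers(1)[OF _ y A(1)])
        show "f x < A ^ CARD('n)" if "x \<in> \<Omega>" for x
          using Gf(2)[of x] that closure_subset[of \<Omega>] A(2) by (auto simp: A_def)
        show "- B + quad 0 (mat A) (x - 0) \<le> g x" if "x \<in> frontier \<Omega>" for x
        proof -
          have x: "x \<in> closure \<Omega>" using that fr by blast
          have "(norm x)\<^sup>2 \<le> R\<^sup>2" using R(2)[OF x] by (intro power_mono) auto
          from mult_left_mono[OF this, of "A / 2"] have "A / 2 * (x \<bullet> x) \<le> A * R\<^sup>2 / 2"
            using A(1) by (simp add: power2_norm_eq_inner)
          then show ?thesis using Gg(2)[OF x] unfolding q B_def by linarith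
        qed
      qed (use elim in blast)
      moreover have "0 \<le> A / 2 * (y \<bullet> y)" using A(1) by simp
      moreover have "w e y \<le> B + 0 \<bullet> y"
      proof (rule barriers(2)[OF _ y f0])
        have "0 \<le> A * R\<^sup>2 / 2" using A(1) by simp
        then show "g x \<le> B + 0 \<bullet> x" if "x \<in> frontier \<Omega>" for x
          using Gg(2)[of x] that fr unfolding B_def inner_zero_left by force
      qed (use elim in blast)
      ultimately show "\<bar>w e y\<bar> \<le> B" unfolding q by simp
    qed
  qed
  have family: "discrete_family F T (\<lambda>e. fst (snd e)) \<Omega> B w"
  proof (unfold_locales, goal_cases)
    case 1 show ?case using False by (simp add: F_def)
  next
    case 2 show ?case by (rule op)
  next
    case 3 show ?case using evH unfolding T_def by eventually_elim (rule mesh)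
  next
    case 4 show ?case using lim(5)
      by eventually_elim (use assms(16) in \<open>auto simp: T_def w_def discrete_solution_def\<close>)
  next
    case 5 show ?case using lim(5) by eventually_elim blast
  next
    case 6
    have "\<forall>\<^sub>F e in F. fst e = mesh_size (T e)" using evH by eventually_elim (simp add: T_def mesh)
    from Lim_transform_eventually[OF lim(1) this] show ?case .
  next
    case 7 show ?case by (rule lim(2))
  next
    case 8
    have "\<forall>\<^sub>F e in F. fst e / fst (snd e) = mesh_size (T e) / fst (snd e)" using evH by eventually_elim (simp add: T_def mesh)
    from Lim_transform_eventually[OF lim(4) this] show ?case .
  next
    case (9 x) then show ?case by (rule exhaust)
  next
    case 10 show ?case by (rule bound)
  qed
  have dom: "\<forall>\<^sub>F e in F. boundary_nodes (T e) \<subseteq> frontier \<Omega> \<and> mesh_domain (T e) \<subseteq> closure \<Omega>"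
    using evH unfolding T_def by eventually_elim (rule conjI[OF mesh(3,5)])
  interpret two_scale_family F T "\<lambda>e. fst (snd e)" \<Omega> B w f g "\<lambda>e. P (snd (snd e))" "\<lambda>e. snd (snd e)"
  proof (intro two_scale_family.intro signed_family.intro two_scale_family_axioms.intro family discrete_family_uminus)
    show "\<forall>\<^sub>F e in F. discrete_solution (T e) (fst (snd e)) (P (snd (snd e))) f g (w e)"
      using lim(5) by eventually_elim (use assms(16) in \<open>auto simp: T_def w_def\<close>)
    show "\<forall>\<^sub>F e in F. finite (P (snd (snd e))) \<and> P (snd (snd e)) \<subseteq> orthonormal_bases \<and>
       (\<forall>v\<in>orthonormal_bases. \<exists>u\<in>P (snd (snd e)). \<forall>j. norm (v j - u j) \<le> snd (snd e))"
      using lim(5) by eventually_elim (use netP in blast)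
    show "((\<lambda>e. snd (snd e)) \<longlongrightarrow> 0) F" by (rule lim(3))
    show "continuous_on \<Omega> f" by (rule continuous_on_subset[OF fc closure_subset])
    show "0 \<le> f x" if "x \<in> \<Omega>" for x using that by (rule f0)
  qed
  have "continuous_on (closure \<Omega>) u"
    using unique unfolding unique_viscosity_solution_def viscosity_solution_def by blast
  then have ucont: "uniformly_continuous_on (closure \<Omega>) u" using comp by (rule compact_uniformly_continuous)
  show ?thesis
    unfolding F_def[symmetric]
  proof (rule uniform_limitI)
    fix \<eta> :: real assume \<eta>: "\<eta> > 0"
    obtain d where d: "d > 0" "\<And>x y. x \<in> closure \<Omega> \<Longrightarrow> y \<in> closure \<Omega> \<Longrightarrow> dist y x < d \<Longrightarrow> dist (u y) (u x) < \<eta> / 2"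
      using ucont half_gt_zero[OF \<eta>] unfolding uniformly_continuous_on_def by blast
    have "\<forall>\<^sub>F e in F. hausdorff_distance \<Omega> (mesh_domain (T e)) < d"
      using d(1) by (intro order_tendstoD(2)[OF haus]) simp
    with convergence_on_mesh_domain[OF uc bd ne fc gc unique dom half_gt_zero[OF \<eta>]] evH dom
    show "\<forall>\<^sub>F e in F. \<forall>x\<in>\<Omega>. dist ((case e of (h, \<delta>, \<theta>) \<Rightarrow> extend_closest (\<T> h) (u\<^sub>\<epsilon> h \<delta> \<theta>)) x) (u x) < \<eta>"
    proof eventually_elim
      case (elim e)
      have ext: "(case e of (h, \<delta>, \<theta>) \<Rightarrow> extend_closest (\<T> h) (u\<^sub>\<epsilon> h \<delta> \<theta>)) = extend_closest (T e) (w e)"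
        by (simp add: T_def w_def split_def)
      show ?case
        unfolding ext
      proof
        fix x assume x: "x \<in> \<Omega>"
        have xc: "x \<in> closure \<Omega>" using x closure_subset by blast
        note D = Dne[OF elim(2), folded T_def]
        \<comment> \<open>The point at which the extension evaluates \<open>w e\<close>. It lies
          within the Hausdorff distance of \<open>x\<close>, so uniform continuity of
          \<open>u\<close> compares the two values of \<open>u\<close>.\<close>
        define y where "y = (if x \<in> mesh_domain (T e) then x else closest_point (mesh_domain (T e)) x)"
        have y: "y \<in> mesh_domain (T e)" using closest_point_in_set[OF D] by (simp add: y_def)
        have ext_y: "extend_closest (T e) (w e) x = w e y" by (simp add: extend_closest_def y_def)
        have "dist y x \<le> infdist x (mesh_domain (T e))"
        proof (cases "x \<in> mesh_domain (T e)")
          case False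
          obtain z where "z \<in> mesh_domain (T e)" "infdist x (mesh_domain (T e)) = dist x z"
            using infdist_attains_inf[OF D] by blast
          then show ?thesis using closest_point_le[OF D(1), of z x] False by (simp add: y_def dist_commute)
        qed (simp add: y_def infdist_nonneg)
        also have "\<dots> \<le> hausdorff_distance \<Omega> (mesh_domain (T e))"
          by (rule infdist_le_hausdorff_distance[OF bd D(2) x])
        finally have "dist (u y) (u x) < \<eta> / 2" using elim y by (intro d(2)[OF xc]) auto
        moreover have "\<bar>w e y - u y\<bar> < \<eta> / 2" using elim(1) y by blast
        ultimately show "dist (extend_closest (T e) (w e) x) (u x) < \<eta>"
          unfolding ext_y dist_real_def by linarith
      qed
    qed
  qed
qed

end
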